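(* For every $n\ge1$, the Olshanski projection $\boldsymbol\mu_{n,n+1}:\boldsymbol\zeta(n+1)\to\boldsymbol\zeta(n)$ is the same map as $\boldsymbol\pi_{n,n+1}:\boldsymbol\zeta(n+1)\to\boldsymbol\zeta(n)$.
   Context: $\boldsymbol\zeta(n)$ is the center of $\mathbf{U}(gl(n))$, $gl(n)=gl(n,\mathbb C)$ with standard basis $e_{i,j}$; $\mathbf{U}(gl(n))\subset\mathbf{U}(gl(n+1))$ via $e_{i,j}\mapsto e_{i,j}$. For a matrix with noncommuting entries, $\mathbf{cdet}(A)=\sum_\sigma(-1)^{|\sigma|}a_{\sigma(1),1}\cdots a_{\sigma(k),k}$, and for $1\le k\le n$ $$\mathbf{H}_k(n)=\sum_{1\le i_1<\cdots<i_k\le n}\mathbf{cdet}\big[e_{i_a,i_b}+\delta_{ab}(k-a)\big]_{a,b=1,\dots,k}.$$ By a theorem of Capelli, $\mathbf{H}_1(n),\dots,\mathbf{H}_n(n)$ are algebraically independent generators of $\boldsymbol\zeta(n)$. The map $\boldsymbol\pi_{n,n+1}$ is the algebra map with $\boldsymbol\pi_{n,n+1}(\mathbf{H}_k(n+1))=\mathbf{H}_k(n)$ for $k=1,\dots,n$ and $\boldsymbol\pi_{n,n+1}(\mathbf{H}_{n+1}(n+1))=0$. The Olshanski projection: let $\mathbf{U}(gl(n+1))^0$ be the centralizer of $e_{n+1,n+1}$ in $\mathbf{U}(gl(n+1))$, let $\mathbf{I}(n+1)$ be the left ideal of $\mathbf{U}(gl(n+1))$ generated by $e_{i,n+1}$,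 $i=1,\dots,n+1$, and let $\mathbf{I}(n+1)^0=\mathbf{I}(n+1)\cap\mathbf{U}(gl(n+1))^0$, a two-sided ideal of $\mathbf{U}(gl(n+1))^0$. One has $\mathbf{U}(gl(n+1))^0=\mathbf{U}(gl(n))\oplus\mathbf{I}(n+1)^0$, and every $\boldsymbol\varrho\in\boldsymbol\zeta(n+1)$ decomposes uniquely as $\boldsymbol\varrho=\boldsymbol\varrho'+\boldsymbol\varrho^0$ with $\boldsymbol\varrho'\in\boldsymbol\zeta(n)$ and $\boldsymbol\varrho^0\in\mathbf{I}(n+1)^0$; $\boldsymbol\mu_{n,n+1}(\boldsymbol\varrho)=\boldsymbol\varrho'$. *)

theory Defs
  imports
    Complex_Main
    "HOL-Library.Poly_Mapping"
    "HOL-Combinatorics.Permutations"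
    "HOL-Algebra.QuotRing"
begin

(* Words under concatenation form a monoid, written additively so that the convolution product
   of finitely supported functions from Poly_Mapping is the product of the free algebra. *)

instantiation list :: (type) monoid_add
begin

definition zero_list :: "'a list" where "0 = []"
definition plus_list :: "'a list \<Rightarrow> 'a list \<Rightarrow> 'a list" where "xs + ys = xs @ ys"

instance
  by standard (simp_all add: zero_list_def plus_list_def)

end

type_synonym free_elt = "(nat \<times> nat) list \<Rightarrow>\<^sub>0 complex"

(* The free unital complex algebra on the letters (i, j) with 1 \<le> i, j \<le> n. *)

definition free_alg :: "nat \<Rightarrow> free_elt ring" where
  "free_alg n = \<lparr>carrier = {x. Poly_Mapping.keys x \<subseteq> lists ({1..n} \<times> {1..n})},
     mult = (*), one = 1, zero = 0, add = (+)\<rparr>"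

definition letter :: "nat \<Rightarrow> nat \<Rightarrow> free_elt" where
  "letter i j = Poly_Mapping.single [(i, j)] 1"

(* e_ij e_kl - e_kl e_ij = delta_jk e_il - delta_il e_kj, the bracket of gl(n) on the basis of
   matrix units; by bilinearity these relations generate the defining ideal of U(gl(n)). *)

definition gl_relations :: "nat \<Rightarrow> free_elt set" where
  "gl_relations n =
     {letter i j * letter k l - letter k l * letter i j
        - ((if j = k then letter i l else 0) - (if i = l then letter k j else 0)) | i j k l.
      i \<in> {1..n} \<and> j \<in> {1..n} \<and> k \<in> {1..n} \<and> l \<in> {1..n}}"

definition gl_ideal :: "nat \<Rightarrow> free_elt set" where
  "gl_ideal n = Idl\<^bsub>free_alg n\<^esub> (gl_relations n)"

definition Ugl :: "nat \<Rightarrow> free_elt set ring" where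
  "Ugl n = free_alg n Quot gl_ideal n"

definition Ugl_gen :: "nat \<Rightarrow> nat \<Rightarrow> nat \<Rightarrow> free_elt set" where
  "Ugl_gen n i j = gl_ideal n +>\<^bsub>free_alg n\<^esub> letter i j"

definition Ugl_scalar :: "nat \<Rightarrow> complex \<Rightarrow> free_elt set" where
  "Ugl_scalar n c = gl_ideal n +>\<^bsub>free_alg n\<^esub> Poly_Mapping.single 0 c"

(* The homomorphism U(gl(n)) \<rightarrow> U(gl(n+1)) with e_ij \<mapsto> e_ij: since gl_ideal n is contained in
   gl_ideal (n+1), the coset of x modulo the former determines the coset of x modulo the latter. *)

definition Ugl_embed :: "nat \<Rightarrow> free_elt set \<Rightarrow> free_elt set" where
  "Ugl_embed n X = the_elem ((\<lambda>x. gl_ideal (n + 1) +>\<^bsub>free_alg (n + 1)\<^esub> x) ` X)"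

definition centralizer :: "('a, 'b) ring_scheme \<Rightarrow> 'a set \<Rightarrow> 'a set" where
  "centralizer R S = {x \<in> carrier R. \<forall>s\<in>S. x \<otimes>\<^bsub>R\<^esub> s = s \<otimes>\<^bsub>R\<^esub> x}"

definition center :: "('a, 'b) ring_scheme \<Rightarrow> 'a set" where
  "center R = centralizer R (carrier R)"

definition left_ideal :: "'a set \<Rightarrow> ('a, 'b) ring_scheme \<Rightarrow> bool" where
  "left_ideal L R \<longleftrightarrow>
     additive_subgroup L R \<and> (\<forall>r\<in>carrier R. \<forall>x\<in>L. r \<otimes>\<^bsub>R\<^esub> x \<in> L)"

definition genleftideal :: "('a, 'b) ring_scheme \<Rightarrow> 'a set \<Rightarrow> 'a set" where
  "genleftideal R S = \<Inter>{L. left_ideal L R \<and> S \<subseteq> L}"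

abbreviation zeta :: "nat \<Rightarrow> free_elt set set" where
  "zeta n \<equiv> center (Ugl n)"

definition zeta_alg :: "nat \<Rightarrow> free_elt set ring" where
  "zeta_alg n = (Ugl n)\<lparr>carrier := zeta n\<rparr>"

(* Column determinant of a k \<times> k matrix indexed from 1; the factors are multiplied in the order
   of the columns 1, ..., k. *)

definition cdet :: "('a, 'b) ring_scheme \<Rightarrow> nat \<Rightarrow> (nat \<Rightarrow> nat \<Rightarrow> 'a) \<Rightarrow> 'a" where
  "cdet R k A =
     (\<Oplus>\<^bsub>R\<^esub>p\<in>{p. p permutes {1..k}}.
        [sign p] \<cdot>\<^bsub>R\<^esub> foldr (\<lambda>b x. A (p b) b \<otimes>\<^bsub>R\<^esub> x) [1..<k + 1] \<one>\<^bsub>R\<^esub>)"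

definition capelli_H :: "nat \<Rightarrow> nat \<Rightarrow> free_elt set" where
  "capelli_H n k =
     (\<Oplus>\<^bsub>Ugl n\<^esub>i\<in>{i \<in> {1..k} \<rightarrow>\<^sub>E {1..n}. strict_mono_on {1..k} i}.
        cdet (Ugl n) k (\<lambda>a b. Ugl_gen n (i a) (i b)
          \<oplus>\<^bsub>Ugl n\<^esub> (if a = b then [(k - a)] \<cdot>\<^bsub>Ugl n\<^esub> \<one>\<^bsub>Ugl n\<^esub> else \<zero>\<^bsub>Ugl n\<^esub>)))"

(* Maps out of a center are extensional (undefined outside it), so that equality of maps is
   equality of functions. *)

definition zeta_alg_homs :: "nat \<Rightarrow> nat \<Rightarrow> (free_elt set \<Rightarrow> free_elt set) set" where
  "zeta_alg_homs m n =
     {h \<in> ring_hom (zeta_alg m) (zeta_alg n) \<inter> extensional (zeta m).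
        \<forall>c. h (Ugl_scalar m c) = Ugl_scalar n c}"

definition capelli_proj :: "nat \<Rightarrow> free_elt set \<Rightarrow> free_elt set" where
  "capelli_proj n =
     (THE h. h \<in> zeta_alg_homs (n + 1) n \<and>
        (\<forall>k\<in>{1..n}. h (capelli_H (n + 1) k) = capelli_H n k) \<and>
        h (capelli_H (n + 1) (n + 1)) = \<zero>\<^bsub>Ugl n\<^esub>)"

definition olshanski_ideal :: "nat \<Rightarrow> free_elt set set" where
  "olshanski_ideal m = genleftideal (Ugl m) {Ugl_gen m i m | i. i \<in> {1..m}}"

definition olshanski_ideal0 :: "nat \<Rightarrow> free_elt set set" where
  "olshanski_ideal0 m = olshanski_ideal m \<inter> centralizer (Ugl m) {Ugl_gen m m m}"

definition olshanski_proj :: "nat \<Rightarrow> free_elt set \<Rightarrow> free_elt set" where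
  "olshanski_proj n =
     (\<lambda>r\<in>zeta (n + 1). THE r'. r' \<in> zeta n \<and>
        (\<exists>r0\<in>olshanski_ideal0 (n + 1). r = Ugl_embed n r' \<oplus>\<^bsub>Ugl (n + 1)\<^esub> r0))"

end

theory Submission
  imports Defs "HOL-Analysis.Derivative"
begin

text \<open>The polynomial functions on matrices form a bimodule over the enveloping algebra, and letting an element
  act on the constant 1 gives a linear map \<open>symbol\<close> that is injective by Poincare-Birkhoff-Witt and equivariant
  for the adjoint action. It sends central elements to invariants and, by the Capelli identity, \<open>H\<^sub>k(n)\<close> to the
  sum of the principal \<open>k\<close>-minors. An invariant is determined by its restriction to diagonal matrices, which is a
  symmetric polynomial, so the elements \<open>H\<^sub>k(n)\<close> generate the center. The symbols of the left ideal
  generated by the \<open>e\<^sub>i\<^sub>,\<^sub>n\<^sub>+\<^sub>1\<close> involve the last column in every monomial, so this ideal meets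
  \<open>U(gl(n))\<close> trivially. Finally a column determinant whose last index is \<open>n + 1\<close> ends in some
  \<open>e\<^sub>i\<^sub>,\<^sub>n\<^sub>+\<^sub>1\<close>, because the shift vanishes in the last column; hence \<open>H\<^sub>k(n + 1)\<close> and \<open>H\<^sub>k(n)\<close> agree modulo
  the ideal, and the two maps agree on generators.\<close>

section \<open>Derivations of polynomial rings\<close>

text \<open>The symbol is not multiplicative, so products are controlled through leading terms only:
  in top degree the symbol of \<open>x\<close> is the commutative image of \<open>x\<close>, and
  taking commutative images is multiplicative. This is why generation of the center is proved by
  induction on the degree, and why the statement on diagonal restrictions concerns the coefficients
  of one degree at a time. The decomposition of a central element is treated as a relation between
  \<open>r\<close> and \<open>r'\<close>. The relation is closed under sums and products and holds
  for scalars and Capelli elements, so generation of the center yields a decomposition of every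
  central element; its uniqueness is the trivial intersection with the left ideal. The map described
  by \<open>capelli_proj\<close> exists because the Olshanski projection has the prescribed values,
  and it is unique because its values on generators are prescribed.\<close>

lemma additive_cong_single:
  fixes f g :: "('k \<Rightarrow>\<^sub>0 complex) \<Rightarrow> 'r::ab_group_add"
  assumes "additive f" "additive g"
    and "\<And>k c. k \<in> Poly_Mapping.keys p \<Longrightarrow> f (Poly_Mapping.single k c) = g (Poly_Mapping.single k c)"
  shows "f p = g p"
proof -
  have p: "p = (\<Sum>k\<in>Poly_Mapping.keys p. Poly_Mapping.single k (Poly_Mapping.lookup p k))"
    by (rule poly_mapping_eqI) (auto simp: lookup_sum lookup_single when_def not_in_keys_iff_lookup_eq_zero)
  show ?thesis
    by (subst (1 2) p) (simp add: additive.sum[OF assms(1)] additive.sum[OF assms(2)] assms(3))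
qed

text \<open>As in the preceding lemma, single terms are considered only on the support of
  \<open>p\<close>, so that hypotheses about the words or monomials occurring in \<open>p\<close>
  stay available in the induction.\<close>

lemma poly_mapping_single_induct:
  fixes p :: "'k \<Rightarrow>\<^sub>0 complex"
  assumes "P 0" "\<And>k c. k \<in> Poly_Mapping.keys p \<Longrightarrow> P (Poly_Mapping.single k c)"
    and "\<And>p q. P p \<Longrightarrow> P q \<Longrightarrow> P (p + q)"
  shows "P p"
proof -
  have p: "p = (\<Sum>k\<in>Poly_Mapping.keys p. Poly_Mapping.single k (Poly_Mapping.lookup p k))"
    by (rule poly_mapping_eqI) (auto simp: lookup_sum lookup_single when_def not_in_keys_iff_lookup_eq_zero)
  have "P (\<Sum>k\<in>K. Poly_Mapping.single k (Poly_Mapping.lookup p k))"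
    if "finite K" "K \<subseteq> Poly_Mapping.keys p" for K
    using that by (induction K rule: finite_induct) (auto intro: assms)
  then show ?thesis
    by (subst p) simp
qed

definition lin_ext :: "(complex \<Rightarrow> 'r::ring_1) \<Rightarrow> ('k \<Rightarrow> 'r) \<Rightarrow> ('k \<Rightarrow>\<^sub>0 complex) \<Rightarrow> 'r" where
  "lin_ext sc h p = (\<Sum>k\<in>Poly_Mapping.keys p. sc (Poly_Mapping.lookup p k) * h k)"

lemma additive_lin_ext:
  assumes "additive sc"
  shows "additive (lin_ext sc h)"
proof
  fix p q :: "'b \<Rightarrow>\<^sub>0 complex"
  let ?S = "Poly_Mapping.keys p \<union> Poly_Mapping.keys q"
  have *: "lin_ext sc h r = (\<Sum>k\<in>?S. sc (Poly_Mapping.lookup r k) * h k)"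
    if "Poly_Mapping.keys r \<subseteq> ?S" for r :: "'b \<Rightarrow>\<^sub>0 complex"
    unfolding lin_ext_def
    by (rule sum.mono_neutral_left)
      (use that assms in \<open>auto simp: not_in_keys_iff_lookup_eq_zero additive.zero[OF assms]\<close>)
  have "lin_ext sc h (p + q) = (\<Sum>k\<in>?S. sc (Poly_Mapping.lookup (p + q) k) * h k)"
    by (rule *) (rule Poly_Mapping.keys_add)
  also have "\<dots> = lin_ext sc h p + lin_ext sc h q"
    by (simp add: * lookup_add additive.add[OF assms] distrib_right sum.distrib)
  finally show "lin_ext sc h (p + q) = lin_ext sc h p + lin_ext sc h q" .
qed

lemma lin_ext_single:
  assumes "additive sc"
  shows "lin_ext sc h (Poly_Mapping.single k c) = sc c * h k"
  using additive.zero[OF assms] by (cases "c = 0") (simp_all add: lin_ext_def)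

lemma additive_id: "additive (\<lambda>x. x)"
  by (simp add: additive_def)

lemma additive_compose: "additive f \<Longrightarrow> additive g \<Longrightarrow> additive (\<lambda>x. f (g x))"
  by (simp add: additive_def)

lemma additive_plus: "additive f \<Longrightarrow> additive g \<Longrightarrow> additive (\<lambda>x. f x + g x)"
  for f g :: "'a::ab_group_add \<Rightarrow> 'b::ab_group_add"
  by (simp add: additive_def)

lemma additive_diff: "additive f \<Longrightarrow> additive g \<Longrightarrow> additive (\<lambda>x. f x - g x)"
  for f g :: "'a::ab_group_add \<Rightarrow> 'b::ab_group_add"
  by (simp add: additive_def)

lemma additive_mult_left: "additive f \<Longrightarrow> additive (\<lambda>x. a * f x)" for a :: "'a::ring"
  by (simp add: additive_def distrib_left)

lemma additive_mult_right: "additive f \<Longrightarrow> additive (\<lambda>x. f x * a)" for a :: "'a::ring"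
  by (simp add: additive_def distrib_right)

lemma additive_lookup: "additive f \<Longrightarrow> additive (\<lambda>p. Poly_Mapping.lookup (f p) k)"
  for f :: "_ \<Rightarrow> 'k \<Rightarrow>\<^sub>0 complex"
  by (simp add: additive_def lookup_add)

lemmas additive_intros =
  additive_id additive_plus additive_diff additive_mult_left additive_mult_right additive_lookup

section \<open>Scalars, monomials and variables\<close>

definition cst :: "complex \<Rightarrow> ('k::monoid_add \<Rightarrow>\<^sub>0 complex)" where
  "cst c = Poly_Mapping.single 0 c"

definition mon :: "'k \<Rightarrow> ('k \<Rightarrow>\<^sub>0 complex)" where
  "mon k = Poly_Mapping.single k 1"

lemma additive_cst: "additive cst"
  by (simp add: additive_def cst_def single_add)

lemma cst_0 [simp]: "cst 0 = 0" and cst_1 [simp]: "cst 1 = 1"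
  by (simp_all add: cst_def)

lemma cst_mult: "cst (c * d) = cst c * cst d"
  by (simp add: cst_def mult_single)

lemma cst_add: "cst (c + d) = cst c + cst d"
  by (simp add: cst_def single_add)

lemma cst_of_nat [simp]: "cst (of_nat n) = of_nat n"
  by (simp add: cst_def)

lemma cst_mult_mon: "cst c * mon k = Poly_Mapping.single k c"
  by (simp add: cst_def mon_def mult_single)

lemma lookup_cst_mult [simp]:
  "Poly_Mapping.lookup (cst c * p) k = c * Poly_Mapping.lookup p k"
proof (rule additive_cong_single[of "\<lambda>p. Poly_Mapping.lookup (cst c * p) k" "\<lambda>p. c * Poly_Mapping.lookup p k"])
  show "Poly_Mapping.lookup (cst c * Poly_Mapping.single l d) k = c * Poly_Mapping.lookup (Poly_Mapping.single l d) k" for l d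
    by (simp add: cst_def mult_single lookup_single when_def)
qed (intro additive_intros)+

lemma cst_mult_commute: "cst c * p = p * cst c"
proof (rule additive_cong_single[of "\<lambda>p. cst c * p" "\<lambda>p. p * cst c"])
  show "cst c * Poly_Mapping.single k d = Poly_Mapping.single k d * cst c" for k d
    by (simp add: cst_def mult_single mult.commute)
qed (intro additive_intros)+

lemma mon_0 [simp]: "mon 0 = 1"
  by (simp add: mon_def)

lemma mon_add: "mon (k + l) = mon k * mon l"
  by (simp add: mon_def mult_single)

text \<open>Multisets over \<open>'v\<close> index the commutative monomials, so finitely supported
  functions on them, under convolution, are the polynomial ring in the variables
  \<open>'v\<close>.\<close>

definition var :: "'v \<Rightarrow> ('v multiset \<Rightarrow>\<^sub>0 complex)" where
  "var v = mon {#v#}"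

lemma mon_add_mset: "mon (add_mset v m) = var v * mon m"
  by (simp add: var_def mon_add[symmetric])

lemma mon_conv_prod_var: "mon m = (\<Prod>v\<in>#m. var v)"
  by (induction m) (simp_all add: mon_add_mset)

lemma mpoly_induct [case_names cst add var]:
  fixes p :: "'v multiset \<Rightarrow>\<^sub>0 complex"
  assumes cst: "\<And>c. P (cst c)" and add: "\<And>p q. P p \<Longrightarrow> P q \<Longrightarrow> P (p + q)"
    and var: "\<And>v p. P p \<Longrightarrow> P (var v * p)"
  shows "P p"
proof (rule poly_mapping_single_induct)
  show "P 0" using cst[of 0] by simp
  show "P (Poly_Mapping.single m c)" for m c
  proof (induction m)
    case empty
    then show ?case using cst[of c] by (simp add: cst_def)
  next
    case (add v m)
    have "Poly_Mapping.single (add_mset v m) c = var v * Poly_Mapping.single m c"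
      by (simp add: var_def mon_def mult_single)
    then show ?case using var[OF add] by simp
  qed
qed (rule add)

text \<open>The derivation with value \<open>g v\<close> at the variable \<open>v\<close>. The sum
  runs over the multiset with multiplicity, which produces the exponent in the derivative of a
  power.\<close>

definition der :: "('v \<Rightarrow> ('v multiset \<Rightarrow>\<^sub>0 complex)) \<Rightarrow> ('v multiset \<Rightarrow>\<^sub>0 complex) \<Rightarrow> ('v multiset \<Rightarrow>\<^sub>0 complex)" where
  "der g = lin_ext cst (\<lambda>m. \<Sum>v\<in>#m. g v * mon (m - {#v#}))"

lemma additive_der: "additive (der g)"
  unfolding der_def by (intro additive_lin_ext additive_cst)

lemmas additive_der_intro = additive_compose[OF additive_der]
lemmas der_add = additive.add[OF additive_der]
lemmas der_sum = additive.sum[OF additive_der]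
lemmas der_0 [simp] = additive.zero[OF additive_der]

lemma der_single: "der g (Poly_Mapping.single m c) = cst c * (\<Sum>v\<in>#m. g v * mon (m - {#v#}))"
  unfolding der_def by (simp add: lin_ext_single additive_cst)

lemma der_mon: "der g (mon m) = (\<Sum>v\<in>#m. g v * mon (m - {#v#}))"
  by (simp add: mon_def der_single)

lemma der_cst [simp]: "der g (cst c) = 0"
proof -
  have c: "cst c = Poly_Mapping.single {#} c" by (simp add: cst_def)
  show ?thesis by (subst c, subst der_single) simp
qed

lemma der_1 [simp]: "der g 1 = 0"
  using der_cst[of g 1] by simp

lemma der_cst_mult: "der g (cst c * p) = cst c * der g p"
proof (rule additive_cong_single[of "\<lambda>p. der g (cst c * p)" "\<lambda>p. cst c * der g p"])
  show "der g (cst c * Poly_Mapping.single k d) = cst c * der g (Poly_Mapping.single k d)" for k d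
    by (simp add: cst_def[of c] mult_single der_single) (simp add: cst_mult mult.assoc flip: cst_def)
qed (intro additive_der_intro additive_intros)+

lemma der_var_mult: "der g (var v * p) = g v * p + var v * der g p"
proof (rule additive_cong_single[of "\<lambda>p. der g (var v * p)" "\<lambda>p. g v * p + var v * der g p"])
  fix m and c
  have *: "der g (var v * mon m) = g v * mon m + var v * der g (mon m)"
  proof -
    have "(\<Sum>x\<in>#m. g x * mon (add_mset v m - {#x#})) = (\<Sum>x\<in>#m. var v * (g x * mon (m - {#x#})))"
    proof (rule arg_cong[where f = sum_mset], rule image_mset_cong)
      fix x assume "x \<in># m"
      then have "add_mset v m - {#x#} = add_mset v (m - {#x#})"
        by simp
      then show "g x * mon (add_mset v m - {#x#}) = var v * (g x * mon (m - {#x#}))"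
        by (simp add: mon_add_mset ac_simps)
    qed
    then show ?thesis
      by (simp flip: mon_add_mset add: der_mon sum_mset_distrib_left)
  qed
  have "der g (var v * Poly_Mapping.single m c) = cst c * der g (var v * mon m)"
    by (simp flip: cst_mult_mon der_cst_mult add: ac_simps)
  also have "\<dots> = g v * Poly_Mapping.single m c + var v * der g (Poly_Mapping.single m c)"
    unfolding * by (simp flip: cst_mult_mon add: der_cst_mult algebra_simps)
  finally show "der g (var v * Poly_Mapping.single m c) = g v * Poly_Mapping.single m c + var v * der g (Poly_Mapping.single m c)" .
qed (intro additive_der_intro additive_intros)+

lemma der_var [simp]: "der g (var v) = g v"
  using der_var_mult[of g v 1] by simp

lemma der_mult: "der g (p * q) = der g p * q + p * der g q"
proof (induction p rule: mpoly_induct)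
  case (var v p)
  then show ?case
    by (simp only: mult.assoc der_var_mult) (simp add: algebra_simps)
qed (simp_all add: der_cst_mult der_add distrib_left distrib_right)

text \<open>The commutator of two derivations is a derivation, hence vanishes as soon as it vanishes
  on the variables.\<close>

lemma der_commute:
  assumes "\<And>v. der g (h v) = der h (g v)"
  shows "der g (der h p) = der h (der g p)"
  by (induction p rule: mpoly_induct)
    (simp_all add: der_add der_mult assms distrib_left distrib_right)

lemma der_minus_fun: "der (\<lambda>v. g v - h v) p = der g p - der h p"
  by (induction p rule: mpoly_induct) (simp_all add: der_var_mult der_add right_diff_distrib left_diff_distrib)

lemma der_prod:
  assumes "finite A"
  shows "der g (\<Prod>a\<in>A. f a) = (\<Sum>a\<in>A. der g (f a) * (\<Prod>b\<in>A - {a}. f b))"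
  using assms
proof (induction A rule: finite_induct)
  case (insert x A)
  have *: "(\<Sum>a\<in>A. der g (f a) * (\<Prod>b\<in>insert x A - {a}. f b))
      = f x * (\<Sum>a\<in>A. der g (f a) * (\<Prod>b\<in>A - {a}. f b))"
    unfolding sum_distrib_left
  proof (rule sum.cong[OF refl])
    fix a assume "a \<in> A"
    then have "insert x A - {a} = insert x (A - {a})" and "x \<notin> A - {a}" "finite (A - {a})"
      using insert.hyps by auto
    then show "der g (f a) * (\<Prod>b\<in>insert x A - {a}. f b) = f x * (der g (f a) * (\<Prod>b\<in>A - {a}. f b))"
      by (metis prod.insert mult.left_commute)
  qed
  have "insert x A - {x} = A"
    using insert.hyps by auto
  then have "(\<Sum>a\<in>insert x A. der g (f a) * (\<Prod>b\<in>insert x A - {a}. f b))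
     = der g (f x) * prod f A + f x * der g (prod f A)"
    by (simp only: sum.insert[OF insert.hyps] * insert.IH)
  then show ?case
    by (simp only: prod.insert[OF insert.hyps] der_mult)
qed simp

section \<open>The symbol of a noncommutative polynomial\<close>

lemma keys_add_subset:
  "Poly_Mapping.keys p \<subseteq> S \<Longrightarrow> Poly_Mapping.keys q \<subseteq> S \<Longrightarrow> Poly_Mapping.keys (p + q) \<subseteq> S"
  by (rule order_trans[OF Poly_Mapping.keys_add]) (rule Un_least)

lemma keys_uminus [simp]: "Poly_Mapping.keys (- p) = Poly_Mapping.keys p" for p :: "'k \<Rightarrow>\<^sub>0 complex"
  by (simp add: Poly_Mapping.keys.rep_eq Poly_Mapping.uminus_poly_mapping.rep_eq)

lemma keys_diff_subset:
  fixes p q :: "'k \<Rightarrow>\<^sub>0 complex"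
  shows "Poly_Mapping.keys p \<subseteq> S \<Longrightarrow> Poly_Mapping.keys q \<subseteq> S \<Longrightarrow> Poly_Mapping.keys (p - q) \<subseteq> S"
  using keys_add_subset[of p S "- q"] by simp

lemma keys_cst_mult_subset: "Poly_Mapping.keys p \<subseteq> S \<Longrightarrow> Poly_Mapping.keys (cst c * p) \<subseteq> S"
  by (auto simp: in_keys_iff)

lemma keys_sum_subset:
  fixes f :: "'i \<Rightarrow> 'k \<Rightarrow>\<^sub>0 complex"
  shows "(\<And>i. i \<in> I \<Longrightarrow> Poly_Mapping.keys (f i) \<subseteq> S) \<Longrightarrow> Poly_Mapping.keys (sum f I) \<subseteq> S"
  by (rule order_trans[OF Poly_Mapping.keys_sum]) (rule UN_least)

lemma keys_sum_mset_subset: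
  fixes f :: "'i \<Rightarrow> 'k \<Rightarrow>\<^sub>0 complex"
  shows "(\<And>i. i \<in># I \<Longrightarrow> Poly_Mapping.keys (f i) \<subseteq> S) \<Longrightarrow> Poly_Mapping.keys (\<Sum>i\<in>#I. f i) \<subseteq> S"
proof (induction I)
  case (add x I)
  then show ?case
    by (simp del: union_iff) (intro keys_add_subset; simp)
qed simp

lemma keys_mult_subset:
  fixes p q :: "'k::monoid_add \<Rightarrow>\<^sub>0 complex"
  assumes "Poly_Mapping.keys p \<subseteq> S" "Poly_Mapping.keys q \<subseteq> T" "\<And>s t. s \<in> S \<Longrightarrow> t \<in> T \<Longrightarrow> s + t \<in> U"
  shows "Poly_Mapping.keys (p * q) \<subseteq> U"
  using Poly_Mapping.keys_mult[of p q] assms by blast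

lemma keys_mon [simp]: "Poly_Mapping.keys (mon k) = {k}"
  by (simp add: mon_def)

lemma keys_var [simp]: "Poly_Mapping.keys (var v) = {{#v#}}"
  by (simp add: var_def)

lemma keys_cst_subset: "Poly_Mapping.keys (cst c) \<subseteq> {0}"
  by (simp add: cst_def)

lemma keys_lin_ext_subset:
  fixes p :: "'l \<Rightarrow>\<^sub>0 complex" and h :: "'l \<Rightarrow> 'k::monoid_add \<Rightarrow>\<^sub>0 complex"
  shows "(\<And>k. k \<in> Poly_Mapping.keys p \<Longrightarrow> Poly_Mapping.keys (h k) \<subseteq> S) \<Longrightarrow> Poly_Mapping.keys (lin_ext cst h p) \<subseteq> S"
  unfolding lin_ext_def by (intro keys_sum_subset keys_cst_mult_subset)

lemma keys_der_subset:
  assumes "\<And>m v. m \<in> Poly_Mapping.keys p \<Longrightarrow> v \<in># m \<Longrightarrow> Poly_Mapping.keys (g v * mon (m - {#v#})) \<subseteq> S"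
  shows "Poly_Mapping.keys (der g p) \<subseteq> S"
  unfolding der_def by (intro keys_lin_ext_subset keys_sum_mset_subset assms)

section \<open>The commuting left and right actions of the matrix units\<close>

type_synonym ix = "nat \<times> nat"
type_synonym gpoly = "ix multiset \<Rightarrow>\<^sub>0 complex"

text \<open>The product \<open>e\<^sub>a e\<^sub>b\<close> of matrix units, read as a linear form in the coordinates. The operators \<open>left_op a\<close> and
  \<open>right_op a\<close> are left and right multiplication by \<open>e\<^sub>a\<close> transported to polynomials by \<open>symbol\<close>; they come from
  letting \<open>e\<^sub>a\<close> act on \<open>exp (tr (\<xi> g))\<close> as an invariant vector field and evaluating at the identity.\<close>

definition unit_mult :: "ix \<Rightarrow> ix \<Rightarrow> gpoly" where
  "unit_mult a b = (if snd a = fst b then var (fst a, snd b) else 0)"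

definition left_op :: "ix \<Rightarrow> gpoly \<Rightarrow> gpoly" where
  "left_op a p = var a * p + der (unit_mult a) p"

definition right_op :: "ix \<Rightarrow> gpoly \<Rightarrow> gpoly" where
  "right_op a p = var a * p + der (\<lambda>b. unit_mult b a) p"

definition ad :: "ix \<Rightarrow> gpoly \<Rightarrow> gpoly" where
  "ad a = der (\<lambda>b. unit_mult a b - unit_mult b a)"

text \<open>The terms \<open>var a * p\<close> cancel. What remains is a derivation with linear
  values on the variables, so the commutator with a matrix unit preserves the degree.\<close>

lemma ad_eq: "ad a p = left_op a p - right_op a p"
  by (simp add: ad_def left_op_def right_op_def der_minus_fun)

lemma additive_left_op: "additive (left_op a)" and additive_right_op: "additive (right_op a)"
  by (simp_all add: additive_def left_op_def right_op_def der_add algebra_simps)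

lemmas left_op_add = additive.add[OF additive_left_op]
  and left_op_0 [simp] = additive.zero[OF additive_left_op] and right_op_0 [simp] = additive.zero[OF additive_right_op]
  and left_op_diff = additive.diff[OF additive_left_op] and right_op_diff = additive.diff[OF additive_right_op]

lemma left_op_cst_mult: "left_op a (cst c * p) = cst c * left_op a p"
  by (simp add: left_op_def der_cst_mult distrib_left mult.left_commute)

lemma right_op_cst_mult: "right_op a (cst c * p) = cst c * right_op a p"
  by (simp add: right_op_def der_cst_mult distrib_left mult.left_commute)

text \<open>On a variable \<open>v\<close> both sides are the product of the matrix units
  \<open>a\<close>, \<open>v\<close>, \<open>b\<close>: this is associativity of matrix
  multiplication.\<close>

lemma der_unit_mult_commute:
  "der (unit_mult a) (der (\<lambda>c. unit_mult c b) p) = der (\<lambda>c. unit_mult c b) (der (unit_mult a) p)"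
  by (rule der_commute) (auto simp: unit_mult_def)

text \<open>Besides the commuting derivations there are cross terms from differentiating
  \<open>var b\<close> or \<open>var a\<close>; in both orders they contribute
  \<open>unit_mult a b * p\<close>.\<close>

lemma left_right_op_commute: "left_op a (right_op b p) = right_op b (left_op a p)"
  by (simp add: left_op_def right_op_def der_add der_mult der_unit_mult_commute distrib_left)

definition symbol :: "free_elt \<Rightarrow> gpoly" where
  "symbol = lin_ext cst (\<lambda>w. foldr left_op w 1)"

lemma additive_symbol: "additive symbol"
  unfolding symbol_def by (intro additive_lin_ext additive_cst)

lemmas symbol_add = additive.add[OF additive_symbol] and symbol_diff = additive.diff[OF additive_symbol]
  and symbol_0 [simp] = additive.zero[OF additive_symbol] and symbol_sum = additive.sum[OF additive_symbol]
  and symbol_minus = additive.minus[OF additive_symbol]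

lemma symbol_single: "symbol (Poly_Mapping.single w c) = cst c * foldr left_op w 1"
  unfolding symbol_def by (simp add: lin_ext_single additive_cst)

lemma symbol_cst [simp]: "symbol (cst c) = cst c"
  unfolding cst_def[of c, where 'k = "ix list"] symbol_single by (simp add: zero_list_def)

lemma symbol_1 [simp]: "symbol 1 = 1"
  using symbol_cst[of 1] by simp

lemma letter_eq: "letter (fst a) (snd a) = mon [a]" "letter i j = mon [(i, j)]"
  by (simp_all add: letter_def mon_def)

lemma mon_Cons: "mon (a # w) = mon [a] * mon w"
  by (simp add: mon_add[symmetric] plus_list_def)

lemma mon_append: "mon (u @ w) = mon u * mon w"
  by (simp add: mon_add[symmetric] plus_list_def)

lemma mon_Nil: "mon [] = 1"
  by (simp add: mon_def flip: zero_list_def)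

lemma symbol_cst_mult: "symbol (cst c * x) = cst c * symbol x"
proof (rule additive_cong_single[of "\<lambda>x. symbol (cst c * x)" "\<lambda>x. cst c * symbol x"])
  show "symbol (cst c * Poly_Mapping.single k d) = cst c * symbol (Poly_Mapping.single k d)" for k d
    by (simp add: cst_def[of c, where 'k = "ix list"] mult_single symbol_single cst_mult mult.assoc)
qed (intro additive_compose[OF additive_symbol] additive_intros)+

lemma symbol_letter_mult: "symbol (mon [a] * x) = left_op a (symbol x)"
proof (rule additive_cong_single[of "\<lambda>x. symbol (mon [a] * x)" "\<lambda>x. left_op a (symbol x)"])
  show "symbol (mon [a] * Poly_Mapping.single k d) = left_op a (symbol (Poly_Mapping.single k d))" for k d
    by (simp add: mon_def mult_single symbol_single plus_list_def left_op_cst_mult)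
qed (intro additive_compose[OF additive_symbol] additive_compose[OF additive_left_op] additive_intros)+

lemma foldr_left_right_op: "foldr left_op w (right_op a p) = right_op a (foldr left_op w p)"
  by (induction w) (simp_all add: left_right_op_commute)

lemma left_op_1: "left_op a 1 = var a" and right_op_1: "right_op a 1 = var a"
  by (simp_all add: left_op_def right_op_def)

text \<open>The last letter of a word is the first to act on 1, where \<open>left_op a\<close> and
  \<open>right_op a\<close> agree. As \<open>right_op a\<close> commutes with all left operators, it
  can then be moved to the outside.\<close>

lemma symbol_mult_letter: "symbol (x * mon [a]) = right_op a (symbol x)"
proof (rule additive_cong_single[of "\<lambda>x. symbol (x * mon [a])" "\<lambda>x. right_op a (symbol x)"])
  have "left_op a 1 = right_op a 1" by (simp add: left_op_1 right_op_1)
  then show "symbol (Poly_Mapping.single k d * mon [a]) = right_op a (symbol (Poly_Mapping.single k d))" for k d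
    by (simp add: mon_def mult_single symbol_single plus_list_def right_op_cst_mult foldr_left_right_op)
qed (intro additive_compose[OF additive_symbol] additive_compose[OF additive_right_op] additive_intros)+

lemma symbol_mon_mult: "symbol (mon w * x) = foldr left_op w (symbol x)"
proof (induction w)
  case (Cons a w)
  then show ?case
    by (subst mon_Cons) (simp add: mult.assoc symbol_letter_mult)
qed (simp add: mon_Nil)

lemma symbol_mult_eq_0_right:
  assumes "symbol y = 0"
  shows "symbol (x * y) = 0"
proof (rule additive_cong_single[of "\<lambda>x. symbol (x * y)" "\<lambda>x. 0"])
  fix w c
  have "foldr left_op w 0 = 0" by (induction w) simp_all
  then show "symbol (Poly_Mapping.single w c * y) = 0"
    by (simp add: cst_mult_mon[symmetric] mult.assoc symbol_cst_mult symbol_mon_mult assms)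
qed (intro additive_compose[OF additive_symbol] additive_intros | simp add: additive_def)+

text \<open>The word is built up at its right end, where each new letter acts on the symbol through
  \<open>right_op\<close>.\<close>

lemma symbol_mult_eq_0_left:
  assumes "symbol y = 0"
  shows "symbol (y * x) = 0"
proof (rule additive_cong_single[of "\<lambda>x. symbol (y * x)" "\<lambda>x. 0"])
  fix w c
  have "symbol (y * mon w) = 0"
  proof (induction w rule: rev_induct)
    case (snoc a w)
    then show ?case
      by (simp add: mon_append symbol_mult_letter flip: mult.assoc)
  qed (simp add: mon_Nil assms)
  then show "symbol (y * Poly_Mapping.single w c) = 0"
    by (simp add: cst_mult_mon[symmetric] cst_mult_commute[of c "mon w"] symbol_cst_mult
        flip: mult.assoc) (simp add: cst_mult_commute[of c, symmetric] symbol_cst_mult)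
qed (intro additive_compose[OF additive_symbol] additive_intros | simp add: additive_def)+

text \<open>The kernel of \<open>symbol\<close> absorbs products on both sides. This takes the place
  of multiplicativity: the symbol of a product depends only on the symbols of the factors.\<close>

lemma symbol_mult_cong:
  assumes "symbol x = symbol x'" "symbol y = symbol y'"
  shows "symbol (x * y) = symbol (x' * y')"
proof -
  have "symbol ((x - x') * y) = 0" "symbol (x' * (y - y')) = 0"
    using assms by (intro symbol_mult_eq_0_left symbol_mult_eq_0_right; simp add: symbol_diff)+
  then have "symbol ((x - x') * y + x' * (y - y')) = 0"
    by (simp add: symbol_add)
  then show ?thesis
    by (simp add: algebra_simps symbol_diff)
qed

text \<open>The symbol of a product of two letters is the commutative product plus their matrix
  product. In the commutator the commutative products cancel and the bracket of \<open>gl(n)\<close>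
  remains.\<close>

lemma symbol_relation:
  "symbol (letter i j * letter k l - letter k l * letter i j
        - ((if j = k then letter i l else 0) - (if i = l then letter k j else 0))) = 0"
proof -
  have [simp]: "symbol (mon [a]) = var a" for a
    using symbol_letter_mult[of a 1] by (simp add: left_op_1)
  show ?thesis
    by (auto simp: symbol_diff letter_eq symbol_letter_mult) (auto simp: left_op_def unit_mult_def mult.commute)
qed

section \<open>The Poincare-Birkhoff-Witt theorem\<close>

definition words :: "nat \<Rightarrow> ix list set" where
  "words n = lists ({1..n} \<times> {1..n})"

lemma words_append: "u \<in> words n \<Longrightarrow> v \<in> words n \<Longrightarrow> u @ v \<in> words n"
  by (simp add: words_def)

lemma words_mset: "u \<in> words n \<Longrightarrow> mset v = mset u \<Longrightarrow> v \<in> words n"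
  using mset_eq_setD[of v u] unfolding words_def in_lists_conv_set by simp

abbreviation free_set :: "nat \<Rightarrow> free_elt set" where
  "free_set n \<equiv> {x. Poly_Mapping.keys x \<subseteq> words n}"

lemma free_alg_simps [simp]:
  "carrier (free_alg n) = free_set n" "x \<otimes>\<^bsub>free_alg n\<^esub> y = x * y" "x \<oplus>\<^bsub>free_alg n\<^esub> y = x + y"
  "\<one>\<^bsub>free_alg n\<^esub> = 1" "\<zero>\<^bsub>free_alg n\<^esub> = 0"
  by (simp_all add: free_alg_def words_def)

lemma free_set_add: "x \<in> free_set n \<Longrightarrow> y \<in> free_set n \<Longrightarrow> x + y \<in> free_set n"
  by (simp add: keys_add_subset)

lemma free_set_diff: "x \<in> free_set n \<Longrightarrow> y \<in> free_set n \<Longrightarrow> x - y \<in> free_set n"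
  by (simp add: keys_diff_subset)

lemma free_set_mult: "x \<in> free_set n \<Longrightarrow> y \<in> free_set n \<Longrightarrow> x * y \<in> free_set n"
  using keys_mult_subset[of x "words n" y "words n" "words n"]
  by (simp add: plus_list_def words_append)

lemma free_set_cst: "cst c \<in> free_set n"
  using keys_cst_subset[of c] by (auto simp: zero_list_def words_def)

lemma free_set_letter: "i \<in> {1..n} \<Longrightarrow> j \<in> {1..n} \<Longrightarrow> letter i j \<in> free_set n"
  by (simp add: letter_eq words_def)

lemma free_set_0: "0 \<in> free_set n" and free_set_1: "1 \<in> free_set n"
  using free_set_cst[of 0 n] free_set_cst[of 1 n] by simp_all

lemma free_set_uminus: "x \<in> free_set n \<Longrightarrow> - x \<in> free_set n"
  by simp

lemmas free_set_intros = free_set_add free_set_diff free_set_mult free_set_cst free_set_letter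
  free_set_0 free_set_1 free_set_uminus

lemma ring_free_alg: "ring (free_alg n)"
proof (rule ringI)
  show "abelian_group (free_alg n)"
  proof (rule abelian_groupI)
    fix x assume "x \<in> carrier (free_alg n)"
    then show "\<exists>y\<in>carrier (free_alg n). y \<oplus>\<^bsub>free_alg n\<^esub> x = \<zero>\<^bsub>free_alg n\<^esub>"
      by (intro bexI[of _ "- x"]) simp_all
  qed (use free_set_intros in \<open>auto simp: add.assoc add.commute\<close>)
  show "Group.monoid (free_alg n)"
    by (rule monoidI) (use free_set_intros in \<open>auto simp: mult.assoc\<close>)
qed (simp_all add: algebra_simps)

interpretation free: ring "free_alg n" for n
  by (rule ring_free_alg)

lemma free_alg_uminus:
  assumes "x \<in> free_set n"
  shows "\<ominus>\<^bsub>free_alg n\<^esub> x = - x"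
  using free.minus_equality[of n "- x" x] assms by simp

lemma free_alg_minus:
  assumes "x \<in> free_set n" "y \<in> free_set n"
  shows "x \<ominus>\<^bsub>free_alg n\<^esub> y = x - y"
  using assms by (simp add: a_minus_def free_alg_uminus)

lemma gl_relations_subset: "gl_relations n \<subseteq> free_set n"
proof
  fix x assume "x \<in> gl_relations n"
  then obtain i j k l where *: "x = letter i j * letter k l - letter k l * letter i j
        - ((if j = k then letter i l else 0) - (if i = l then letter k j else 0))"
    "i \<in> {1..n}" "j \<in> {1..n}" "k \<in> {1..n}" "l \<in> {1..n}"
    unfolding gl_relations_def by blast
  have "(if b then letter p q else 0) \<in> free_set n" if "p \<in> {1..n}" "q \<in> {1..n}" for b p q
    using that free_set_letter[of p n q] free_set_0 by simp
  then show "x \<in> free_set n"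
    unfolding *(1) using *(2-) by (intro free_set_intros)
qed

lemma ideal_gl_ideal: "ideal (gl_ideal n) (free_alg n)"
  unfolding gl_ideal_def by (rule free.genideal_ideal) (use gl_relations_subset in simp)

lemma gl_relations_in_ideal: "gl_relations n \<subseteq> gl_ideal n"
  unfolding gl_ideal_def by (rule free.genideal_self) (use gl_relations_subset in simp)

lemma gl_ideal_subset: "gl_ideal n \<subseteq> free_set n"
  using additive_subgroup.a_subset[OF ideal.axioms(1)[OF ideal_gl_ideal[of n]]] by simp

lemma gl_ideal_add: "x \<in> gl_ideal n \<Longrightarrow> y \<in> gl_ideal n \<Longrightarrow> x + y \<in> gl_ideal n"
  using additive_subgroup.a_closed[OF ideal.axioms(1)[OF ideal_gl_ideal[of n]]] by simp

lemma gl_ideal_mult_left: "x \<in> gl_ideal n \<Longrightarrow> y \<in> free_set n \<Longrightarrow> y * x \<in> gl_ideal n"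
  using ideal.I_l_closed[OF ideal_gl_ideal[of n]] by simp

lemma gl_ideal_mult_right: "x \<in> gl_ideal n \<Longrightarrow> y \<in> free_set n \<Longrightarrow> x * y \<in> gl_ideal n"
  using ideal.I_r_closed[OF ideal_gl_ideal[of n]] by simp

lemma gl_ideal_0: "0 \<in> gl_ideal n"
  using additive_subgroup.zero_closed[OF ideal.axioms(1)[OF ideal_gl_ideal[of n]]] by simp

lemma gl_ideal_symbol:
  assumes "x \<in> gl_ideal n"
  shows "symbol x = 0"
proof -
  let ?K = "{x. x \<in> free_set n \<and> symbol x = 0}"
  have "ideal ?K (free_alg n)"
  proof (rule idealI[OF ring_free_alg])
    show "subgroup ?K (add_monoid (free_alg n))"
    proof (rule free.add.subgroupI)
      show "?K \<noteq> {}"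
        using free_set_0[of n] symbol_0 by blast
      show "\<ominus>\<^bsub>free_alg n\<^esub> x \<in> ?K" if "x \<in> ?K" for x
        using that by (simp add: free_alg_uminus symbol_minus)
      show "x \<oplus>\<^bsub>free_alg n\<^esub> y \<in> ?K" if "x \<in> ?K" "y \<in> ?K" for x y
        using that by (simp add: keys_add_subset symbol_add)
    qed auto
    show "y \<otimes>\<^bsub>free_alg n\<^esub> x \<in> ?K" "x \<otimes>\<^bsub>free_alg n\<^esub> y \<in> ?K"
      if "x \<in> ?K" "y \<in> carrier (free_alg n)" for x y
      using that free_set_mult[of x n y] free_set_mult[of y n x]
      by (simp_all add: symbol_mult_eq_0_left symbol_mult_eq_0_right)
  qed
  then have "gl_ideal n \<subseteq> ?K"
    unfolding gl_ideal_def
  proof (rule free.genideal_minimal)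
    show "gl_relations n \<subseteq> ?K"
    proof
      fix x assume x: "x \<in> gl_relations n"
      then have "symbol x = 0"
        unfolding gl_relations_def using symbol_relation by blast
      then show "x \<in> ?K"
        using x gl_relations_subset by blast
    qed
  qed
  then show ?thesis using assms by auto
qed

text \<open>Expresses that the class of \<open>x\<close> in the enveloping algebra has filtration
  degree less than \<open>d\<close>.\<close>

definition lower_mod_ideal :: "nat \<Rightarrow> nat \<Rightarrow> free_elt \<Rightarrow> bool" where
  "lower_mod_ideal n d x \<longleftrightarrow> (\<exists>y. x - y \<in> gl_ideal n \<and> Poly_Mapping.keys y \<subseteq> words n \<inter> {w. length w < d})"

lemma lower_mod_idealI: "x - y \<in> gl_ideal n \<Longrightarrow> Poly_Mapping.keys y \<subseteq> words n \<inter> {w. length w < d} \<Longrightarrow> lower_mod_ideal n d x"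
  unfolding lower_mod_ideal_def by blast

lemma lower_mod_ideal_lower: "Poly_Mapping.keys x \<subseteq> words n \<inter> {w. length w < d} \<Longrightarrow> lower_mod_ideal n d x"
  by (rule lower_mod_idealI[of _ x]) (simp_all add: gl_ideal_0)

lemma lower_mod_ideal_ideal: "x \<in> gl_ideal n \<Longrightarrow> lower_mod_ideal n d x"
  by (rule lower_mod_idealI[of _ 0]) simp_all

lemma lower_mod_ideal_add: "lower_mod_ideal n d x \<Longrightarrow> lower_mod_ideal n d y \<Longrightarrow> lower_mod_ideal n d (x + y)"
  unfolding lower_mod_ideal_def
proof (elim exE conjE)
  fix u v assume *: "x - u \<in> gl_ideal n" "Poly_Mapping.keys u \<subseteq> words n \<inter> {w. length w < d}"
    "y - v \<in> gl_ideal n" "Poly_Mapping.keys v \<subseteq> words n \<inter> {w. length w < d}"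
  have "x + y - (u + v) \<in> gl_ideal n"
    using gl_ideal_add[OF *(1,3)] by (simp add: algebra_simps)
  then show "\<exists>z. x + y - z \<in> gl_ideal n \<and> Poly_Mapping.keys z \<subseteq> words n \<inter> {w. length w < d}"
    using * by (intro exI[of _ "u + v"] conjI keys_add_subset)
qed

lemma lower_mod_ideal_mult_left:
  assumes "lower_mod_ideal n d x" "Poly_Mapping.keys z \<subseteq> words n \<inter> {w. length w \<le> k}"
  shows "lower_mod_ideal n (k + d) (z * x)"
proof -
  obtain y where y: "x - y \<in> gl_ideal n" "Poly_Mapping.keys y \<subseteq> words n \<inter> {w. length w < d}"
    using assms unfolding lower_mod_ideal_def by blast
  show ?thesis
  proof (rule lower_mod_idealI)
    show "z * x - z * y \<in> gl_ideal n"
      using gl_ideal_mult_left[OF y(1)] assms(2) by (simp add: right_diff_distrib)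
    show "Poly_Mapping.keys (z * y) \<subseteq> words n \<inter> {w. length w < k + d}"
      by (rule keys_mult_subset[OF assms(2) y(2)]) (auto simp: plus_list_def words_append)
  qed
qed

lemma lower_mod_ideal_mult_right:
  assumes "lower_mod_ideal n d x" "Poly_Mapping.keys z \<subseteq> words n \<inter> {w. length w \<le> k}"
  shows "lower_mod_ideal n (k + d) (x * z)"
proof -
  obtain y where y: "x - y \<in> gl_ideal n" "Poly_Mapping.keys y \<subseteq> words n \<inter> {w. length w < d}"
    using assms unfolding lower_mod_ideal_def by blast
  show ?thesis
  proof (rule lower_mod_idealI)
    show "x * z - y * z \<in> gl_ideal n"
      using gl_ideal_mult_right[OF y(1)] assms(2) by (simp add: left_diff_distrib)
    show "Poly_Mapping.keys (y * z) \<subseteq> words n \<inter> {w. length w < k + d}"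
      by (rule keys_mult_subset[OF y(2) assms(2)]) (auto simp: plus_list_def words_append)
  qed
qed

lemma lower_mod_ideal_swap_letters:
  assumes "a \<in> {1..n} \<times> {1..n}" "b \<in> {1..n} \<times> {1..n}"
  shows "lower_mod_ideal n 2 (mon [a] * mon [b] - mon [b] * mon [a])"
proof -
  obtain i j k l where ij: "a = (i, j)" "b = (k, l)" by (cases a, cases b)
  have *: "Poly_Mapping.keys (if c then letter p q else 0) \<subseteq> words n \<inter> {w. length w < 2}"
    if "p \<in> {1..n}" "q \<in> {1..n}" for c p q
    using that by (simp add: letter_eq words_def)
  show ?thesis
  proof (rule lower_mod_idealI)
    show "mon [a] * mon [b] - mon [b] * mon [a] -
      ((if j = k then letter i l else 0) - (if i = l then letter k j else 0)) \<in> gl_ideal n"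
      unfolding ij letter_eq(2)[symmetric]
    proof (rule subsetD[OF gl_relations_in_ideal])
      show "letter i j * letter k l - letter k l * letter i j -
        ((if j = k then letter i l else 0) - (if i = l then letter k j else 0)) \<in> gl_relations n"
        unfolding gl_relations_def using assms unfolding ij by blast
    qed
    show "Poly_Mapping.keys ((if j = k then letter i l else 0) - (if i = l then letter k j else 0))
      \<subseteq> words n \<inter> {w. length w < 2}"
      using assms unfolding ij by (intro keys_diff_subset *) auto
  qed
qed

lemma lower_mod_ideal_move_letter:
  assumes "a # u @ v \<in> words n"
  shows "lower_mod_ideal n (length (a # u @ v)) (mon (a # u @ v) - mon (u @ a # v))"
  using assms
proof (induction u)
  case Nil
  then show ?case by (simp add: lower_mod_ideal_ideal gl_ideal_0)
next
  case (Cons b u)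
  have "lower_mod_ideal n (length (u @ v) + 2) ((mon [a] * mon [b] - mon [b] * mon [a]) * mon (u @ v))"
    using Cons.prems by (intro lower_mod_ideal_mult_right lower_mod_ideal_swap_letters) (auto simp: words_def)
  moreover have "lower_mod_ideal n (1 + length (a # u @ v)) (mon [b] * (mon (a # u @ v) - mon (u @ a # v)))"
    using Cons by (intro lower_mod_ideal_mult_left) (auto simp: words_def)
  ultimately have "lower_mod_ideal n (length (a # (b # u) @ v))
     ((mon [a] * mon [b] - mon [b] * mon [a]) * mon (u @ v) + mon [b] * (mon (a # u @ v) - mon (u @ a # v)))"
    by (intro lower_mod_ideal_add) simp_all
  moreover have "(mon [a] * mon [b] - mon [b] * mon [a]) * mon (u @ v) + mon [b] * (mon (a # u @ v) - mon (u @ a # v))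
     = mon (a # (b # u) @ v) - mon ((b # u) @ a # v)"
    by (simp add: algebra_simps mon_Cons[of a "b # u @ v"] mon_Cons[of b "u @ v"]
        mon_Cons[of b "u @ a # v"] mon_Cons[of a "u @ v"])
  ultimately show ?case by simp
qed

text \<open>The spanning half of Poincare-Birkhoff-Witt: modulo lower degree a word depends only on
  the multiset of its letters. The first letter of \<open>w\<close> is located in \<open>w'\<close>
  and moved to the front; the remaining letters are matched by induction.\<close>

lemma lower_mod_ideal_perm:
  assumes "w \<in> words n" "mset w = mset w'"
  shows "lower_mod_ideal n (length w) (mon w - mon w')"
  using assms
proof (induction w arbitrary: w')
  case Nil
  then show ?case by (simp add: lower_mod_ideal_ideal gl_ideal_0)
next
  case (Cons a w)
  then have "a \<in> set w'"
    by (metis list.set_intros(1) mset_eq_setD)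
  then obtain u v where w': "w' = u @ a # v"
    by (meson split_list)
  have mset: "mset w = mset (u @ v)"
    using Cons.prems w' by simp
  have w: "w \<in> words n" "[a] \<in> words n"
    using Cons.prems by (simp_all add: words_def)
  have "lower_mod_ideal n (1 + length w) (mon [a] * (mon w - mon (u @ v)))"
    using w by (intro lower_mod_ideal_mult_left Cons.IH[OF w(1) mset]) simp
  moreover have "lower_mod_ideal n (length (a # u @ v)) (mon (a # u @ v) - mon (u @ a # v))"
  proof (rule lower_mod_ideal_move_letter)
    have "u @ v \<in> words n" using words_mset[OF w(1) mset[symmetric]] .
    then show "a # u @ v \<in> words n" using w by (simp add: words_def)
  qed
  moreover have "length w = length (u @ v)"
    using mset mset_eq_length by blast
  ultimately have "lower_mod_ideal n (length (a # w))
      (mon [a] * (mon w - mon (u @ v)) + (mon (a # u @ v) - mon (u @ a # v)))"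
    by (intro lower_mod_ideal_add) simp_all
  then show ?case
    by (simp add: w' right_diff_distrib flip: mon_Cons)
qed

section \<open>Leading terms of symbols\<close>

definition abelianize :: "free_elt \<Rightarrow> gpoly" where
  "abelianize = lin_ext cst (\<lambda>w. mon (mset w))"

lemma additive_abelianize: "additive abelianize"
  unfolding abelianize_def by (intro additive_lin_ext additive_cst)

lemma abelianize_single: "abelianize (Poly_Mapping.single w c) = cst c * mon (mset w)"
  unfolding abelianize_def by (simp add: lin_ext_single additive_cst)

abbreviation deg_lt :: "nat \<Rightarrow> gpoly \<Rightarrow> bool" where
  "deg_lt d p \<equiv> Poly_Mapping.keys p \<subseteq> {m. size m < d}"

lemma keys_unit_mult_mult:
  assumes "snd a = fst b \<Longrightarrow> add_mset (fst a, snd b) m \<in> S"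
  shows "Poly_Mapping.keys (unit_mult a b * mon m) \<subseteq> S"
  using assms by (simp add: unit_mult_def flip: mon_add_mset)

lemma deg_lt_der_unit_mult: "deg_lt d p \<Longrightarrow> deg_lt d (der (unit_mult a) p)"
proof (rule keys_der_subset, rule keys_unit_mult_mult)
  fix m v assume "deg_lt d p" "m \<in> Poly_Mapping.keys p" "v \<in># m"
  then have "size m < d" "size (add_mset w (m - {#v#})) = size m" for w
    by (auto dest!: multi_member_split)
  then show "add_mset (fst a, snd v) (m - {#v#}) \<in> {m. size m < d}"
    by simp
qed

lemma deg_lt_var_mult: "deg_lt d p \<Longrightarrow> deg_lt (Suc d) (var v * p)"
  by (rule keys_mult_subset[of _ "{{#v#}}"]) auto

text \<open>\<open>left_op a\<close> is multiplication by \<open>var a\<close>, which raises the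
  degree by one, plus a derivation that does not raise it; only the multiplications reach the top
  degree.\<close>

lemma symbol_word_leading: "deg_lt (length w) (foldr left_op w 1 - mon (mset w))"
proof (induction w)
  case Nil
  then show ?case by simp
next
  case (Cons a w)
  let ?q = "foldr left_op w 1 - mon (mset w)"
  have eq: "foldr left_op (a # w) 1 - mon (mset (a # w)) = var a * ?q + der (unit_mult a) (mon (mset w) + ?q)"
    by (simp add: left_op_def mon_add_mset right_diff_distrib)
  show ?case
    unfolding eq
  proof (rule keys_add_subset)
    show "deg_lt (length (a # w)) (var a * ?q)"
      using deg_lt_var_mult[OF Cons.IH] by simp
    have "deg_lt (Suc (length w)) (mon (mset w) + ?q)"
      by (rule keys_add_subset) (use Cons.IH in \<open>auto intro: less_SucI\<close>)
    then show "deg_lt (length (a # w)) (der (unit_mult a) (mon (mset w) + ?q))"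
      by (simp add: deg_lt_der_unit_mult)
  qed
qed

lemma symbol_leading:
  assumes "Poly_Mapping.keys x \<subseteq> {w. length w \<le> d}"
  shows "deg_lt d (symbol x - abelianize x)"
proof -
  have "symbol x - abelianize x = lin_ext cst (\<lambda>w. foldr left_op w 1 - mon (mset w)) x"
    by (simp add: lin_ext_def symbol_def abelianize_def right_diff_distrib sum_subtractf)
  moreover have "deg_lt d (foldr left_op w 1 - mon (mset w))" if "w \<in> Poly_Mapping.keys x" for w
    using symbol_word_leading[of w] that assms by fastforce
  ultimately show ?thesis
    by (simp add: keys_lin_ext_subset)
qed

text \<open>A normal form for monomials: any section of \<open>mset\<close> serves the purpose,
  since words with the same letters agree modulo lower degree.\<close>

definition arrange :: "ix multiset \<Rightarrow> ix list" where
  "arrange m = (SOME w. mset w = m)"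

lemma mset_arrange: "mset (arrange m) = m"
  unfolding arrange_def by (rule someI_ex) (rule ex_mset)

lemma length_arrange [simp]: "length (arrange m) = size m"
  by (metis mset_arrange size_mset)

text \<open>Descent on the degree. Modulo lower degree \<open>x\<close> can be rewritten in normal
  form, which depends only on its commutative image. A vanishing symbol forces this image to have no
  part of top degree, so \<open>x\<close> is congruent to an element of smaller degree whose symbol
  again vanishes.\<close>

theorem symbol_eq_0_imp_gl_ideal:
  assumes "x \<in> free_set n" "symbol x = 0"
  shows "x \<in> gl_ideal n"
proof -
  have "x \<in> gl_ideal n" if "Poly_Mapping.keys x \<subseteq> words n \<inter> {w. length w < d}" "symbol x = 0" for d x
    using that
  proof (induction d arbitrary: x)
    case 0
    then have "x = 0" by simp
    then show ?case by (simp add: gl_ideal_0)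
  next
    case (Suc d)
    \<comment> \<open>A linear right inverse of \<open>abelianize\<close> that puts every monomial
      into its normal form.\<close>
    let ?rho = "lin_ext cst (\<lambda>m. mon (arrange m)) :: gpoly \<Rightarrow> free_elt"
    have "lower_mod_ideal n d (x - ?rho (abelianize x))"
    proof -
      note additive_rho = additive_lin_ext[OF additive_cst, of "\<lambda>m. mon (arrange m) :: free_elt"]
      show ?thesis
      proof (rule poly_mapping_single_induct[where p = x])
        show "lower_mod_ideal n d (0 - ?rho (abelianize 0))"
          by (simp add: additive.zero[OF additive_abelianize] additive.zero[OF additive_rho] lower_mod_ideal_ideal gl_ideal_0)
      next
        fix w c assume "w \<in> Poly_Mapping.keys x"
        then have w: "w \<in> words n" "length w < Suc d"
          using Suc.prems(1) by auto
        have w': "arrange (mset w) \<in> words n"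
          using words_mset[OF w(1)] mset_arrange by blast
        have "lower_mod_ideal n d (mon w - mon (arrange (mset w)))"
        proof (cases "length w = d")
          case True
          then show ?thesis
            using lower_mod_ideal_perm[OF w(1), of "arrange (mset w)"] by (simp add: mset_arrange)
        next
          case False
          then show ?thesis
            using w w' by (intro lower_mod_ideal_lower keys_diff_subset) auto
        qed
        moreover have "Poly_Mapping.keys (cst c) \<subseteq> words n \<inter> {w. length w \<le> 0}"
          using keys_cst_subset[of c] by (auto simp: words_def zero_list_def)
        ultimately have "lower_mod_ideal n (0 + d) (cst c * (mon w - mon (arrange (mset w))))"
          by (rule lower_mod_ideal_mult_left)
        then show "lower_mod_ideal n d (Poly_Mapping.single w c - ?rho (abelianize (Poly_Mapping.single w c)))"
          by (simp add: abelianize_single cst_mult_mon lin_ext_single[OF additive_cst] right_diff_distrib)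
      next
        fix p q assume "lower_mod_ideal n d (p - ?rho (abelianize p))" "lower_mod_ideal n d (q - ?rho (abelianize q))"
        then have "lower_mod_ideal n d ((p - ?rho (abelianize p)) + (q - ?rho (abelianize q)))"
          by (rule lower_mod_ideal_add)
        then show "lower_mod_ideal n d (p + q - ?rho (abelianize (p + q)))"
          by (simp add: additive.add[OF additive_abelianize] additive.add[OF additive_rho] algebra_simps)
      qed
    qed
    moreover have "lower_mod_ideal n d (?rho (abelianize x))"
    proof (rule lower_mod_ideal_lower, rule keys_lin_ext_subset)
      fix m assume m: "m \<in> Poly_Mapping.keys (abelianize x)"
      have "Poly_Mapping.keys (abelianize x) \<subseteq> mset ` Poly_Mapping.keys x"
        unfolding abelianize_def by (rule keys_lin_ext_subset) simp
      then obtain w where "w \<in> words n" "m = mset w"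
        using m Suc.prems(1) by blast
      then have "arrange m \<in> words n"
        using words_mset mset_arrange by blast
      moreover have "deg_lt d (symbol x - abelianize x)"
        using Suc.prems(1) by (intro symbol_leading) auto
      then have "size m < d"
        using m Suc.prems(2) by auto
      ultimately show "Poly_Mapping.keys (mon (arrange m)) \<subseteq> words n \<inter> {w. length w < d}"
        by simp
    qed
    ultimately have "lower_mod_ideal n d (x - ?rho (abelianize x) + ?rho (abelianize x))"
      by (rule lower_mod_ideal_add)
    then have "lower_mod_ideal n d x" by simp
    then obtain y where y: "x - y \<in> gl_ideal n" "Poly_Mapping.keys y \<subseteq> words n \<inter> {w. length w < d}"
      unfolding lower_mod_ideal_def by blast
    have "symbol y = 0"
      using gl_ideal_symbol[OF y(1)] Suc.prems by (simp add: symbol_diff)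
    then have "x - y + y \<in> gl_ideal n"
      by (intro gl_ideal_add y Suc.IH)
    then show ?case by simp
  qed
  moreover have "finite (length ` Poly_Mapping.keys x)" by simp
  then obtain d where "\<forall>k\<in>length ` Poly_Mapping.keys x. k < d"
    by (metis finite_nat_set_iff_bounded)
  ultimately show ?thesis
    using assms by blast
qed

section \<open>The Capelli identity\<close>

declare One_nat_def [simp del]

lemma cst_of_int [simp]: "cst (of_int z) = of_int z"
  by (simp add: cst_def)

lemma symbol_of_nat_mult: "symbol (of_nat c * x) = of_nat c * symbol x"
  using symbol_cst_mult[of "of_nat c" x] by simp

lemma symbol_of_int_mult: "symbol (of_int c * x) = of_int c * symbol x"
  using symbol_cst_mult[of "of_int c" x] by simp

definition free_cdet :: "nat \<Rightarrow> (nat \<Rightarrow> nat) \<Rightarrow> free_elt" where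
  "free_cdet k i = (\<Sum>p | p permutes {1..k}. of_int (sign p) *
     foldr (\<lambda>b x. (letter (i (p b)) (i b) + of_nat (if p b = b then k - p b else 0)) * x) [1..<k + 1] 1)"

text \<open>The minor of the generic matrix with rows and columns listed by \<open>i\<close>; a
  principal minor, up to the order of the indices, when \<open>i\<close> is injective.\<close>

definition mdet :: "nat \<Rightarrow> (nat \<Rightarrow> nat) \<Rightarrow> gpoly" where
  "mdet k i = (\<Sum>p | p permutes {1..k}. of_int (sign p) * (\<Prod>b\<in>{1..k}. var (i (p b), i b)))"

text \<open>Composing with a transposition is a sign-reversing bijection of the permutations that
  matches the two sums term by term.\<close>

lemma sum_permutes_transpose_cancel:
  fixes X Y :: "(nat \<Rightarrow> nat) \<Rightarrow> 'r::ring_1"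
  assumes "b \<in> {1..k}" "c \<in> {1..k}" "b \<noteq> c"
    and XY: "\<And>p. p permutes {1..k} \<Longrightarrow> Y (p \<circ> Transposition.transpose b c) = X p"
  shows "(\<Sum>p | p permutes {1..k}. of_int (sign p) * Y p) + (\<Sum>p | p permutes {1..k}. of_int (sign p) * X p) = 0"
proof -
  have t: "Transposition.transpose b c permutes {1..k}"
    using assms by (intro permutes_swap_id)
  have "(\<Sum>p | p permutes {1..k}. of_int (sign p) * Y p)
      = (\<Sum>p | p permutes {1..k}. of_int (sign (p \<circ> Transposition.transpose b c)) * Y (p \<circ> Transposition.transpose b c))"
    by (rule sum_permutations_compose_right[OF t])
  also have "\<dots> = (\<Sum>p | p permutes {1..k}. - (of_int (sign p) * X p))"
  proof (rule sum.cong[OF refl])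
    fix p assume "p \<in> {p. p permutes {1..k}}"
    then have p: "p permutes {1..k}" by simp
    have "sign (p \<circ> Transposition.transpose b c) = - sign p"
      using p t assms(3) by (subst sign_compose) (auto intro: permutes_imp_permutation[of "{1..k}"] simp: sign_swap_id)
    then show "of_int (sign (p \<circ> Transposition.transpose b c)) * Y (p \<circ> Transposition.transpose b c) = - (of_int (sign p) * X p)"
      by (simp add: XY[OF p])
  qed
  finally show ?thesis
    by (simp add: sum_negf)
qed

text \<open>Apply the columns from the last to the first. In column \<open>b\<close> the derivation replaces a row equal to
  \<open>b\<close> in some later column \<open>c\<close>; after composing the permutation with the transposition of \<open>b\<close> and \<open>c\<close>
  each of these \<open>k - b\<close> terms cancels one unit of the diagonal shift.\<close>

lemma symbol_free_cdet:
  assumes inj: "inj_on i {1..k}"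
  shows "symbol (free_cdet k i) = mdet k i"
proof -
  define A where "A = (\<lambda>p b q. left_op (i (p b), i b) q + of_nat (if p b = b then k - b else 0) * q)"
  define G where "G = (\<lambda>b p. foldr (A p) [1..<b])"
  have A_add: "additive (A p b)" for p b
    unfolding A_def additive_def by (simp add: left_op_add distrib_left)
  have G_add: "additive (G b p)" for b p
  proof -
    have "additive (foldr (A p) bs)" for bs
    proof (induction bs)
      case Nil
      then show ?case by (simp add: additive_def)
    next
      case (Cons b bs)
      then show ?case
        using additive_compose[OF A_add[of p b] Cons] by (simp add: additive_def)
    qed
    then show ?thesis by (simp add: G_def)
  qed
  have G_cong: "G b p q = G b p' q" if "\<And>c. c \<in> {1..<b} \<Longrightarrow> p c = p' c" for b p p' q
    unfolding G_def by (rule foldr_cong) (use that in \<open>auto simp: A_def\<close>)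
  \<comment> \<open>\<open>T b\<close> is the intermediate stage in which the columns from
    \<open>b\<close> on have been turned into a commutative product, while \<open>G b p\<close>
    still applies the columns before \<open>b\<close> as operators. \<open>T (Suc k)\<close> is the
    symbol of the column determinant and \<open>T 1\<close> is the minor.\<close>
  define T where "T = (\<lambda>b. \<Sum>p | p permutes {1..k}. of_int (sign p) * G b p (\<Prod>c\<in>{b..k}. var (i (p c), i c)))"
  have "T (Suc b) = T b" if b: "b \<in> {1..k}" for b
  proof -
    \<comment> \<open>\<open>X p\<close> is the contribution of one unit of the diagonal shift.
      \<open>Y c p\<close> is the term in which the derivation of column \<open>b\<close> hits the
      factor of column \<open>c\<close>; it is nonzero only if the row index there is
      \<open>b\<close>.\<close>
    define X where "X = (\<lambda>p. if p b = b then \<Prod>c\<in>{Suc b..k}. var (i (p c), i c) else 0)"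
    define Y where "Y = (\<lambda>c p. if p c = b then var (i (p b), i c) * (\<Prod>c'\<in>{Suc b..k} - {c}. var (i (p c'), i c')) else 0)"
    have step: "A p b (\<Prod>c\<in>{Suc b..k}. var (i (p c), i c)) =
      (\<Prod>c\<in>{b..k}. var (i (p c), i c)) + (\<Sum>c\<in>{Suc b..k}. Y c p + X p)" if p: "p permutes {1..k}" for p
    proof -
      let ?P = "\<Prod>c\<in>{Suc b..k}. var (i (p c), i c)"
      have "(\<Prod>c\<in>{b..k}. var (i (p c), i c)) = var (i (p b), i b) * ?P"
        using b by (simp add: prod.atLeast_Suc_atMost)
      moreover have "der (unit_mult (i (p b), i b)) ?P = (\<Sum>c\<in>{Suc b..k}. Y c p)"
        unfolding der_prod[OF finite_atLeastAtMost] der_var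
      proof (rule sum.cong[OF refl])
        fix c assume c: "c \<in> {Suc b..k}"
        then have "p c \<in> {1..k}" using permutes_in_image[OF p, of c] by simp
        then have "i b = i (p c) \<longleftrightarrow> p c = b"
          using inj b by (auto dest: inj_onD)
        then show "unit_mult (i (p b), i b) (i (p c), i c) * (\<Prod>c\<in>{Suc b..k} - {c}. var (i (p c), i c)) = Y c p"
          by (simp add: unit_mult_def Y_def)
      qed
      \<comment> \<open>The shift \<open>k - b\<close> is the number of columns to the right of
        \<open>b\<close>, so it supplies one copy of \<open>X p\<close> for each of them.\<close>
      moreover have "of_nat (if p b = b then k - b else 0) * ?P = (\<Sum>c\<in>{Suc b..k}. X p)"
        by (simp add: X_def)
      ultimately show ?thesis
        by (simp add: A_def left_op_def sum.distrib)
    qed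
    have "T (Suc b) = (\<Sum>p | p permutes {1..k}. of_int (sign p) * G b p (A p b (\<Prod>c\<in>{Suc b..k}. var (i (p c), i c))))"
      using b by (simp add: T_def G_def)
    also have "\<dots> = (\<Sum>p | p permutes {1..k}. of_int (sign p) * G b p (\<Prod>c\<in>{b..k}. var (i (p c), i c))
        + (\<Sum>c\<in>{Suc b..k}. of_int (sign p) * G b p (Y c p) + of_int (sign p) * G b p (X p)))"
      by (rule sum.cong[OF refl])
        (simp add: step additive.add[OF G_add] additive.sum[OF G_add] distrib_left sum_distrib_left)
    also have "\<dots> = T b + (\<Sum>c\<in>{Suc b..k}. (\<Sum>p | p permutes {1..k}. of_int (sign p) * G b p (Y c p))
        + (\<Sum>p | p permutes {1..k}. of_int (sign p) * G b p (X p)))"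
      unfolding T_def sum.distrib
      by (simp add: sum.swap[of "\<lambda>p c. of_int (sign p) * G b p (Y c p)"] sum_distrib_left)
    also have "(\<Sum>c\<in>{Suc b..k}. (\<Sum>p | p permutes {1..k}. of_int (sign p) * G b p (Y c p))
        + (\<Sum>p | p permutes {1..k}. of_int (sign p) * G b p (X p))) = 0"
    proof (rule sum.neutral, rule ballI)
      fix c assume c: "c \<in> {Suc b..k}"
      show "(\<Sum>p | p permutes {1..k}. of_int (sign p) * G b p (Y c p))
        + (\<Sum>p | p permutes {1..k}. of_int (sign p) * G b p (X p)) = 0"
      proof (rule sum_permutes_transpose_cancel)
        fix p :: "nat \<Rightarrow> nat"
        have "Y c (p \<circ> Transposition.transpose b c) = X p"
        proof -
          have "(\<Prod>c'\<in>{Suc b..k} - {c}. var (i ((p \<circ> Transposition.transpose b c) c'), i c')) = (\<Prod>c'\<in>{Suc b..k} - {c}. var (i (p c'), i c'))"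
            by (rule prod.cong) (auto simp: transpose_apply_other)
          then show ?thesis
            using c by (simp add: Y_def X_def prod.remove[of "{Suc b..k}" c])
        qed
        \<comment> \<open>The transposition moves only \<open>b\<close> and \<open>c\<close>, so the
          operators of the columns before \<open>b\<close> are unaffected.\<close>
        moreover have "G b (p \<circ> Transposition.transpose b c) q = G b p q" for q
          using c by (intro G_cong) (auto simp: transpose_apply_other)
        ultimately show "G b (p \<circ> Transposition.transpose b c) (Y c (p \<circ> Transposition.transpose b c)) = G b p (X p)"
          by simp
      qed (use b c in auto)
    qed
    finally show ?thesis by simp
  qed
  then have *: "T (Suc b) = T b" if "b \<in> {1..k}" for b
    using that by blast
  have T: "b \<le> k \<Longrightarrow> T (Suc b) = T (Suc 0)" for b
  proof (induction b)
    case (Suc b)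
    have "T (Suc (Suc b)) = T (Suc b)" by (rule *) (use Suc.prems in simp)
    also have "\<dots> = T (Suc 0)" by (rule Suc.IH) (use Suc.prems in simp)
    finally show ?case .
  qed simp
  have "T (Suc k) = T 1" using T[OF order_refl] by (simp only: One_nat_def)
  moreover have "T 1 = mdet k i"
    by (simp add: T_def G_def mdet_def)
  moreover have "symbol (free_cdet k i) = T (Suc k)"
  proof -
    have "symbol (foldr (\<lambda>b x. (letter (i (p b)) (i b) + of_nat (if p b = b then k - p b else 0)) * x) bs 1)
      = foldr (A p) bs 1" for p bs
      by (induction bs) (simp_all add: A_def distrib_right symbol_add letter_eq symbol_letter_mult symbol_of_nat_mult)
    then show ?thesis
      by (simp add: free_cdet_def T_def G_def symbol_sum symbol_of_int_mult Suc_eq_plus1 del: upt_Suc)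
  qed
  ultimately show ?thesis by simp
qed

section \<open>Minors with permuted or repeated indices\<close>

lemma mdet_cong: "(\<And>b. b \<in> {1..k} \<Longrightarrow> i b = j b) \<Longrightarrow> mdet k i = mdet k j"
  unfolding mdet_def
proof (intro sum.cong arg_cong2[of _ _ _ _ "(*)"] prod.cong refl)
  fix p b assume *: "\<And>b. b \<in> {1..k} \<Longrightarrow> i b = j b" "p \<in> {p. p permutes {1..k}}" "b \<in> {1..k}"
  then have "p b \<in> {1..k}"
    using permutes_in_image[of p "{1..k}" b] by simp
  then show "var (i (p b), i b) = var (j (p b), j b)"
    using * by simp
qed

text \<open>Rows and columns are permuted simultaneously: conjugation by \<open>q\<close> permutes
  the summation index, keeps its sign, and only reorders the factors of the product.\<close>

lemma mdet_compose:
  assumes q: "q permutes {1..k}"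
  shows "mdet k (i \<circ> q) = mdet k i"
proof -
  have "mdet k i = (\<Sum>p | p permutes {1..k}. of_int (sign (q \<circ> p)) * (\<Prod>b\<in>{1..k}. var (i ((q \<circ> p) b), i b)))"
    unfolding mdet_def by (rule setum_permutations_compose_left[OF q])
  also have "\<dots> = (\<Sum>p | p permutes {1..k}. of_int (sign (q \<circ> (p \<circ> inv_into UNIV q))) * (\<Prod>b\<in>{1..k}. var (i ((q \<circ> (p \<circ> inv_into UNIV q)) b), i b)))"
    by (rule sum_permutations_compose_right[OF permutes_inv[OF q]])
  also have "\<dots> = mdet k (i \<circ> q)"
    unfolding mdet_def
  proof (rule sum.cong[OF refl])
    fix p assume "p \<in> {p. p permutes {1..k}}"
    then have p: "p permutes {1..k}" by simp
    have perms: "permutation p" "permutation q" "permutation (inv_into UNIV q)"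
      using p q permutes_inv[OF q] by (auto intro: permutes_imp_permutation[of "{1..k}"])
    have "sign (q \<circ> (p \<circ> inv_into UNIV q)) = sign p"
      using perms by (simp add: sign_compose permutation_compose sign_inverse mult.left_commute)
    moreover have "(\<Prod>b\<in>{1..k}. var (i ((q \<circ> (p \<circ> inv_into UNIV q)) b), i b)) = (\<Prod>b\<in>{1..k}. var ((i \<circ> q) (p b), (i \<circ> q) b))"
      by (subst prod.permute[OF q]) (simp add: permutes_inverses[OF q] o_def)
    ultimately show "of_int (sign (q \<circ> (p \<circ> inv_into UNIV q))) * (\<Prod>b\<in>{1..k}. var (i ((q \<circ> (p \<circ> inv_into UNIV q)) b), i b))
      = of_int (sign p) * (\<Prod>b\<in>{1..k}. var ((i \<circ> q) (p b), (i \<circ> q) b))"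
      by simp
  qed
  finally show ?thesis ..
qed

text \<open>Two rows coincide, so exchanging them shows that the minor equals its own negative; the
  coefficients are complex numbers and therefore vanish.\<close>

lemma mdet_not_inj:
  assumes "\<not> inj_on i {1..k}"
  shows "mdet k i = 0"
proof -
  obtain b c where bc: "b \<in> {1..k}" "c \<in> {1..k}" "b \<noteq> c" "i b = i c"
    using assms by (auto simp: inj_on_def)
  have i: "i (Transposition.transpose b c x) = i x" for x
    using bc(4) by (simp add: Transposition.transpose_def)
  have t: "Transposition.transpose b c permutes {1..k}"
    using bc by (intro permutes_swap_id)
  have "mdet k i = (\<Sum>p | p permutes {1..k}. of_int (sign (Transposition.transpose b c \<circ> p)) * (\<Prod>x\<in>{1..k}. var (i ((Transposition.transpose b c \<circ> p) x), i x)))"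
    unfolding mdet_def by (rule setum_permutations_compose_left[OF t])
  also have "\<dots> = (\<Sum>p | p permutes {1..k}. - (of_int (sign p) * (\<Prod>x\<in>{1..k}. var (i (p x), i x))))"
  proof (rule sum.cong[OF refl])
    fix p assume "p \<in> {p. p permutes {1..k}}"
    then have "sign (Transposition.transpose b c \<circ> p) = - sign p"
      using bc t by (subst sign_compose) (auto intro: permutes_imp_permutation[of "{1..k}"] simp: sign_swap_id)
    then show "of_int (sign (Transposition.transpose b c \<circ> p)) * (\<Prod>x\<in>{1..k}. var (i ((Transposition.transpose b c \<circ> p) x), i x))
      = - (of_int (sign p) * (\<Prod>x\<in>{1..k}. var (i (p x), i x)))"
      by (simp add: i)
  qed
  also have "\<dots> = - mdet k i"
    by (simp add: mdet_def sum_negf)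
  finally have eq: "mdet k i = - mdet k i" .
  show ?thesis
  proof (rule poly_mapping_eqI)
    fix m
    have "Poly_Mapping.lookup (mdet k i) m = - Poly_Mapping.lookup (mdet k i) m"
      by (subst eq) simp
    then show "Poly_Mapping.lookup (mdet k i) m = Poly_Mapping.lookup 0 m" by simp
  qed
qed


lemma ad_prod_var_sum:
  \<comment> \<open>For fixed \<open>p\<close> the sum is the product, over the cycles of
    \<open>p\<close>, of traces of powers of the generic matrix with the cycle lengths as exponents.
    In the proof \<open>P c\<close> collects the terms in which the row index of factor
    \<open>c\<close> is replaced and \<open>Q c\<close> those in which its column index is replaced.
    The row index of factor \<open>c\<close> is the column index of factor \<open>p c\<close>, so
    summing over all tuples makes the two kinds cancel.\<close>
  fixes k :: nat
  assumes p: "p permutes {1..k}" and a: "a \<in> {1..n} \<times> {1..n}"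
  shows "ad a (\<Sum>i\<in>{1..k} \<rightarrow>\<^sub>E {1..n}. \<Prod>b\<in>{1..k}. var (i (p b), i b)) = 0"
proof -
  obtain u v where uv: "a = (u, v)" "u \<in> {1..n}" "v \<in> {1..n}" using a by auto
  let ?I = "{1..k} \<rightarrow>\<^sub>E {1..n}"
  define P where "P = (\<lambda>c i. (if i (p c) = v then var (u, i c) * (\<Prod>b\<in>{1..k} - {c}. var (i (p b), i b)) else 0) :: gpoly)"
  define Q where "Q = (\<lambda>c i. (if i c = u then var (i (p c), v) * (\<Prod>b\<in>{1..k} - {c}. var (i (p b), i b)) else 0) :: gpoly)"
  have PQ: "(\<Sum>i\<in>?I. P c i) = (\<Sum>i\<in>?I. Q (p c) i)" if c: "c \<in> {1..k}" for c
  proof -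
    define d where "d = p c"
    have d: "d \<in> {1..k}" using c permutes_in_image[OF p, of c] by (simp add: d_def)
    have "(\<Sum>i\<in>?I. P c i) = (\<Sum>i\<in>{i \<in> ?I. i d = v}. P c i)"
      by (rule sum.mono_neutral_right) (auto simp: P_def d_def finite_PiE)
    also have "\<dots> = (\<Sum>i\<in>{i \<in> ?I. i d = u}. Q d i)"
    \<comment> \<open>The index \<open>i d\<close> is the row index of factor \<open>c\<close> and
      the column index of factor \<open>d\<close>. Changing it from \<open>v\<close> to
      \<open>u\<close> turns "row index of factor \<open>c\<close> replaced by \<open>u\<close>"
      into "column index of factor \<open>d\<close> replaced by \<open>v\<close>".\<close>
    proof (rule sum.reindex_bij_witness[of _ "\<lambda>i. i(d := v)" "\<lambda>i. i(d := u)"])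
      fix i assume i: "i \<in> {i \<in> ?I. i d = v}"
      show "(i(d := u))(d := v) = i" using i by auto
      show "i(d := u) \<in> {i \<in> ?I. i d = u}"
        using i uv d by (auto simp: PiE_iff extensional_def)
      have inj: "p b = d \<longleftrightarrow> b = c" for b
        using permutes_inj[OF p] by (auto simp: d_def inj_eq)
      show "Q d (i(d := u)) = P c i"
      \<comment> \<open>If \<open>p\<close> fixes \<open>c\<close>, both occurrences of the index
        lie in the same factor, which then has to be treated separately.\<close>
      proof (cases "c = d")
        case True
        have "(\<Prod>b\<in>{1..k} - {c}. var ((i(d := u)) (p b), (i(d := u)) b)) = (\<Prod>b\<in>{1..k} - {c}. var (i (p b), i b))"
          using True inj by (intro prod.cong) auto
        moreover have "p d = d" using True d_def by simp
        ultimately show ?thesis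
          using i True by (simp add: P_def Q_def)
      next
        case False
        have rest: "(\<Prod>b\<in>{1..k} - {c} - {d}. var ((i(d := u)) (p b), (i(d := u)) b)) = (\<Prod>b\<in>{1..k} - {c} - {d}. var (i (p b), i b))"
          using inj by (intro prod.cong) auto
        have "{1..k} - {d} - {c} = {1..k} - {c} - {d}" by auto
        then have "(\<Prod>b\<in>{1..k} - {d}. var ((i(d := u)) (p b), (i(d := u)) b))
          = var (u, i c) * (\<Prod>b\<in>{1..k} - {c} - {d}. var (i (p b), i b))"
          using prod.remove[of "{1..k} - {d}" c "\<lambda>b. var ((i(d := u)) (p b), (i(d := u)) b)"] c False rest
          by (simp add: d_def[symmetric])
        moreover have "(\<Prod>b\<in>{1..k} - {c}. var (i (p b), i b))
          = var (i (p d), v) * (\<Prod>b\<in>{1..k} - {c} - {d}. var (i (p b), i b))"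
          using prod.remove[of "{1..k} - {c}" d "\<lambda>b. var (i (p b), i b)"] d False i by simp
        moreover have "p d \<noteq> d" using inj[of d] False by auto
        ultimately show ?thesis
          using i by (simp add: P_def Q_def d_def[symmetric] ac_simps)
      qed
    next
      fix i assume i: "i \<in> {i \<in> ?I. i d = u}"
      show "(i(d := v))(d := u) = i" using i by auto
      show "i(d := v) \<in> {i \<in> ?I. i d = v}"
        using i uv d by (auto simp: PiE_iff extensional_def)
    qed
    also have "\<dots> = (\<Sum>i\<in>?I. Q d i)"
      by (rule sum.mono_neutral_left) (auto simp: Q_def finite_PiE)
    finally show ?thesis by (simp add: d_def)
  qed
  have "ad a (\<Sum>i\<in>?I. \<Prod>b\<in>{1..k}. var (i (p b), i b)) = (\<Sum>i\<in>?I. \<Sum>c\<in>{1..k}. P c i - Q c i)"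
  proof -
    have "(unit_mult a (i (p c), i c) - unit_mult (i (p c), i c) a) * (\<Prod>b\<in>{1..k} - {c}. var (i (p b), i b)) = P c i - Q c i" for i c
      by (auto simp: unit_mult_def uv P_def Q_def left_diff_distrib)
    then show ?thesis
      unfolding ad_def der_sum der_prod[OF finite_atLeastAtMost] der_var by simp
  qed
  also have "\<dots> = (\<Sum>c\<in>{1..k}. \<Sum>i\<in>?I. P c i) - (\<Sum>c\<in>{1..k}. \<Sum>i\<in>?I. Q c i)"
    by (simp add: sum_subtractf sum.swap[of "\<lambda>i c. P c i"] sum.swap[of "\<lambda>i c. Q c i"])
  also have "(\<Sum>c\<in>{1..k}. \<Sum>i\<in>?I. P c i) = (\<Sum>c\<in>{1..k}. \<Sum>i\<in>?I. Q (p c) i)"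
    by (intro sum.cong PQ) simp_all
  also have "\<dots> = (\<Sum>c\<in>{1..k}. \<Sum>i\<in>?I. Q c i)"
    using sum.permute[OF p, of "\<lambda>c. \<Sum>i\<in>?I. Q c i"] by (simp add: o_def)
  finally show ?thesis by simp
qed

section \<open>Increasing tuples and sums of principal minors\<close>

definition strict_tuples :: "nat \<Rightarrow> nat \<Rightarrow> (nat \<Rightarrow> nat) set" where
  "strict_tuples n k = {i \<in> {1..k} \<rightarrow>\<^sub>E {1..n}. strict_mono_on {1..k} i}"

lemma finite_strict_tuples [simp]: "finite (strict_tuples n k)"
  by (simp add: strict_tuples_def finite_PiE)

lemma strict_tuples_inj: "i \<in> strict_tuples n k \<Longrightarrow> inj_on i {1..k}"
  unfolding strict_tuples_def using strict_mono_on_imp_inj_on by blast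

text \<open>The values in their order form the sorted list of the image, which the image
  determines.\<close>

lemma strict_tuples_eq:
  assumes "i \<in> strict_tuples n k" "j \<in> strict_tuples n k" "i ` {1..k} = j ` {1..k}"
  shows "i = j"
proof -
  have *: "map i [1..<Suc k] = sorted_list_of_set (i ` {1..k})" if "i \<in> strict_tuples n k" for i
  proof -
    have "sorted_wrt (<) (map i [1..<Suc k])"
      unfolding sorted_wrt_map
      by (rule sorted_wrt_mono_rel[OF _ sorted_wrt_upt])
        (use that in \<open>auto simp: strict_tuples_def strict_mono_on_def simp del: upt_Suc\<close>)
    moreover have "set (map i [1..<Suc k]) = i ` {1..k}"
      by (auto simp del: upt_Suc)
    ultimately show ?thesis
      by (metis sorted_list_of_set.idem_if_sorted_distinct strict_sorted_iff)
  qed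
  have "map i [1..<Suc k] = map j [1..<Suc k]"
    by (simp only: *[OF assms(1)] *[OF assms(2)] assms(3))
  then have "\<forall>b\<in>set [1..<Suc k]. i b = j b"
    by (simp only: map_eq_conv)
  then have "i b = j b" if "b \<in> {1..k}" for b
  proof -
    have "b \<in> set [1..<Suc k]" using that by (simp del: upt_Suc)
    then show ?thesis using \<open>\<forall>b\<in>set [1..<Suc k]. i b = j b\<close> by blast
  qed
  then show ?thesis
    using assms(1,2) by (intro PiE_ext[of i "{1..k}" "\<lambda>_. {1..n}" j]) (simp_all add: strict_tuples_def)
qed

lemma ex_strict_tuple:
  assumes "K \<subseteq> {1..n}" "card K = k"
  shows "\<exists>j\<in>strict_tuples n k. j ` {1..k} = K"
proof -
  have fin: "finite K" using assms finite_subset by blast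
  obtain h where h: "bij_betw h {..<card K} K" "strict_mono_on {..<card K} h"
    using ex_bij_betw_strict_mono_card[OF fin] .
  have img: "(\<lambda>b. b - 1) ` {1..k} = {..<k}"
    by (force simp: image_iff intro: bexI[of _ "Suc _"])
  have hK: "h ` {..<k} = K"
    using h(1) assms(2) by (simp add: bij_betw_def)
  let ?j = "restrict (\<lambda>b. h (b - 1)) {1..k}"
  have "?j ` {1..k} = h ` ((\<lambda>b. b - 1) ` {1..k})"
    by (auto simp: image_image)
  then have jK: "?j ` {1..k} = K"
    by (simp only: img hK)
  moreover have "?j \<in> strict_tuples n k"
    unfolding strict_tuples_def
  proof (intro CollectI conjI)
    show "?j \<in> {1..k} \<rightarrow>\<^sub>E {1..n}"
      using jK assms(1) by (auto simp del: atLeastAtMost_iff)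
    show "strict_mono_on {1..k} ?j"
    proof (rule strict_mono_onI)
      fix a b assume "a \<in> {1..k}" "b \<in> {1..k}" "a < b"
      then have "a - 1 \<in> {..<card K}" "b - 1 \<in> {..<card K}" "a - 1 < b - 1"
        using assms(2) by auto
      then show "?j a < ?j b"
        using strict_mono_onD[OF h(2)] \<open>a \<in> {1..k}\<close> \<open>b \<in> {1..k}\<close> by simp
    qed
  qed
  ultimately show ?thesis by blast
qed

text \<open>The sum of the principal \<open>k\<close>-minors of the generic matrix, that is, up to
  sign a coefficient of its characteristic polynomial.\<close>

definition esym :: "nat \<Rightarrow> nat \<Rightarrow> gpoly" where
  "esym n k = (\<Sum>i\<in>strict_tuples n k. mdet k i)"

text \<open>Tuples with a repetition contribute 0, and every set of \<open>k\<close> indices is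
  listed by \<open>fact k\<close> tuples with the same minor. The sum over all tuples is the form in
  which invariance is visible.\<close>

lemma sum_mdet_all:
  "(\<Sum>i\<in>{1..k} \<rightarrow>\<^sub>E {1..n}. mdet k i) = of_nat (fact k) * esym n k"
proof -
  let ?I = "{1..k} \<rightarrow>\<^sub>E {1..n}"
  let ?S = "strict_tuples n k \<times> {p. p permutes {1..k}}"
  let ?f = "\<lambda>(j, p). restrict (j \<circ> p) {1..k}"
  have img: "restrict (j \<circ> p) {1..k} ` {1..k} = j ` {1..k}" if "p permutes {1..k}" for j :: "nat \<Rightarrow> nat" and p
    by (simp only: image_restrict_eq image_comp[symmetric] permutes_image[OF that])
  have "bij_betw ?f ?S {i \<in> ?I. inj_on i {1..k}}"
  proof (rule bij_betwI')
    fix x y assume "x \<in> ?S" "y \<in> ?S"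
    then obtain j p j' p' where *: "x = (j, p)" "y = (j', p')" "j \<in> strict_tuples n k" "p permutes {1..k}"
       "j' \<in> strict_tuples n k" "p' permutes {1..k}" by auto
    show "(?f x = ?f y) = (x = y)"
    proof
      assume eq: "?f x = ?f y"
      then have "j ` {1..k} = j' ` {1..k}"
        using img[OF *(4), of j] img[OF *(6), of j'] by (simp add: *(1,2))
      then have j: "j = j'" using strict_tuples_eq * by blast
      have "p b = p' b" if "b \<in> {1..k}" for b
      proof -
        have "j (p b) = j (p' b)"
          using fun_cong[OF eq, of b] that by (simp add: * j)
        then show ?thesis
          using strict_tuples_inj[OF *(3)] that permutes_in_image[OF *(4), of b] permutes_in_image[OF *(6), of b]
          by (auto dest: inj_onD)
      qed
      then have "p = p'"
        using *(4,6) by (metis permutes_def ext)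
      then show "x = y" using * j by simp
    qed simp
  next
    fix x assume "x \<in> ?S"
    then obtain j p where *: "x = (j, p)" "j \<in> strict_tuples n k" "p permutes {1..k}" by auto
    have "restrict (j \<circ> p) {1..k} \<in> ?I"
      using *(2) permutes_in_image[OF *(3)] by (auto simp: strict_tuples_def)
    moreover have "inj_on (restrict (j \<circ> p) {1..k}) {1..k}"
      using strict_tuples_inj[OF *(2)] permutes_inj_on[OF *(3)] permutes_image[OF *(3)]
      by (intro inj_on_restrict_eq[THEN iffD2] comp_inj_on) simp_all
    ultimately show "?f x \<in> {i \<in> ?I. inj_on i {1..k}}"
      using *(1) by simp
  next
    fix i assume i: "i \<in> {i \<in> ?I. inj_on i {1..k}}"
    then obtain j where j: "j \<in> strict_tuples n k" "j ` {1..k} = i ` {1..k}"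
      using ex_strict_tuple[of "i ` {1..k}" n k] by (auto simp: card_image)
    have bij: "bij_betw j {1..k} (i ` {1..k})" "bij_betw i {1..k} (i ` {1..k})"
      using strict_tuples_inj[OF j(1)] j(2) i by (auto simp: bij_betw_def)
    define p where "p = (\<lambda>b. if b \<in> {1..k} then (inv_into {1..k} j \<circ> i) b else b)"
    have "bij_betw (inv_into {1..k} j \<circ> i) {1..k} {1..k}"
      using bij bij_betw_inv_into bij_betw_trans by blast
    then have p: "p permutes {1..k}"
      using bij_betw_cong[of "{1..k}" p "inv_into {1..k} j \<circ> i" "{1..k}"]
      by (intro bij_imp_permutes) (auto simp: p_def)
    have "i = ?f (j, p)"
    proof (rule ext)
      fix b
      show "i b = ?f (j, p) b"
      proof (cases "b \<in> {1..k}")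
        case True
        then show ?thesis
          using j(2) by (simp add: p_def f_inv_into_f)
      next
        case False
        then show ?thesis using i by (auto simp: PiE_def extensional_def)
      qed
    qed
    then show "\<exists>x\<in>?S. i = ?f x" using j p by blast
  qed
  then have "(\<Sum>i\<in>{i \<in> ?I. inj_on i {1..k}}. mdet k i) = (\<Sum>x\<in>?S. mdet k (?f x))"
    by (rule sum.reindex_bij_betw[symmetric])
  also have "\<dots> = (\<Sum>x\<in>?S. mdet k (fst x))"
  proof (rule sum.cong[OF refl])
    fix x assume "x \<in> ?S"
    then show "mdet k (?f x) = mdet k (fst x)"
      using mdet_compose mdet_cong[of k "restrict (fst x \<circ> snd x) {1..k}" "fst x \<circ> snd x"]
      by (auto simp: case_prod_beta)
  qed
  also have "\<dots> = (\<Sum>j\<in>strict_tuples n k. \<Sum>p | p permutes {1..k}. mdet k j)"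
    unfolding sum.cartesian_product by (simp add: case_prod_beta)
  also have "\<dots> = of_nat (fact k) * esym n k"
  proof -
    have "card {p. p permutes {1..k}} = fact k"
      by (rule card_permutations) simp_all
    then show ?thesis
      by (simp only: sum_constant esym_def sum_distrib_left)
  qed
  also have "(\<Sum>i\<in>{i \<in> ?I. inj_on i {1..k}}. mdet k i) = (\<Sum>i\<in>?I. mdet k i)"
    by (rule sum.mono_neutral_left) (auto simp: mdet_not_inj finite_PiE)
  finally show ?thesis .
qed

lemma additive_ad: "additive (ad a)"
  unfolding ad_def by (rule additive_der)

lemma ad_of_int_mult: "ad a (of_int c * p) = of_int c * ad a p"
  using der_cst_mult[of _ "of_int c" p] by (simp add: ad_def)

lemma ad_esym:
  assumes "a \<in> {1..n} \<times> {1..n}"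
  shows "ad a (esym n k) = 0"
proof -
  have "(\<Sum>i\<in>{1..k} \<rightarrow>\<^sub>E {1..n}. mdet k i)
     = (\<Sum>p | p permutes {1..k}. of_int (sign p) * (\<Sum>i\<in>{1..k} \<rightarrow>\<^sub>E {1..n}. \<Prod>b\<in>{1..k}. var (i (p b), i b)))"
    unfolding mdet_def by (subst sum.swap) (simp add: sum_distrib_left)
  then have "ad a (\<Sum>i\<in>{1..k} \<rightarrow>\<^sub>E {1..n}. mdet k i)
     = (\<Sum>p | p permutes {1..k}. of_int (sign p) * ad a (\<Sum>i\<in>{1..k} \<rightarrow>\<^sub>E {1..n}. \<Prod>b\<in>{1..k}. var (i (p b), i b)))"
    by (simp only: additive.sum[OF additive_ad] ad_of_int_mult)
  also have "\<dots> = 0"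
    by (rule sum.neutral, rule ballI, subst ad_prod_var_sum[OF _ assms]) simp_all
  \<comment> \<open>As a constant polynomial the factor \<open>fact k\<close> can be cancelled in
    each coefficient.\<close>
  finally have *: "cst (of_nat (fact k)) * ad a (esym n k) = 0"
    by (simp only: sum_mdet_all cst_of_nat[symmetric] ad_def der_cst_mult)
  show ?thesis
  proof (rule poly_mapping_eqI)
    fix m
    have "of_nat (fact k) * Poly_Mapping.lookup (ad a (esym n k)) m = 0"
      using arg_cong[OF *, of "\<lambda>p. Poly_Mapping.lookup p m"] unfolding lookup_cst_mult by simp
    then show "Poly_Mapping.lookup (ad a (esym n k)) m = Poly_Mapping.lookup 0 m"
      by simp
  qed
qed

section \<open>Symmetry of invariants on the diagonal\<close>

definition psubst :: "(complex \<Rightarrow> 'r::comm_ring_1) \<Rightarrow> ('v \<Rightarrow> 'r) \<Rightarrow> ('v multiset \<Rightarrow>\<^sub>0 complex) \<Rightarrow> 'r" where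
  "psubst sc g = lin_ext sc (\<lambda>m. \<Prod>v\<in>#m. g v)"

text \<open>The embedding of scalars is a parameter so that evaluation at complex points and
  substitution of polynomials for variables are two instances of one homomorphism.\<close>

locale scalar_hom =
  fixes sc :: "complex \<Rightarrow> 'r::comm_ring_1"
  assumes add: "sc (c + d) = sc c + sc d" and mult: "sc (c * d) = sc c * sc d" and one: "sc 1 = 1"
begin

lemma additive_sc: "additive sc"
  by (simp add: additive_def add)

lemma additive_psubst: "additive (psubst sc g)"
  unfolding psubst_def by (intro additive_lin_ext additive_sc)

lemmas psubst_add = additive.add[OF additive_psubst] and psubst_diff = additive.diff[OF additive_psubst]
  and psubst_0 = additive.zero[OF additive_psubst] and psubst_sum = additive.sum[OF additive_psubst]

lemma psubst_single: "psubst sc g (Poly_Mapping.single m c) = sc c * (\<Prod>v\<in>#m. g v)"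
  unfolding psubst_def by (simp add: lin_ext_single additive_sc)

lemma psubst_mon: "psubst sc g (mon m) = (\<Prod>v\<in>#m. g v)"
  by (simp add: mon_def psubst_single one)

lemma psubst_cst: "psubst sc g (cst c) = sc c"
proof -
  have c: "cst c = Poly_Mapping.single {#} c" by (simp add: cst_def)
  show ?thesis unfolding c psubst_single by simp
qed

lemma psubst_cst_mult: "psubst sc g (cst c * p) = sc c * psubst sc g p"
proof (rule additive_cong_single[of "\<lambda>p. psubst sc g (cst c * p)" "\<lambda>p. sc c * psubst sc g p"])
  show "psubst sc g (cst c * Poly_Mapping.single k d) = sc c * psubst sc g (Poly_Mapping.single k d)" for k d
    by (simp add: cst_def[of c] mult_single psubst_single mult mult.assoc)
qed (intro additive_compose[OF additive_psubst] additive_intros)+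

lemma psubst_var_mult: "psubst sc g (var v * p) = g v * psubst sc g p"
proof (rule additive_cong_single[of "\<lambda>p. psubst sc g (var v * p)" "\<lambda>p. g v * psubst sc g p"])
  show "psubst sc g (var v * Poly_Mapping.single k d) = g v * psubst sc g (Poly_Mapping.single k d)" for k d
    by (simp add: var_def mon_def mult_single psubst_single mult.left_commute)
qed (intro additive_compose[OF additive_psubst] additive_intros)+

lemma psubst_mult: "psubst sc g (p * q) = psubst sc g p * psubst sc g q"
  by (induction p rule: mpoly_induct)
    (simp_all add: psubst_cst psubst_cst_mult psubst_add distrib_right psubst_var_mult mult.assoc)

lemma psubst_1: "psubst sc g 1 = 1"
  using psubst_cst[of g 1] by (simp add: one)

lemma psubst_var: "psubst sc g (var v) = g v"
  using psubst_var_mult[of g v 1] by (simp add: psubst_1)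

lemma psubst_prod: "psubst sc g (\<Prod>a\<in>A. f a) = (\<Prod>a\<in>A. psubst sc g (f a))"
  by (induction A rule: infinite_finite_induct) (simp_all add: psubst_1 psubst_mult)

end

interpretation ev: scalar_hom "\<lambda>c. c"
  by standard simp_all

interpretation poly_subst: scalar_hom "cst :: complex \<Rightarrow> 'v multiset \<Rightarrow>\<^sub>0 complex"
  by standard (simp_all add: cst_add cst_mult)

abbreviation ev :: "('v \<Rightarrow> complex) \<Rightarrow> ('v multiset \<Rightarrow>\<^sub>0 complex) \<Rightarrow> complex" where
  "ev \<equiv> psubst (\<lambda>c. c)"

abbreviation poly_subst :: "('v \<Rightarrow> ('w multiset \<Rightarrow>\<^sub>0 complex)) \<Rightarrow> ('v multiset \<Rightarrow>\<^sub>0 complex) \<Rightarrow> ('w multiset \<Rightarrow>\<^sub>0 complex)" where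
  "poly_subst \<equiv> psubst cst"

lemma ev_subst: "ev x (poly_subst g p) = ev (\<lambda>v. ev x (g v)) p"
  by (induction p rule: mpoly_induct)
    (simp_all add: ev.psubst_cst poly_subst.psubst_cst ev.psubst_add poly_subst.psubst_add poly_subst.psubst_var_mult
      ev.psubst_var_mult ev.psubst_mult ev.psubst_var)

text \<open>Monomials are pairwise distinct multiplicative characters of the points, hence linearly independent.\<close>

lemma monomials_independent:
  fixes c :: "'v multiset \<Rightarrow> complex"
  assumes "finite S" "\<And>x :: 'v \<Rightarrow> complex. (\<Sum>m\<in>S. c m * (\<Prod>v\<in>#m. x v)) = 0" "m \<in> S"
  shows "c m = 0"
  using assms
proof (induction S arbitrary: c m rule: finite_induct)
  case (insert m0 S)
  let ?\<chi> = "\<lambda>m x. \<Prod>v\<in>#m. x v :: complex"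
  have S: "c m = 0" if m: "m \<in> S" for m
  proof -
    have diff0: "c m * (?\<chi> m y - ?\<chi> m0 y) = 0" for y
    proof (rule insert.IH[of "\<lambda>m. c m * (?\<chi> m y - ?\<chi> m0 y)", OF _ m])
      fix x
      \<comment> \<open>Dedekind's argument: scaling the point by \<open>y\<close> multiplies each
        term by \<open>?\<chi> m y\<close>; subtracting \<open>?\<chi> m0 y\<close> times the
        original relation eliminates \<open>m0\<close>.\<close>
      have "(\<Sum>m\<in>insert m0 S. c m * ?\<chi> m (\<lambda>v. x v * y v)) - ?\<chi> m0 y * (\<Sum>m\<in>insert m0 S. c m * ?\<chi> m x) = 0"
        by (simp only: insert.prems(1)) simp
      then show "(\<Sum>m\<in>S. c m * (?\<chi> m y - ?\<chi> m0 y) * ?\<chi> m x) = 0"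
        using insert.hyps
        by (simp add: prod_mset.distrib sum_distrib_left algebra_simps sum_subtractf[symmetric])
    qed
    have "m \<noteq> m0" using m insert.hyps by blast
    then obtain v where v: "count m v \<noteq> count m0 v"
      by (auto simp: multiset_eq_iff)
    \<comment> \<open>This point separates the two characters: its value under a monomial is 2 to
      the multiplicity of \<open>v\<close>.\<close>
    define y :: "'v \<Rightarrow> complex" where "y = (\<lambda>w. if w = v then 2 else 1)"
    have "?\<chi> l y = 2 ^ count l v" for l
      by (induction l) (auto simp: y_def)
    moreover have "(2 :: complex) ^ a \<noteq> 2 ^ b" if "a \<noteq> b" for a b :: nat
    proof
      assume "(2 :: complex) ^ a = 2 ^ b"
      then have "(of_nat (2 ^ a) :: complex) = of_nat (2 ^ b)" by simp
      then have "(2 :: nat) ^ a = 2 ^ b" by (simp only: of_nat_eq_iff)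
      then show False using that by simp
    qed
    ultimately have "?\<chi> m y \<noteq> ?\<chi> m0 y"
      using v by simp
    then show ?thesis using diff0[of y] by simp
  qed
  have "c m0 = 0"
    using insert.prems(1)[of "\<lambda>_. 1"] S insert.hyps by (simp add: sum.neutral)
  then show ?case using S insert.prems(2) by blast
qed simp

lemma ev_eq_imp_eq:
  assumes "\<And>x. ev x p = ev x q"
  shows "p = q"
proof -
  have "Poly_Mapping.lookup (p - q) m = 0" if "m \<in> Poly_Mapping.keys (p - q)" for m
  proof (rule monomials_independent[OF finite_keys _ that])
    fix x
    have "ev x (p - q) = 0" by (simp add: ev.psubst_diff assms)
    then show "(\<Sum>m\<in>Poly_Mapping.keys (p - q). Poly_Mapping.lookup (p - q) m * (\<Prod>v\<in>#m. x v)) = 0"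
      by (simp add: psubst_def lin_ext_def)
  qed
  then have "Poly_Mapping.lookup (p - q) m = 0" for m
    by (cases "m \<in> Poly_Mapping.keys (p - q)") (auto simp: in_keys_iff)
  then show ?thesis
    by (intro poly_mapping_eqI) (simp add: lookup_minus)
qed

text \<open>The chain rule along an integral curve of the vector field \<open>g\<close>. It turns
  the algebraic condition \<open>der g p = 0\<close> into constancy of \<open>p\<close> along the
  curve.\<close>

lemma has_field_derivative_ev:
  assumes "\<And>v. ((\<lambda>t. X t v) has_field_derivative ev (X t) (g v)) (at t)"
  shows "((\<lambda>t. ev (X t) p) has_field_derivative ev (X t) (der g p)) (at t)"
proof (induction p rule: mpoly_induct)
  case (var v p)
  show ?case
    unfolding der_var_mult ev.psubst_var_mult ev.psubst_add ev.psubst_mult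
    using DERIV_mult[OF assms[of v] var] by (simp add: ev.psubst_var ac_simps)
qed (simp_all add: ev.psubst_cst ev.psubst_0 ev.psubst_add der_add DERIV_add)

definition diag_var :: "ix \<Rightarrow> (nat multiset \<Rightarrow>\<^sub>0 complex)" where
  "diag_var v = (if fst v = snd v then var (fst v) else 0)"

text \<open>Conjugating a diagonal matrix by the rotations in the \<open>(i, j)\<close>-plane joins it to the
  matrix with two diagonal entries swapped, and invariants are constant along this curve.\<close>

lemma subst_diag_symmetric:
  assumes "ad (i, j) p = 0" "ad (j, i) p = 0"
  shows "poly_subst (\<lambda>v. var (Transposition.transpose i j v)) (poly_subst diag_var p) = poly_subst diag_var p"
proof (cases "i = j")
  case True
  show ?thesis
    by (rule ev_eq_imp_eq) (simp add: True ev_subst ev.psubst_var)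
next
  case False
  show ?thesis
  proof (rule ev_eq_imp_eq)
    fix x :: "nat \<Rightarrow> complex"
    let ?a = "x i" and ?b = "x j"
    \<comment> \<open>The diagonal matrix with entries \<open>x\<close>, conjugated by the rotation
      through the angle \<open>t\<close> in the plane of the coordinates \<open>i\<close> and
      \<open>j\<close>.\<close>
    define X :: "complex \<Rightarrow> ix \<Rightarrow> complex" where "X = (\<lambda>t v.
      if v = (i, i) then ?a * (cos t)\<^sup>2 + ?b * (sin t)\<^sup>2
      else if v = (j, j) then ?a * (sin t)\<^sup>2 + ?b * (cos t)\<^sup>2
      else if v = (i, j) \<or> v = (j, i) then (?a - ?b) * (cos t * sin t)
      else if fst v = snd v then x (fst v) else 0)"
    \<comment> \<open>The commutator with the difference of the matrix units at
      \<open>(i, j)\<close> and \<open>(j, i)\<close>, the infinitesimal generator of these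
      rotations.\<close>
    let ?g = "\<lambda>v. (unit_mult (i, j) v - unit_mult v (i, j)) - (unit_mult (j, i) v - unit_mult v (j, i))"
    have der0: "der ?g p = 0"
      using assms by (simp add: der_minus_fun ad_def)
    have X: "((\<lambda>t. X t v) has_field_derivative ev (X t) (?g v)) (at t)" for t v
    proof -
      obtain k l where v: "v = (k, l)" by (cases v)
      have g: "ev (X t) (?g v) = (if j = k then X t (i, l) else 0) - (if l = i then X t (k, j) else 0)
          - (if i = k then X t (j, l) else 0) + (if l = j then X t (k, i) else 0)"
        by (simp add: v unit_mult_def ev.psubst_diff ev.psubst_var ev.psubst_0)
      consider "k = i" "l = i" | "k = j" "l = j" | "k = i" "l = j" | "k = j" "l = i"
        | "k = i" "l \<noteq> i" "l \<noteq> j" | "k = j" "l \<noteq> i" "l \<noteq> j" | "l = i" "k \<noteq> i" "k \<noteq> j" | "l = j" "k \<noteq> i" "k \<noteq> j"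
        | "k \<noteq> i" "k \<noteq> j" "l \<noteq> i" "l \<noteq> j" by blast
      then show ?thesis
        unfolding g unfolding v
        by cases (use False in \<open>auto simp: X_def power2_eq_square algebra_simps intro!: derivative_eq_intros\<close>)
    qed
    have "((\<lambda>t. ev (X t) p) has_field_derivative 0) (at t)" for t
      using has_field_derivative_ev[of X t ?g p, OF X] by (simp only: der0 ev.psubst_0)
    then have const: "\<exists>c. \<forall>t\<in>UNIV. ev (X t) p = c"
      by (intro has_field_derivative_zero_constant) auto
    \<comment> \<open>A quarter turn makes the cosine 0 and the sine 1: the matrix is diagonal
      again, with the two entries exchanged.\<close>
    have "ev (X (complex_of_real (pi / 2))) p = ev (X 0) p"
      using const by (metis UNIV_I)
    moreover have "X 0 = (\<lambda>v. ev x (diag_var v))"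
      using False by (auto simp: X_def diag_var_def ev.psubst_var ev.psubst_0)
    moreover have "X (complex_of_real (pi / 2)) = (\<lambda>v. ev (\<lambda>k. x (Transposition.transpose i j k)) (diag_var v))"
      using False
      by (auto simp: X_def diag_var_def ev.psubst_var ev.psubst_0 Transposition.transpose_def
          cos_of_real sin_of_real simp del: of_real_divide)
    ultimately show "ev x (poly_subst (\<lambda>v. var (Transposition.transpose i j v)) (poly_subst diag_var p)) = ev x (poly_subst diag_var p)"
      by (simp add: ev_subst ev.psubst_var)
  qed
qed

section \<open>The fundamental theorem on symmetric polynomials\<close>

definition elsym :: "'v set \<Rightarrow> nat \<Rightarrow> ('v multiset \<Rightarrow>\<^sub>0 complex)" where
  "elsym V k = (\<Sum>K | K \<subseteq> V \<and> card K = k. \<Prod>i\<in>K. var i)"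

text \<open>The index \<open>d\<close> is the degree: keeping it lets products be lifted to the enveloping algebra modulo
  terms of lower degree.\<close>

inductive elsym_gen :: "'v set \<Rightarrow> nat \<Rightarrow> ('v multiset \<Rightarrow>\<^sub>0 complex) \<Rightarrow> bool" for V where
  zero: "elsym_gen V d 0"
| cst: "elsym_gen V 0 (cst c)"
| elsym: "1 \<le> k \<Longrightarrow> k \<le> card V \<Longrightarrow> elsym_gen V k (elsym V k)"
| add: "elsym_gen V d p \<Longrightarrow> elsym_gen V d q \<Longrightarrow> elsym_gen V d (p + q)"
| mult: "elsym_gen V d p \<Longrightarrow> elsym_gen V e q \<Longrightarrow> elsym_gen V (d + e) (p * q)"

abbreviation rename :: "('v \<Rightarrow> 'v) \<Rightarrow> ('v multiset \<Rightarrow>\<^sub>0 complex) \<Rightarrow> ('v multiset \<Rightarrow>\<^sub>0 complex)" where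
  "rename f \<equiv> poly_subst (\<lambda>v. var (f v))"

definition symmetric_in :: "'v set \<Rightarrow> ('v multiset \<Rightarrow>\<^sub>0 complex) \<Rightarrow> bool" where
  "symmetric_in V p \<longleftrightarrow> (\<forall>i\<in>V. \<forall>j\<in>V. rename (Transposition.transpose i j) p = p)"

abbreviation homog :: "'v set \<Rightarrow> nat \<Rightarrow> ('v multiset \<Rightarrow>\<^sub>0 complex) \<Rightarrow> bool" where
  "homog V d p \<equiv> Poly_Mapping.keys p \<subseteq> {m. set_mset m \<subseteq> V \<and> size m = d}"

lemma prod_var_eq_mon: "finite K \<Longrightarrow> (\<Prod>i\<in>K. var i) = mon (mset_set K)"
  by (simp add: mon_conv_prod_var prod_unfold_prod_mset)

lemma elsym_card: "finite V \<Longrightarrow> elsym V (card V) = mon (mset_set V)"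
proof -
  assume fin: "finite V"
  have "{K. K \<subseteq> V \<and> card K = card V} = {V}"
    using fin by (auto dest: card_subset_eq)
  then show ?thesis
    by (simp add: elsym_def prod_var_eq_mon[OF fin])
qed

lemma homog_elsym: "finite V \<Longrightarrow> homog V k (elsym V k)"
  unfolding elsym_def
  by (rule keys_sum_subset) (auto simp: prod_var_eq_mon finite_subset)

lemma homog_elsym_gen:
  assumes "finite V" "elsym_gen V d p"
  shows "homog V d p"
  using assms(2)
proof induction
  case (cst c)
  then show ?case using keys_cst_subset[of c] by auto
next
  case (add d p q)
  then show ?case by (intro keys_add_subset)
next
  case (mult d p e q)
  then show ?case by (intro keys_mult_subset[OF mult.IH]) auto
qed (simp_all add: homog_elsym assms(1))

lemma symmetric_in_elsym_gen:
  assumes "finite V" "elsym_gen V d p"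
  shows "symmetric_in V p"
proof -
  have "rename (Transposition.transpose i j) p = p" if ij: "i \<in> V" "j \<in> V" for i j
    using assms(2)
  proof induction
    case (elsym k)
    let ?t = "Transposition.transpose i j"
    have t: "?t permutes V" using ij by (rule permutes_swap_id)
    have "rename ?t (elsym V k) = (\<Sum>K | K \<subseteq> V \<and> card K = k. \<Prod>a\<in>?t ` K. var a)"
      by (simp add: elsym_def poly_subst.psubst_sum poly_subst.psubst_prod poly_subst.psubst_var prod.reindex)
    also have "\<dots> = (\<Sum>K | K \<subseteq> V \<and> card K = k. \<Prod>a\<in>K. var a)"
    proof (rule sum.reindex_bij_witness[of _ "\<lambda>K. ?t ` K" "\<lambda>K. ?t ` K"])
      have *: "?t ` K \<in> {K. K \<subseteq> V \<and> card K = k}" if "K \<in> {K. K \<subseteq> V \<and> card K = k}" for K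
        using that permutes_image[OF t] by (auto simp: card_image)
      show "?t ` K \<in> {K. K \<subseteq> V \<and> card K = k}" if "K \<in> {K. K \<subseteq> V \<and> card K = k}" for K
        using that by (rule *)
      show "?t ` K \<in> {K. K \<subseteq> V \<and> card K = k}" if "K \<in> {K. K \<subseteq> V \<and> card K = k}" for K
        using that by (rule *)
    qed (simp_all add: image_image)
    finally show ?case by (simp add: elsym_def)
  qed (simp_all add: poly_subst.psubst_0 poly_subst.psubst_cst poly_subst.psubst_add poly_subst.psubst_mult)
  then show ?thesis by (simp add: symmetric_in_def)
qed

section \<open>Renaming variables and setting a variable to zero\<close>

lemma lookup_rename:
  assumes "inj f"
  shows "Poly_Mapping.lookup (rename f p) (image_mset f m) = Poly_Mapping.lookup p m"
proof (rule additive_cong_single[of "\<lambda>p. Poly_Mapping.lookup (rename f p) (image_mset f m)" "\<lambda>p. Poly_Mapping.lookup p m"])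
  fix l c
  have "(\<Prod>v\<in>#l. var (f v)) = mon (image_mset f l)"
    by (simp add: mon_conv_prod_var image_mset.compositionality o_def)
  moreover have "image_mset f l = image_mset f m \<longleftrightarrow> l = m"
    by (rule inj_eq[OF multiset.inj_map[OF assms]])
  ultimately show "Poly_Mapping.lookup (rename f (Poly_Mapping.single l c)) (image_mset f m) = Poly_Mapping.lookup (Poly_Mapping.single l c) m"
    by (simp add: poly_subst.psubst_single mon_def lookup_single when_def)
qed (intro additive_lookup poly_subst.additive_psubst additive_id)+

abbreviation drop_var :: "'v \<Rightarrow> ('v multiset \<Rightarrow>\<^sub>0 complex) \<Rightarrow> ('v multiset \<Rightarrow>\<^sub>0 complex)" where
  "drop_var v \<equiv> poly_subst (\<lambda>w. if w = v then 0 else var w)"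

lemma lookup_drop_var: "Poly_Mapping.lookup (drop_var v p) m = (if v \<in># m then 0 else Poly_Mapping.lookup p m)"
proof (rule additive_cong_single[of "\<lambda>p. Poly_Mapping.lookup (drop_var v p) m" "\<lambda>p. if v \<in># m then 0 else Poly_Mapping.lookup p m"])
  fix l c
  have "(\<Prod>w\<in>#l. if w = v then 0 else var w) = (if v \<in># l then 0 else mon l)"
    by (induction l) (auto simp: mon_add_mset)
  then show "Poly_Mapping.lookup (drop_var v (Poly_Mapping.single l c)) m = (if v \<in># m then 0 else Poly_Mapping.lookup (Poly_Mapping.single l c) m)"
    by (auto simp: poly_subst.psubst_single mon_def lookup_single when_def)
qed (auto intro!: additive_lookup poly_subst.additive_psubst simp: additive_def lookup_add poly_subst.psubst_add)

text \<open>Subsets containing \<open>v\<close> contribute 0 and the others are unchanged. On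
  diagonal restrictions this is the counterpart of sending a Capelli element to the one with the
  same index for \<open>n\<close> instead of \<open>n + 1\<close>.\<close>

lemma drop_var_elsym:
  assumes "finite V" "v \<notin> V"
  shows "drop_var v (elsym (insert v V) k) = elsym V k"
proof -
  have "drop_var v (elsym (insert v V) k) = (\<Sum>K | K \<subseteq> insert v V \<and> card K = k. \<Prod>w\<in>K. if w = v then 0 else var w)"
    by (simp add: elsym_def poly_subst.psubst_sum poly_subst.psubst_prod poly_subst.psubst_var)
  also have "\<dots> = (\<Sum>K | K \<subseteq> V \<and> card K = k. \<Prod>w\<in>K. if w = v then 0 else var w)"
  proof (rule sum.mono_neutral_right)
    show "finite {K. K \<subseteq> insert v V \<and> card K = k}" using assms by simp
    show "\<forall>K\<in>{K. K \<subseteq> insert v V \<and> card K = k} - {K. K \<subseteq> V \<and> card K = k}. (\<Prod>w\<in>K. if w = v then 0 else var w) = 0"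
    proof
      fix K assume K: "K \<in> {K. K \<subseteq> insert v V \<and> card K = k} - {K. K \<subseteq> V \<and> card K = k}"
      then have "v \<in> K" "finite K" using assms finite_subset[of K "insert v V"] by auto
      then show "(\<Prod>w\<in>K. if w = v then 0 else var w) = 0"
        by (intro prod_zero) auto
    qed
  qed auto
  also have "\<dots> = elsym V k"
    unfolding elsym_def using assms by (intro sum.cong prod.cong) auto
  finally show ?thesis .
qed

text \<open>In an expression through elementary symmetric polynomials every \<open>elsym V k\<close>
  is replaced by \<open>elsym (insert v V) k\<close>, which keeps the degree.\<close>

lemma elsym_gen_lift:
  assumes "finite V" "v \<notin> V" "elsym_gen V d p"
  shows "\<exists>q. elsym_gen (insert v V) d q \<and> drop_var v q = p"
  using assms(3)
proof induction
  case (zero d)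
  then show ?case by (intro exI[of _ 0]) (simp add: elsym_gen.zero poly_subst.psubst_0)
next
  case (cst c)
  then show ?case by (intro exI[of _ "cst c"]) (simp add: elsym_gen.cst poly_subst.psubst_cst)
next
  case (elsym k)
  then show ?case using assms
    by (intro exI[of _ "elsym (insert v V) k"]) (simp add: elsym_gen.elsym drop_var_elsym)
next
  case (add d p q)
  then obtain p' q' where "elsym_gen (insert v V) d p'" "drop_var v p' = p" "elsym_gen (insert v V) d q'" "drop_var v q' = q"
    by blast
  then show ?case by (intro exI[of _ "p' + q'"]) (simp add: elsym_gen.add poly_subst.psubst_add)
next
  case (mult d p e q)
  then obtain p' q' where "elsym_gen (insert v V) d p'" "drop_var v p' = p" "elsym_gen (insert v V) e q'" "drop_var v q' = q"
    by blast
  then show ?case by (intro exI[of _ "p' * q'"]) (simp add: elsym_gen.mult poly_subst.psubst_mult)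
qed

lemma rename_mon: "rename f (mon m) = mon (image_mset f m)"
  unfolding poly_subst.psubst_mon by (simp add: mon_conv_prod_var image_mset.compositionality o_def)

lemma mon_mult_cancel:
  fixes p q :: "'v multiset \<Rightarrow>\<^sub>0 complex"
  assumes "mon m * p = mon m * q"
  shows "p = q"
proof -
  have *: "Poly_Mapping.lookup (mon m * p) (m + l) = Poly_Mapping.lookup p l" for l p
  proof (rule additive_cong_single[of "\<lambda>p. Poly_Mapping.lookup (mon m * p) (m + l)" "\<lambda>p. Poly_Mapping.lookup p l"])
    show "Poly_Mapping.lookup (mon m * Poly_Mapping.single k c) (m + l) = Poly_Mapping.lookup (Poly_Mapping.single k c) l" for k c
      by (simp add: mon_def mult_single lookup_single when_def)
  qed (intro additive_intros)+
  show ?thesis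
    by (rule poly_mapping_eqI) (metis * assms)
qed

text \<open>Setting a variable to zero reduces to fewer variables; the difference to the lift is divisible by
  that variable, hence by symmetry by the product of all of them.\<close>

theorem fundamental_symmetric:
  assumes "finite V" "homog V d q" "symmetric_in V q"
  shows "elsym_gen V d q"
  using assms
proof (induction V arbitrary: d q rule: finite_induct)
  case empty
  then have keys: "Poly_Mapping.keys q \<subseteq> {m. m = {#} \<and> d = 0}" by auto
  show ?case
  proof (cases "d = 0")
    case True
    have "q = cst (Poly_Mapping.lookup q {#})"
      by (rule poly_mapping_eqI)
        (use keys in \<open>auto simp: cst_def lookup_single when_def in_keys_iff\<close>)
    then show ?thesis using True elsym_gen.cst by metis
  next
    case False
    then have "q = 0" using keys by auto
    then show ?thesis by (simp add: elsym_gen.zero)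
  qed
next
  case (insert v V)
  let ?W = "insert v V"
  have fin: "finite ?W" using insert by simp
  show ?case
    using insert.prems
  \<comment> \<open>Inside the induction on the number of variables, a second induction on the
    degree, with the variables \<open>?W\<close> fixed, disposes of the remainder.\<close>
  proof (induction d arbitrary: q rule: less_induct)
    case (less d)
    have "elsym_gen V d (drop_var v q)"
    proof (rule insert.IH)
      show "homog V d (drop_var v q)"
      proof
        fix m assume "m \<in> Poly_Mapping.keys (drop_var v q)"
        then have "v \<notin># m" "m \<in> Poly_Mapping.keys q"
          by (auto simp: in_keys_iff lookup_drop_var split: if_splits)
        then show "m \<in> {m. set_mset m \<subseteq> V \<and> size m = d}"
          using less.prems(1) by blast
      qed
      show "symmetric_in V (drop_var v q)"
        unfolding symmetric_in_def
      proof (intro ballI)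
        fix i j assume ij: "i \<in> V" "j \<in> V"
        let ?t = "Transposition.transpose i j"
        have v: "?t w = v \<longleftrightarrow> w = v" for w
          using ij insert.hyps(2) by (auto simp: Transposition.transpose_def)
        have "rename ?t (drop_var v q) = drop_var v (rename ?t q)"
          by (induction q rule: mpoly_induct)
            (simp_all add: poly_subst.psubst_cst poly_subst.psubst_add poly_subst.psubst_mult poly_subst.psubst_var poly_subst.psubst_0 v)
        also have "rename ?t q = q"
          using less.prems(2) ij by (simp add: symmetric_in_def)
        finally show "rename ?t (drop_var v q) = drop_var v q" .
      qed
    qed
    then obtain p where p: "elsym_gen ?W d p" "drop_var v p = drop_var v q"
      using elsym_gen_lift[OF insert.hyps(1,2)] by blast
    define r where "r = q - p"
    have r_sym: "rename (Transposition.transpose i j) r = r" if "i \<in> ?W" "j \<in> ?W" for i j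
    proof -
      have "rename (Transposition.transpose i j) q = q" "rename (Transposition.transpose i j) p = p"
        using less.prems(2) symmetric_in_elsym_gen[OF fin p(1)] that unfolding symmetric_in_def by blast+
      then show ?thesis by (simp add: r_def poly_subst.psubst_diff)
    qed
    have r_homog: "homog ?W d r"
      unfolding r_def by (intro keys_diff_subset less.prems(1) homog_elsym_gen[OF fin p(1)])
    have v_in: "v \<in># m" if "m \<in> Poly_Mapping.keys r" for m
    proof (rule ccontr)
      assume "v \<notin># m"
      then have "Poly_Mapping.lookup r m = Poly_Mapping.lookup (drop_var v r) m"
        by (simp add: lookup_drop_var)
      also have "drop_var v r = 0" by (simp add: r_def poly_subst.psubst_diff p(2))
      finally show False using that by (simp add: in_keys_iff)
    qed
    have all_in: "w \<in># m" if m: "m \<in> Poly_Mapping.keys r" and w: "w \<in> ?W" for m w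
    proof -
      let ?t = "Transposition.transpose v w"
      have "Poly_Mapping.lookup r (image_mset ?t m) = Poly_Mapping.lookup (rename ?t r) (image_mset ?t m)"
        using r_sym[of v w] w by simp
      also have "\<dots> = Poly_Mapping.lookup r m"
        by (rule lookup_rename) simp
      finally have "v \<in># image_mset ?t m"
        using m by (intro v_in) (simp add: in_keys_iff)
      then obtain u where u: "u \<in># m" "?t u = v" by auto
      have "u = ?t (?t u)" by simp
      then have "u = ?t v" by (simp only: u(2))
      then show ?thesis using u by simp
    qed
    have sub: "mset_set ?W \<subseteq># m" if "m \<in> Poly_Mapping.keys r" for m
    proof (rule mset_subset_eqI)
      fix w
      show "count (mset_set ?W) w \<le> count m w"
        using all_in[OF that, of w] fin
        by (simp add: count_mset_set' Suc_le_eq One_nat_def del: mset_set.insert)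
    qed
    \<comment> \<open>The quotient of \<open>r\<close> by the product of all variables in
      \<open>?W\<close>. It inherits the symmetry of \<open>r\<close>, and for nonzero
      \<open>r\<close> its degree is smaller by the positive number \<open>card ?W\<close>.\<close>
    define s where "s = lin_ext cst (\<lambda>m. mon (m - mset_set ?W)) r"
    have r_eq: "r = mon (mset_set ?W) * s"
    proof -
      have "mon (mset_set ?W) * s = (\<Sum>m\<in>Poly_Mapping.keys r. cst (Poly_Mapping.lookup r m) * mon (mset_set ?W + (m - mset_set ?W)))"
        unfolding s_def lin_ext_def sum_distrib_left by (simp add: mon_add mult.left_commute)
      also have "\<dots> = (\<Sum>m\<in>Poly_Mapping.keys r. cst (Poly_Mapping.lookup r m) * mon m)"
        using sub by (intro sum.cong refl) (simp del: mset_set.insert add: subset_mset.add_diff_inverse)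
      also have "\<dots> = r"
        by (rule poly_mapping_eqI)
          (auto simp: cst_mult_mon lookup_sum lookup_single when_def not_in_keys_iff_lookup_eq_zero)
      finally show ?thesis ..
    qed
    have size_W: "size (mset_set ?W) = card ?W" "set_mset (mset_set ?W) = ?W"
      using fin by (simp_all del: mset_set.insert)
    have s_homog: "homog ?W (d - card ?W) s"
      unfolding s_def
    proof (rule keys_lin_ext_subset)
      fix m assume m: "m \<in> Poly_Mapping.keys r"
      then have "size m = d" "set_mset m \<subseteq> ?W" using r_homog by auto
      then show "Poly_Mapping.keys (mon (m - mset_set ?W)) \<subseteq> {m. set_mset m \<subseteq> ?W \<and> size m = d - card ?W}"
        using sub[OF m] size_W by (auto simp: size_Diff_submset simp del: mset_set.insert dest: in_diffD)
    qed
    have "elsym_gen ?W d r"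
    proof (cases "r = 0")
      case False
      then obtain m where m: "m \<in> Poly_Mapping.keys r" by (metis ex_in_conv keys_eq_empty)
      then have le: "card ?W \<le> d"
        using size_mset_mono[OF sub[OF m]] r_homog size_W by auto
      have pos: "card ?W > 0" using fin card_gt_0_iff by blast
      have "elsym_gen ?W (d - card ?W) s"
      proof (rule less.IH)
        show "d - card ?W < d" using le pos by simp
        show "symmetric_in ?W s"
          unfolding symmetric_in_def
        proof (intro ballI)
          fix i j assume ij: "i \<in> ?W" "j \<in> ?W"
          let ?t = "Transposition.transpose i j"
          have "image_mset ?t (mset_set ?W) = mset_set ?W"
            using permutes_image_mset[OF permutes_swap_id[OF ij]] .
          then have "mon (mset_set ?W) * rename ?t s = rename ?t r"
            by (simp add: r_eq poly_subst.psubst_mult rename_mon del: mset_set.insert)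
          also have "\<dots> = mon (mset_set ?W) * s"
            using r_sym[OF ij] r_eq by simp
          finally show "rename ?t s = s" by (rule mon_mult_cancel)
        qed
      qed (rule s_homog)
      then have "elsym_gen ?W (card ?W + (d - card ?W)) (elsym ?W (card ?W) * s)"
        using pos by (intro elsym_gen.mult elsym_gen.elsym) auto
      then show ?thesis
        using le by (simp add: elsym_card[OF fin] r_eq[symmetric] del: mset_set.insert)
    qed (simp add: elsym_gen.zero)
    then have "elsym_gen ?W d (p + r)"
      using p(1) by (rule elsym_gen.add[rotated])
    then show ?case by (simp add: r_def)
  qed
qed

section \<open>Invariants are determined by their diagonal part\<close>

abbreviation diag_mset :: "nat multiset \<Rightarrow> ix multiset" where
  "diag_mset \<equiv> image_mset (\<lambda>k. (k, k))"

lemma prod_diag_var: "(\<Prod>v\<in>#l. diag_var v) = (if \<forall>v\<in>#l. fst v = snd v then mon (image_mset fst l) else 0)"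
  by (induction l) (auto simp: diag_var_def mon_add_mset)

lemma diag_mset_fst: "\<forall>v\<in>#l. fst v = snd v \<Longrightarrow> diag_mset (image_mset fst l) = l"
  by (induction l) (auto simp: prod_eq_iff)

text \<open>Restriction to diagonal matrices keeps exactly the monomials in the diagonal variables,
  with unchanged coefficients; it thereby becomes a statement about coefficients.\<close>

lemma lookup_subst_diag: "Poly_Mapping.lookup (poly_subst diag_var p) M = Poly_Mapping.lookup p (diag_mset M)"
proof (rule additive_cong_single[of "\<lambda>p. Poly_Mapping.lookup (poly_subst diag_var p) M" "\<lambda>p. Poly_Mapping.lookup p (diag_mset M)"])
  fix l c
  have "(\<forall>v\<in>#l. fst v = snd v) \<and> image_mset fst l = M \<longleftrightarrow> l = diag_mset M"
    using diag_mset_fst[of l] by (auto simp: image_mset.compositionality o_def)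
  then show "Poly_Mapping.lookup (poly_subst diag_var (Poly_Mapping.single l c)) M = Poly_Mapping.lookup (Poly_Mapping.single l c) (diag_mset M)"
    unfolding poly_subst.psubst_single prod_diag_var lookup_cst_mult
    by (auto simp: mon_def lookup_single when_def)
qed (intro additive_lookup poly_subst.additive_psubst additive_id)+

text \<open>The degree in the off-diagonal variables, on which the vanishing of coefficients is
  proved by induction.\<close>

definition offdiag :: "ix multiset \<Rightarrow> nat" where
  "offdiag m = size {#v \<in># m. fst v \<noteq> snd v#}"

lemma offdiag_add_mset [simp]: "offdiag (add_mset v m) = (if fst v = snd v then 0 else 1) + offdiag m"
  by (simp add: offdiag_def)

lemma lookup_ad:
  "Poly_Mapping.lookup (ad a p) m0
    = (\<Sum>m\<in>Poly_Mapping.keys p. Poly_Mapping.lookup p m *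
        (\<Sum>v\<in>#m. Poly_Mapping.lookup ((unit_mult a v - unit_mult v a) * mon (m - {#v#})) m0))"
proof -
  have sum_mset: "Poly_Mapping.lookup (\<Sum>v\<in>#m. f v) m0 = (\<Sum>v\<in>#m. Poly_Mapping.lookup (f v) m0)"
    for f :: "ix \<Rightarrow> gpoly" and m
    by (induction m) (simp_all add: lookup_add)
  show ?thesis
    by (simp add: ad_def der_def lin_ext_def lookup_sum sum_mset)
qed

lemma sum_mset_of_bool: "(\<Sum>v\<in>#m. if P v then 1 else 0 :: complex) = of_nat (size (filter_mset P m))"
  by (induction m) auto

text \<open>Compare coefficients in \<open>ad (i, j) q = 0\<close>: only the two terms of \<open>ad (i, j)\<close> that turn the
  off-diagonal variable \<open>(j, i)\<close> into a diagonal one lower the off-diagonal degree.\<close>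

lemma invariant_leading_eq_0_step:
  assumes ad: "ad (i, j) q = 0" and ij: "i \<noteq> j"
    and low: "\<And>m. size m = d \<Longrightarrow> offdiag m \<le> r \<Longrightarrow> Poly_Mapping.lookup q m = 0"
    and "Suc (size m') = d" "offdiag m' = r"
  shows "Poly_Mapping.lookup q (add_mset (j, i) m') = 0"
  using assms(4,5)
proof (induction "count m' (j, j)" arbitrary: m' rule: less_induct)
  case less
  \<comment> \<open>The coefficient of \<open>m0\<close> in \<open>ad (i, j) q\<close> is examined.
    The wanted monomial \<open>m1\<close> contributes to it by turning a variable
    \<open>(j, i)\<close> into \<open>(i, i)\<close>.\<close>
  define m0 where "m0 = add_mset (i, i) m'"
  define m1 where "m1 = add_mset (j, i) m'"
  let ?t = "\<lambda>m v. Poly_Mapping.lookup ((unit_mult (i, j) v - unit_mult v (i, j)) * mon (m - {#v#})) m0"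
  have t: "?t m (k, l) = (if j = k \<and> add_mset (i, l) (m - {#(k, l)#}) = m0 then 1 else 0)
      - (if l = i \<and> add_mset (k, j) (m - {#(k, l)#}) = m0 then 1 else 0)" for m k l
    by (simp add: unit_mult_def left_diff_distrib mon_add_mset[symmetric])
      (auto simp: mon_def lookup_single lookup_minus when_def)
  have zero: "Poly_Mapping.lookup q m * (\<Sum>v\<in>#m. ?t m v) = 0" if "m \<noteq> m1" for m
  proof (rule ccontr)
    assume "Poly_Mapping.lookup q m * (\<Sum>v\<in>#m. ?t m v) \<noteq> 0"
    then have qm: "Poly_Mapping.lookup q m \<noteq> 0" and "(\<Sum>v\<in>#m. ?t m v) \<noteq> 0" by auto
    then obtain v where "v \<in># m" "?t m v \<noteq> 0"
      by (metis (no_types, lifting) image_mset_cong sum_mset.neutral_const)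
    then obtain k l X where X: "m = add_mset (k, l) X" and tv: "?t m (k, l) \<noteq> 0"
      by (metis insert_DiffM prod.exhaust)
    then consider "k = j" "add_mset (i, l) X = m0" | "l = i" "add_mset (k, j) X = m0"
      unfolding t by (auto split: if_splits)
    then show False
    proof cases
      case 1
      show False
      proof (cases "l = i")
        case True
        then show False using 1 X that by (simp add: m0_def m1_def)
      next
        \<comment> \<open>The variable \<open>(i, l)\<close> occurs in \<open>m0\<close> and is
          off-diagonal, so \<open>m\<close> has at most \<open>r\<close> off-diagonal factors and
          \<open>low\<close> applies.\<close>
        case False
        have "Suc (size X) = size m0" "Suc (offdiag X) = offdiag m0"
          using 1(2)[symmetric] False by auto
        then show False
          using low[of m] qm less.prems X by (auto simp: m0_def split: if_splits)
      qed
    next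
      case 2
      have size: "Suc (size X) = size m0" using 2(2)[symmetric] by auto
      show False
      \<comment> \<open>Here \<open>(j, i)\<close> has become \<open>(j, j)\<close>, a factor
        already present in \<open>m'\<close>. The other factors of \<open>m\<close> therefore
        contain \<open>(j, j)\<close> once less than \<open>m'\<close> does, which is the reason for
        the induction on this multiplicity.\<close>
      proof (cases "k = j")
        case True
        have "count (add_mset (j, j) X) (j, j) = count m0 (j, j)" "offdiag X = offdiag m0"
          using 2(2)[symmetric] True by auto
        then have "count X (j, j) < count m' (j, j)" "offdiag X = r"
          using ij less.prems by (auto simp: m0_def)
        then have "Poly_Mapping.lookup q (add_mset (j, i) X) = 0"
          using size less.prems by (intro less.hyps) (simp_all add: m0_def)
        then show False using qm X 2 True by simp
      next
        case False
        have "Suc (offdiag X) = offdiag m0"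
          using 2(2)[symmetric] False by auto
        then show False
          using low[of m] qm less.prems X size by (auto simp: m0_def split: if_splits)
      qed
    qed
  qed
  \<comment> \<open>Terms of negative sign do not occur for \<open>m1\<close>: one would require
    \<open>(i, i)\<close> and \<open>(k, i)\<close> to be, as a multiset, \<open>(j, i)\<close> and
    \<open>(k, j)\<close>, but \<open>(i, i)\<close> is not among the latter. The factor of the
    coefficient of \<open>m1\<close> is thus a positive count.\<close>
  have t1: "?t m1 v = (if fst v = j \<and> add_mset (i, snd v) (m1 - {#v#}) = m0 then 1 else 0)" if "v \<in># m1" for v
  proof -
    obtain k l X where v: "v = (k, l)" and X: "m1 = add_mset (k, l) X"
      using \<open>v \<in># m1\<close> by (metis insert_DiffM prod.exhaust)
    have "add_mset (k, j) X \<noteq> m0" if "l = i"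
    proof
      assume eq: "add_mset (k, j) X = m0"
      have "add_mset (i, i) m1 = add_mset (j, i) m0"
        by (simp add: m0_def m1_def)
      then have *: "add_mset (i, i) (add_mset (k, i) X) = add_mset (j, i) (add_mset (k, j) X)"
        using X eq that by simp
      have "count (add_mset (i, i) (add_mset (k, i) X)) (j, i) = count (add_mset (j, i) (add_mset (k, j) X)) (j, i)"
        "count (add_mset (i, i) (add_mset (k, i) X)) (i, i) = count (add_mset (j, i) (add_mset (k, j) X)) (i, i)"
        by (simp_all only: *)
      then show False using ij by (auto split: if_splits)
    qed
    then show ?thesis unfolding v t using X by auto
  qed
  have "(\<Sum>v\<in>#m1. ?t m1 v) = (\<Sum>v\<in>#m1. if fst v = j \<and> add_mset (i, snd v) (m1 - {#v#}) = m0 then 1 else 0)"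
    by (rule arg_cong[where f = sum_mset], rule image_mset_cong) (rule t1)
  also have "\<dots> \<noteq> 0"
  proof -
    have "(j, i) \<in># filter_mset (\<lambda>v. fst v = j \<and> add_mset (i, snd v) (m1 - {#v#}) = m0) m1"
      by (simp add: m0_def m1_def)
    then have "filter_mset (\<lambda>v. fst v = j \<and> add_mset (i, snd v) (m1 - {#v#}) = m0) m1 \<noteq> {#}"
      by (metis empty_not_add_mset multi_member_split)
    then show ?thesis
      unfolding sum_mset_of_bool by simp
  qed
  finally have nz: "(\<Sum>v\<in>#m1. ?t m1 v) \<noteq> 0" .
  have "(\<Sum>m\<in>Poly_Mapping.keys q. Poly_Mapping.lookup q m * (\<Sum>v\<in>#m. ?t m v)) = 0"
    using ad lookup_ad[of "(i, j)" q m0] by simp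
  moreover have "(\<Sum>m\<in>Poly_Mapping.keys q. Poly_Mapping.lookup q m * (\<Sum>v\<in>#m. ?t m v))
     = (\<Sum>m\<in>Poly_Mapping.keys q. if m = m1 then Poly_Mapping.lookup q m * (\<Sum>v\<in>#m. ?t m v) else 0)"
    using zero by (intro sum.cong) auto
  ultimately have "Poly_Mapping.lookup q m1 * (\<Sum>v\<in>#m1. ?t m1 v) = 0"
    by (cases "m1 \<in> Poly_Mapping.keys q") (auto simp: in_keys_iff)
  then show ?case using nz by (simp add: m1_def)
qed

text \<open>Induction on the number of off-diagonal factors, starting from the diagonal monomials.
  The hypothesis on the diagonal and the conclusion concern the single degree \<open>d\<close>, so
  the lemma applies to the top degree of an inhomogeneous symbol.\<close>

lemma invariant_leading_eq_0:
  assumes ad: "\<And>a. a \<in> {1..n} \<times> {1..n} \<Longrightarrow> ad a q = 0"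
    and vars: "\<And>m. m \<in> Poly_Mapping.keys q \<Longrightarrow> set_mset m \<subseteq> {1..n} \<times> {1..n}"
    and diag: "\<And>M. size M = d \<Longrightarrow> Poly_Mapping.lookup q (diag_mset M) = 0"
    and "size m = d"
  shows "Poly_Mapping.lookup q m = 0"
  using assms(4)
proof (induction "offdiag m" arbitrary: m rule: less_induct)
  case less
  show ?case
  proof (cases "\<exists>v\<in>#m. fst v \<noteq> snd v")
    case False
    then have "m = diag_mset (image_mset fst m)"
      using diag_mset_fst[of m] by auto
    then show ?thesis using diag less.prems by (metis size_image_mset)
  next
    case True
    then obtain j i where v: "(j, i) \<in># m" "i \<noteq> j" by auto
    then obtain m' where m: "m = add_mset (j, i) m'" by (metis insert_DiffM)
    show ?thesis
    proof (cases "m \<in> Poly_Mapping.keys q")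
      case True
      then have "(i, j) \<in> {1..n} \<times> {1..n}" using vars v by fastforce
      then have adz: "ad (i, j) q = 0" by (rule ad)
      have "Poly_Mapping.lookup q (add_mset (j, i) m') = 0"
      proof (rule invariant_leading_eq_0_step[OF adz v(2), of d "offdiag m'"])
        show "Poly_Mapping.lookup q l = 0" if "size l = d" "offdiag l \<le> offdiag m'" for l
          using that v(2) m by (intro less.hyps) auto
      qed (use m less.prems in auto)
      then show ?thesis by (simp add: m)
    qed (simp add: in_keys_iff)
  qed
qed

text \<open>Any permutation other than the identity selects an off-diagonal entry, because
  \<open>i\<close> is injective.\<close>

lemma subst_diag_mdet:
  assumes "inj_on i {1..k}"
  shows "poly_subst diag_var (mdet k i) = (\<Prod>b\<in>{1..k}. var (i b))"
proof -
  have "poly_subst diag_var (mdet k i) = (\<Sum>p | p permutes {1..k}. of_int (sign p) * (\<Prod>b\<in>{1..k}. diag_var (i (p b), i b)))"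
    using poly_subst.psubst_cst_mult[of diag_var "of_int _"]
    by (simp add: mdet_def poly_subst.psubst_sum poly_subst.psubst_prod poly_subst.psubst_var del: One_nat_def)
  also have "\<dots> = (\<Sum>p | p permutes {1..k}. if p = id then \<Prod>b\<in>{1..k}. var (i b) else 0)"
  proof (rule sum.cong[OF refl])
    fix p assume "p \<in> {p. p permutes {1..k}}"
    then have p: "p permutes {1..k}" by simp
    show "of_int (sign p) * (\<Prod>b\<in>{1..k}. diag_var (i (p b), i b)) = (if p = id then \<Prod>b\<in>{1..k}. var (i b) else 0)"
    proof (cases "p = id")
      case False
      then obtain b where b: "p b \<noteq> b" by (auto simp: fun_eq_iff)
      then have "b \<in> {1..k}" using p by (metis permutes_def)
      moreover have "i (p b) \<noteq> i b"
        using b assms \<open>b \<in> {1..k}\<close> permutes_in_image[OF p, of b] by (auto dest: inj_onD)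
      ultimately have "(\<Prod>b\<in>{1..k}. diag_var (i (p b), i b)) = 0"
        by (intro prod_zero) (auto simp: diag_var_def)
      then show ?thesis using False by simp
    qed (simp add: diag_var_def)
  qed
  also have "\<dots> = (\<Prod>b\<in>{1..k}. var (i b))"
    by (simp add: sum.delta[of "{p. p permutes {1..k}}"] finite_permutations permutes_id)
  finally show ?thesis .
qed

text \<open>On diagonal matrices a principal minor is the product of the selected entries, and the
  images of increasing tuples run once through the subsets of size \<open>k\<close>.\<close>

lemma subst_diag_esym: "poly_subst diag_var (esym n k) = elsym {1..n} k"
proof -
  have "poly_subst diag_var (esym n k) = (\<Sum>i\<in>strict_tuples n k. \<Prod>b\<in>{1..k}. var (i b))"
    by (simp add: esym_def poly_subst.psubst_sum subst_diag_mdet strict_tuples_inj)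
  also have "\<dots> = (\<Sum>i\<in>strict_tuples n k. \<Prod>v\<in>i ` {1..k}. var v)"
    by (rule sum.cong[OF refl]) (simp add: prod.reindex[OF strict_tuples_inj])
  also have "\<dots> = elsym {1..n} k"
    unfolding elsym_def
  proof (rule sum.reindex_bij_betw)
    show "bij_betw (\<lambda>i. i ` {1..k}) (strict_tuples n k) {K. K \<subseteq> {1..n} \<and> card K = k}"
    proof (rule bij_betwI')
      show "(i ` {1..k} = j ` {1..k}) = (i = j)" if "i \<in> strict_tuples n k" "j \<in> strict_tuples n k" for i j
        using strict_tuples_eq[OF that] by blast
      show "i ` {1..k} \<in> {K. K \<subseteq> {1..n} \<and> card K = k}" if "i \<in> strict_tuples n k" for i
        using that card_image[OF strict_tuples_inj[OF that]] by (auto simp: strict_tuples_def)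
      show "\<exists>i\<in>strict_tuples n k. K = i ` {1..k}" if "K \<in> {K. K \<subseteq> {1..n} \<and> card K = k}" for K
        using ex_strict_tuple[of K n k] that by auto
    qed
  qed
  finally show ?thesis .
qed

lemma homog_mdet: "i \<in> {1..k} \<rightarrow> {1..n} \<Longrightarrow> homog ({1..n} \<times> {1..n}) k (mdet k i)"
proof -
  assume i: "i \<in> {1..k} \<rightarrow> {1..n}"
  have *: "homog V (card B) (\<Prod>b\<in>B. var (f b))" if "finite B" "f ` B \<subseteq> V" for B :: "nat set" and f :: "nat \<Rightarrow> ix" and V
    using that
  proof (induction B rule: finite_induct)
    case empty
    then show ?case using keys_cst_subset[of 1] by auto
  next
    case (insert b B)
    then show ?case by simp (rule keys_mult_subset[of _ "{{#f b#}}"], auto)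
  qed
  show ?thesis
    unfolding mdet_def
  proof (rule keys_sum_subset)
    fix p assume "p \<in> {p. p permutes {1..k}}"
    then have p: "p permutes {1..k}" by simp
    have "homog ({1..n} \<times> {1..n}) (card {1..k}) (\<Prod>b\<in>{1..k}. var (i (p b), i b))"
      using i permutes_in_image[OF p] by (intro *) (auto simp: Pi_iff)
    then show "homog ({1..n} \<times> {1..n}) k (of_int (sign p) * (\<Prod>b\<in>{1..k}. var (i (p b), i b)))"
      using keys_cst_mult_subset[of "\<Prod>b\<in>{1..k}. var (i (p b), i b)" _ "of_int (sign p)"] by simp
  qed
qed

lemma homog_esym: "homog ({1..n} \<times> {1..n}) k (esym n k)"
  unfolding esym_def by (intro keys_sum_subset homog_mdet) (auto simp: strict_tuples_def)

section \<open>The center of the enveloping algebra\<close>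

lemmas keys_words [simp] = free_set_add[simplified] free_set_diff[simplified] free_set_mult[simplified]
  free_set_cst[simplified] free_set_0[simplified] free_set_1[simplified]

lemma keys_words_of_nat [simp]: "Poly_Mapping.keys (of_nat k :: free_elt) \<subseteq> words n"
  using free_set_cst[of "of_nat k" n] by simp

lemma keys_words_of_int [simp]: "Poly_Mapping.keys (of_int k :: free_elt) \<subseteq> words n"
  using free_set_cst[of "of_int k" n] by simp

section \<open>Cosets and their symbols\<close>

definition Ugl_class :: "nat \<Rightarrow> free_elt \<Rightarrow> free_elt set" where
  "Ugl_class n x = gl_ideal n +>\<^bsub>free_alg n\<^esub> x"

lemma ring_Ugl: "ring (Ugl n)"
  unfolding Ugl_def by (rule ideal.quotient_is_ring[OF ideal_gl_ideal])

interpretation U: ring "Ugl n" for n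
  by (rule ring_Ugl)

lemma carrier_Ugl: "carrier (Ugl n) = Ugl_class n ` free_set n"
  by (auto simp: Ugl_def FactRing_def A_RCOSETS_def' Ugl_class_def)

lemma Ugl_class_carrier [simp]: "x \<in> free_set n \<Longrightarrow> Ugl_class n x \<in> carrier (Ugl n)"
  by (auto simp: carrier_Ugl)

lemma Ugl_class_hom: "Ugl_class n \<in> ring_hom (free_alg n) (Ugl n)"
  unfolding Ugl_class_def[abs_def] Ugl_def by (rule ideal.rcos_ring_hom[OF ideal_gl_ideal])

lemma Ugl_class_mult: "x \<in> free_set n \<Longrightarrow> y \<in> free_set n \<Longrightarrow> Ugl_class n x \<otimes>\<^bsub>Ugl n\<^esub> Ugl_class n y = Ugl_class n (x * y)"
  using ring_hom_mult[OF Ugl_class_hom] by simp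

lemma Ugl_class_add: "x \<in> free_set n \<Longrightarrow> y \<in> free_set n \<Longrightarrow> Ugl_class n x \<oplus>\<^bsub>Ugl n\<^esub> Ugl_class n y = Ugl_class n (x + y)"
  using ring_hom_add[OF Ugl_class_hom] by simp

lemma Ugl_class_one: "\<one>\<^bsub>Ugl n\<^esub> = Ugl_class n 1"
  using ring_hom_one[OF Ugl_class_hom] by simp

lemma Ugl_class_zero: "\<zero>\<^bsub>Ugl n\<^esub> = Ugl_class n 0"
  using ring_hom_zero[OF Ugl_class_hom ring_free_alg ring_Ugl] by simp

lemma Ugl_class_uminus:
  assumes "x \<in> free_set n"
  shows "\<ominus>\<^bsub>Ugl n\<^esub> Ugl_class n x = Ugl_class n (- x)"
  by (rule U.minus_equality) (use assms in \<open>simp_all add: Ugl_class_add Ugl_class_zero\<close>)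

text \<open>Poincare-Birkhoff-Witt in the form used from here on: equality in the enveloping algebra
  is equality of commutative polynomials, with no reference to the ideal or to
  \<open>n\<close>.\<close>

lemma Ugl_class_eq_iff:
  assumes "x \<in> free_set n" "y \<in> free_set n"
  shows "Ugl_class n x = Ugl_class n y \<longleftrightarrow> symbol x = symbol y"
proof -
  have "Ugl_class n x = Ugl_class n y \<longleftrightarrow> x - y \<in> gl_ideal n"
    using free.quotient_eq_iff_same_a_r_cos[OF ideal_gl_ideal, of x n y] assms
    by (simp add: Ugl_class_def free_alg_minus)
  also have "\<dots> \<longleftrightarrow> symbol (x - y) = 0"
    using assms symbol_eq_0_imp_gl_ideal[of "x - y" n] gl_ideal_symbol[of "x - y" n] by auto
  finally show ?thesis by (simp add: symbol_diff)
qed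

lemma in_class_symbol: "y \<in> Ugl_class n x \<Longrightarrow> symbol y = symbol x"
  by (auto simp: Ugl_class_def a_r_coset_def' symbol_add gl_ideal_symbol)

lemma in_class_free_set:
  assumes "y \<in> Ugl_class n x" "x \<in> free_set n"
  shows "y \<in> free_set n"
proof -
  obtain i where "i \<in> gl_ideal n" "y = i + x"
    using assms(1) by (auto simp: Ugl_class_def a_r_coset_def')
  then show ?thesis
    using free_set_add[OF subsetD[OF gl_ideal_subset]] assms(2) by blast
qed

lemma Ugl_class_self: "x \<in> Ugl_class n x"
  using gl_ideal_0[of n] by (auto simp: Ugl_class_def a_r_coset_def' intro!: bexI[of _ 0])

lemma Ugl_scalar_eq: "Ugl_scalar n c = Ugl_class n (cst c)"
  by (simp add: Ugl_scalar_def Ugl_class_def cst_def)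

lemma Ugl_gen_eq: "Ugl_gen n i j = Ugl_class n (letter i j)"
  by (simp add: Ugl_gen_def Ugl_class_def)

lemma Ugl_class_finsum:
  assumes "finite S" "\<And>s. s \<in> S \<Longrightarrow> f s \<in> free_set n"
  shows "(\<Oplus>\<^bsub>Ugl n\<^esub>s\<in>S. Ugl_class n (f s)) = Ugl_class n (\<Sum>s\<in>S. f s) \<and> (\<Sum>s\<in>S. f s) \<in> free_set n"
  using assms
proof (induction S rule: finite_induct)
  case (insert s S)
  have "(\<Oplus>\<^bsub>Ugl n\<^esub>s\<in>insert s S. Ugl_class n (f s)) = Ugl_class n (f s) \<oplus>\<^bsub>Ugl n\<^esub> (\<Oplus>\<^bsub>Ugl n\<^esub>s\<in>S. Ugl_class n (f s))"
    using insert by (intro U.finsum_insert) auto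
  then show ?case
    using insert by (simp add: Ugl_class_add)
qed (simp add: Ugl_class_zero)

lemma Ugl_class_nat: "[k] \<cdot>\<^bsub>Ugl n\<^esub> \<one>\<^bsub>Ugl n\<^esub> = Ugl_class n (of_nat k)" for k :: nat
proof (induction k)
  case (Suc k)
  then show ?case
    by (simp add: U.add.nat_pow_Suc Ugl_class_one Ugl_class_add add.commute)
qed (simp add: U.add.nat_pow_0 Ugl_class_zero)

lemma Ugl_class_sign:
  assumes "x \<in> free_set n"
  shows "[sign p] \<cdot>\<^bsub>Ugl n\<^esub> Ugl_class n x = Ugl_class n (of_int (sign p) * x)"
proof -
  have "[(1::nat)] \<cdot>\<^bsub>Ugl n\<^esub> Ugl_class n x = Ugl_class n x"
    using assms by (simp add: One_nat_def U.add.nat_pow_Suc U.add.nat_pow_0)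
  then show ?thesis
    using assms by (auto simp: sign_def add_pow_int_ge add_pow_int_lt Ugl_class_uminus)
qed

text \<open>Multiplying by a matrix unit on the left or right acts on symbols by
  \<open>left_op\<close> or \<open>right_op\<close>, and \<open>ad\<close> is their difference.
  Commuting with the matrix units extends to words letter by letter and then to all elements by
  linearity.\<close>

lemma center_iff_ad:
  assumes x: "x \<in> free_set n"
  shows "Ugl_class n x \<in> zeta n \<longleftrightarrow> (\<forall>a\<in>{1..n} \<times> {1..n}. ad a (symbol x) = 0)"
proof -
  have "Ugl_class n x \<in> zeta n \<longleftrightarrow> (\<forall>y\<in>free_set n. symbol (x * y) = symbol (y * x))"
    using x by (auto simp: center_def centralizer_def carrier_Ugl Ugl_class_mult Ugl_class_eq_iff)
  also have "\<dots> \<longleftrightarrow> (\<forall>a\<in>{1..n} \<times> {1..n}. ad a (symbol x) = 0)"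
  proof
    assume *: "\<forall>y\<in>free_set n. symbol (x * y) = symbol (y * x)"
    show "\<forall>a\<in>{1..n} \<times> {1..n}. ad a (symbol x) = 0"
    proof
      fix a assume "a \<in> {1..n} \<times> {1..n}"
      then have "mon [a] \<in> free_set n" by (auto simp: words_def)
      then have "symbol (x * mon [a]) = symbol (mon [a] * x)" using * by blast
      then show "ad a (symbol x) = 0"
        by (simp add: ad_eq symbol_letter_mult symbol_mult_letter)
    qed
  next
    assume ad: "\<forall>a\<in>{1..n} \<times> {1..n}. ad a (symbol x) = 0"
    have word: "symbol (x * mon w) = symbol (mon w * x)" if "w \<in> words n" for w
      using that
    proof (induction w)
      case (Cons a w)
      then have "left_op a (symbol x) = right_op a (symbol x)"
        using ad by (auto simp: ad_eq words_def)
      then have "symbol (x * mon [a]) = symbol (mon [a] * x)"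
        by (simp add: symbol_letter_mult symbol_mult_letter)
      then have "symbol (x * mon [a] * mon w) = symbol (mon [a] * x * mon w)"
        by (rule symbol_mult_cong) simp
      also have "\<dots> = left_op a (symbol (mon w * x))"
        using Cons by (simp add: mult.assoc symbol_letter_mult words_def)
      finally show ?case
        by (simp add: mon_Cons[of a w] mult.assoc symbol_letter_mult)
    qed (simp add: mon_Nil)
    show "\<forall>y\<in>free_set n. symbol (x * y) = symbol (y * x)"
    proof
      fix y assume y: "y \<in> free_set n"
      show "symbol (x * y) = symbol (y * x)"
      proof (rule additive_cong_single[of "\<lambda>y. symbol (x * y)" "\<lambda>y. symbol (y * x)"])
        fix w c assume "w \<in> Poly_Mapping.keys y"
        then have "symbol (x * mon w) = symbol (mon w * x)" using y by (intro word) auto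
        then have "symbol (cst c) * symbol (x * mon w) = symbol (cst c) * symbol (mon w * x)" by simp
        then have "symbol (cst c * (x * mon w)) = symbol (cst c * (mon w * x))"
          by (simp add: symbol_cst_mult)
        moreover have "cst c * (x * mon w) = x * Poly_Mapping.single w c"
          by (simp only: cst_mult_mon[symmetric] mult.assoc[symmetric] cst_mult_commute[of c x])
        moreover have "cst c * (mon w * x) = Poly_Mapping.single w c * x"
          by (simp only: cst_mult_mon[symmetric] mult.assoc)
        ultimately show "symbol (x * Poly_Mapping.single w c) = symbol (Poly_Mapping.single w c * x)"
          by simp
      qed (intro additive_compose[OF additive_symbol] additive_intros)+
    qed
  qed
  finally show ?thesis .
qed

section \<open>The center as a subalgebra containing the Capelli elements\<close>

lemma zeta_carrier: "X \<in> zeta n \<Longrightarrow> X \<in> carrier (Ugl n)"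
  by (simp add: center_def centralizer_def)

lemma zeta_cases:
  assumes "X \<in> zeta n"
  obtains x where "x \<in> free_set n" "X = Ugl_class n x" "\<And>a. a \<in> {1..n} \<times> {1..n} \<Longrightarrow> ad a (symbol x) = 0"
  using zeta_carrier[OF assms] assms center_iff_ad by (auto simp: carrier_Ugl)

lemma zeta_commute: "X \<in> zeta n \<Longrightarrow> Y \<in> carrier (Ugl n) \<Longrightarrow> X \<otimes>\<^bsub>Ugl n\<^esub> Y = Y \<otimes>\<^bsub>Ugl n\<^esub> X"
  by (simp add: center_def centralizer_def)

lemma zeta_add: "X \<in> zeta n \<Longrightarrow> Y \<in> zeta n \<Longrightarrow> X \<oplus>\<^bsub>Ugl n\<^esub> Y \<in> zeta n"
  by (simp add: center_def centralizer_def U.l_distr U.r_distr)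

lemma zeta_mult: "X \<in> zeta n \<Longrightarrow> Y \<in> zeta n \<Longrightarrow> X \<otimes>\<^bsub>Ugl n\<^esub> Y \<in> zeta n"
proof -
  assume X: "X \<in> zeta n" and Y: "Y \<in> zeta n"
  note car = zeta_carrier[OF X] zeta_carrier[OF Y]
  have "X \<otimes>\<^bsub>Ugl n\<^esub> Y \<otimes>\<^bsub>Ugl n\<^esub> Z = Z \<otimes>\<^bsub>Ugl n\<^esub> (X \<otimes>\<^bsub>Ugl n\<^esub> Y)" if Z: "Z \<in> carrier (Ugl n)" for Z
  proof -
    have "X \<otimes>\<^bsub>Ugl n\<^esub> Y \<otimes>\<^bsub>Ugl n\<^esub> Z = X \<otimes>\<^bsub>Ugl n\<^esub> (Y \<otimes>\<^bsub>Ugl n\<^esub> Z)"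
      by (rule U.m_assoc[OF car Z])
    also have "\<dots> = X \<otimes>\<^bsub>Ugl n\<^esub> (Z \<otimes>\<^bsub>Ugl n\<^esub> Y)"
      by (simp only: zeta_commute[OF Y Z])
    also have "\<dots> = X \<otimes>\<^bsub>Ugl n\<^esub> Z \<otimes>\<^bsub>Ugl n\<^esub> Y"
      by (rule U.m_assoc[OF car(1) Z car(2), symmetric])
    also have "\<dots> = Z \<otimes>\<^bsub>Ugl n\<^esub> X \<otimes>\<^bsub>Ugl n\<^esub> Y"
      by (simp only: zeta_commute[OF X Z])
    also have "\<dots> = Z \<otimes>\<^bsub>Ugl n\<^esub> (X \<otimes>\<^bsub>Ugl n\<^esub> Y)"
      by (rule U.m_assoc[OF Z car])
    finally show ?thesis .
  qed
  then show ?thesis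
    using car by (simp add: center_def centralizer_def)
qed

lemma zeta_scalar: "Ugl_scalar n c \<in> zeta n"
  by (simp add: Ugl_scalar_eq center_iff_ad ad_def)

definition free_H :: "nat \<Rightarrow> nat \<Rightarrow> free_elt" where
  "free_H n k = (\<Sum>i\<in>strict_tuples n k. free_cdet k i)"

text \<open>Moves the column determinant from cosets to a representative in the free algebra, on
  which \<open>symbol\<close> is defined. Membership in \<open>free_set n\<close> is carried along
  because the coset map is known to be multiplicative and additive only there.\<close>

lemma cdet_Ugl:
  assumes i: "i \<in> {1..k} \<rightarrow> {1..n}"
  shows "cdet (Ugl n) k (\<lambda>a b. Ugl_gen n (i a) (i b)
          \<oplus>\<^bsub>Ugl n\<^esub> (if a = b then [(k - a)] \<cdot>\<^bsub>Ugl n\<^esub> \<one>\<^bsub>Ugl n\<^esub> else \<zero>\<^bsub>Ugl n\<^esub>)) = Ugl_class n (free_cdet k i)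
      \<and> free_cdet k i \<in> free_set n"
proof -
  let ?e = "\<lambda>p b. letter (i (p b)) (i b) + of_nat (if p b = b then k - p b else 0) :: free_elt"
  let ?A = "\<lambda>a b. Ugl_gen n (i a) (i b)
          \<oplus>\<^bsub>Ugl n\<^esub> (if a = b then [(k - a)] \<cdot>\<^bsub>Ugl n\<^esub> \<one>\<^bsub>Ugl n\<^esub> else \<zero>\<^bsub>Ugl n\<^esub>)"
  let ?t = "\<lambda>p. foldr (\<lambda>b x. ?e p b * x) [1..<k + 1] 1"
  have e: "?e p b \<in> free_set n \<and> ?A (p b) b = Ugl_class n (?e p b)" if "p permutes {1..k}" "b \<in> {1..k}" for p b
  proof -
    have "i (p b) \<in> {1..n}" "i b \<in> {1..n}"
      using i that permutes_in_image[OF that(1), of b] by auto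
    then have "letter (i (p b)) (i b) \<in> free_set n" "letter (i b) (i b) \<in> free_set n"
      by (simp_all only: free_set_letter)
    then show ?thesis
      by (simp add: Ugl_gen_eq Ugl_class_nat Ugl_class_zero Ugl_class_add)
  qed
  have fold: "foldr (\<lambda>b x. ?A (p b) b \<otimes>\<^bsub>Ugl n\<^esub> x) bs \<one>\<^bsub>Ugl n\<^esub> = Ugl_class n (foldr (\<lambda>b x. ?e p b * x) bs 1)
      \<and> foldr (\<lambda>b x. ?e p b * x) bs 1 \<in> free_set n"
    if p: "p permutes {1..k}" and "set bs \<subseteq> {1..k}" for p bs
    using that(2)
  proof (induction bs)
    case (Cons b bs)
    then have "b \<in> {1..k}" by simp
    note e = e[OF p this]
    show ?case
      using Cons e by (simp only: foldr.simps o_apply) (auto simp: Ugl_class_mult)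
  qed (simp add: Ugl_class_one)
  have t: "?t p \<in> free_set n" and fold': "foldr (\<lambda>b x. ?A (p b) b \<otimes>\<^bsub>Ugl n\<^esub> x) [1..<k + 1] \<one>\<^bsub>Ugl n\<^esub> = Ugl_class n (?t p)"
    if "p permutes {1..k}" for p
  proof -
    have "set [1..<k + 1] \<subseteq> {1..k}" by auto
    note * = fold[OF that this]
    show "?t p \<in> free_set n" using * by (rule conjunct2)
    show "foldr (\<lambda>b x. ?A (p b) b \<otimes>\<^bsub>Ugl n\<^esub> x) [1..<k + 1] \<one>\<^bsub>Ugl n\<^esub> = Ugl_class n (?t p)"
      using * by (rule conjunct1)
  qed
  have "cdet (Ugl n) k ?A = (\<Oplus>\<^bsub>Ugl n\<^esub>p\<in>{p. p permutes {1..k}}. Ugl_class n (of_int (sign p) * ?t p))"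
    unfolding cdet_def
  proof (rule U.finsum_cong')
    show "(\<lambda>p. Ugl_class n (of_int (sign p) * ?t p)) \<in> {p. p permutes {1..k}} \<rightarrow> carrier (Ugl n)"
    proof
      fix p assume "p \<in> {p. p permutes {1..k}}"
      then have "?t p \<in> free_set n" using t by blast
      then show "Ugl_class n (of_int (sign p) * ?t p) \<in> carrier (Ugl n)" by simp
    qed
    fix p assume "p \<in> {p. p permutes {1..k}}"
    then have p: "p permutes {1..k}" by simp
    show "[sign p] \<cdot>\<^bsub>Ugl n\<^esub> foldr (\<lambda>b x. ?A (p b) b \<otimes>\<^bsub>Ugl n\<^esub> x) [1..<k + 1] \<one>\<^bsub>Ugl n\<^esub> = Ugl_class n (of_int (sign p) * ?t p)"
      unfolding fold'[OF p] by (rule Ugl_class_sign[OF t[OF p]])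
  qed simp
  moreover have "(\<Oplus>\<^bsub>Ugl n\<^esub>p\<in>{p. p permutes {1..k}}. Ugl_class n (of_int (sign p) * ?t p)) = Ugl_class n (free_cdet k i)
      \<and> free_cdet k i \<in> free_set n"
    unfolding free_cdet_def
  proof (rule Ugl_class_finsum)
    fix p assume "p \<in> {p. p permutes {1..k}}"
    then have "?t p \<in> free_set n" using t by blast
    then show "of_int (sign p) * ?t p \<in> free_set n" by simp
  qed (simp add: finite_permutations)
  ultimately show ?thesis by simp
qed

lemma capelli_H_eq: "capelli_H n k = Ugl_class n (free_H n k)" and free_H_free_set: "free_H n k \<in> free_set n"
proof -
  have i: "i \<in> {1..k} \<rightarrow> {1..n}" if "i \<in> strict_tuples n k" for i
    using that by (auto simp: strict_tuples_def)
  have fin: "(\<Oplus>\<^bsub>Ugl n\<^esub>i\<in>strict_tuples n k. Ugl_class n (free_cdet k i)) = Ugl_class n (free_H n k) \<and> free_H n k \<in> free_set n"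
    unfolding free_H_def by (rule Ugl_class_finsum) (use cdet_Ugl[OF i] in auto)
  have "capelli_H n k = (\<Oplus>\<^bsub>Ugl n\<^esub>i\<in>strict_tuples n k. Ugl_class n (free_cdet k i))"
    unfolding capelli_H_def strict_tuples_def[symmetric]
    by (rule U.finsum_cong') (use cdet_Ugl[OF i] in auto)
  then show "capelli_H n k = Ugl_class n (free_H n k)" "free_H n k \<in> free_set n"
    using fin by auto
qed

lemma symbol_free_H: "symbol (free_H n k) = esym n k"
  by (simp add: free_H_def esym_def symbol_sum symbol_free_cdet strict_tuples_inj)

lemma zeta_capelli_H: "capelli_H n k \<in> zeta n"
  using free_H_free_set[of n k] by (simp add: capelli_H_eq center_iff_ad symbol_free_H ad_esym)

text \<open>The inductive form provides rule induction, by which both the existence of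
  decompositions and the agreement of two homomorphisms are later reduced to generators.\<close>

inductive_set capelli_alg :: "nat \<Rightarrow> free_elt set set" for n where
  scalar: "Ugl_scalar n c \<in> capelli_alg n"
| capelli_H: "1 \<le> k \<Longrightarrow> k \<le> n \<Longrightarrow> capelli_H n k \<in> capelli_alg n"
| add: "X \<in> capelli_alg n \<Longrightarrow> Y \<in> capelli_alg n \<Longrightarrow> X \<oplus>\<^bsub>Ugl n\<^esub> Y \<in> capelli_alg n"
| mult: "X \<in> capelli_alg n \<Longrightarrow> Y \<in> capelli_alg n \<Longrightarrow> X \<otimes>\<^bsub>Ugl n\<^esub> Y \<in> capelli_alg n"

lemma capelli_alg_zeta: "X \<in> capelli_alg n \<Longrightarrow> X \<in> zeta n"
  by (induction rule: capelli_alg.induct) (auto intro: zeta_scalar zeta_capelli_H zeta_add zeta_mult)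

section \<open>Lifting symmetric polynomials to the Capelli subalgebra\<close>

lemma abelianize_cst: "abelianize (cst c) = cst c"
  unfolding cst_def[of c, where 'k = "ix list"] abelianize_single by (simp add: zero_list_def)

text \<open>Multiplicativity holds for the commutative image, though not for the symbol; hence
  leading terms of products are products of leading terms.\<close>

lemma abelianize_mult: "abelianize (x * y) = abelianize x * abelianize y"
proof (rule additive_cong_single[of "\<lambda>x. abelianize (x * y)" "\<lambda>x. abelianize x * abelianize y"])
  fix w c
  show "abelianize (Poly_Mapping.single w c * y) = abelianize (Poly_Mapping.single w c) * abelianize y"
  proof (rule additive_cong_single[of "\<lambda>y. abelianize (Poly_Mapping.single w c * y)" "\<lambda>y. abelianize (Poly_Mapping.single w c) * abelianize y"])
    show "abelianize (Poly_Mapping.single w c * Poly_Mapping.single v d) = abelianize (Poly_Mapping.single w c) * abelianize (Poly_Mapping.single v d)" for v d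
      by (simp add: mult_single abelianize_single plus_list_def cst_mult mon_add ac_simps)
  qed (intro additive_compose[OF additive_abelianize] additive_intros)+
qed (intro additive_compose[OF additive_abelianize] additive_intros)+

lemma keys_letter_le: "Poly_Mapping.keys (letter i j + of_nat c) \<subseteq> {w. length w \<le> 1}"
proof (rule keys_add_subset)
  show "Poly_Mapping.keys (of_nat c :: free_elt) \<subseteq> {w. length w \<le> 1}"
    using keys_cst_subset[of "of_nat c", where 'a = "ix list"] by (auto simp: zero_list_def)
qed (simp add: letter_eq)

lemma keys_mult_length:
  fixes x y :: free_elt
  assumes "Poly_Mapping.keys x \<subseteq> {w. length w \<le> d}" "Poly_Mapping.keys y \<subseteq> {w. length w \<le> e}"
  shows "Poly_Mapping.keys (x * y) \<subseteq> {w. length w \<le> d + e}"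
  by (rule keys_mult_subset[OF assms]) (auto simp: plus_list_def)

lemma keys_free_H: "Poly_Mapping.keys (free_H n k) \<subseteq> {w. length w \<le> k}"
  unfolding free_H_def free_cdet_def
proof (intro keys_sum_subset)
  fix i p
  let ?f = "\<lambda>bs. foldr (\<lambda>b x. (letter (i (p b)) (i b) + of_nat (if p b = b then k - p b else 0)) * x) bs 1"
  have "Poly_Mapping.keys (?f bs) \<subseteq> {w. length w \<le> length bs}" for bs
  proof (induction bs)
    case Nil
    then show ?case using keys_cst_subset[of 1, where 'a = "ix list"] by (auto simp: zero_list_def)
  next
    case (Cons b bs)
    have len: "length (b # bs) = 1 + length bs" by simp
    show ?case
      unfolding len foldr.simps o_apply by (rule keys_mult_length[OF keys_letter_le Cons])
  qed
  from this[of "[1..<k + 1]"] have "Poly_Mapping.keys (?f [1..<k + 1]) \<subseteq> {w. length w \<le> k}"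
    by simp
  from keys_cst_mult_subset[OF this, of "of_int (sign p)"]
  show "Poly_Mapping.keys (of_int (sign p) * ?f [1..<k + 1]) \<subseteq> {w. length w \<le> k}"
    by simp
qed

lemma keys_symbol_vars:
  assumes "x \<in> free_set n"
  shows "Poly_Mapping.keys (symbol x) \<subseteq> {m. set_mset m \<subseteq> {1..n} \<times> {1..n}}"
  unfolding symbol_def
proof (rule keys_lin_ext_subset)
  fix w assume "w \<in> Poly_Mapping.keys x"
  then have "w \<in> words n" using assms by auto
  then show "Poly_Mapping.keys (foldr left_op w 1) \<subseteq> {m. set_mset m \<subseteq> {1..n} \<times> {1..n}}"
  proof (induction w)
    case Nil
    then show ?case using keys_cst_subset[of 1] by auto
  next
    case (Cons a w)
    then have a: "a \<in> {1..n} \<times> {1..n}" and IH: "Poly_Mapping.keys (foldr left_op w 1) \<subseteq> {m. set_mset m \<subseteq> {1..n} \<times> {1..n}}"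
      by (auto simp: words_def)
    have eq: "foldr left_op (a # w) 1 = var a * foldr left_op w 1 + der (unit_mult a) (foldr left_op w 1)"
      by (simp add: left_op_def)
    show ?case
      unfolding eq
    proof (rule keys_add_subset)
      show "Poly_Mapping.keys (var a * foldr left_op w 1) \<subseteq> {m. set_mset m \<subseteq> {1..n} \<times> {1..n}}"
        by (rule keys_mult_subset[OF _ IH, of _ "{{#a#}}"]) (use a in auto)
      show "Poly_Mapping.keys (der (unit_mult a) (foldr left_op w 1)) \<subseteq> {m. set_mset m \<subseteq> {1..n} \<times> {1..n}}"
      proof (rule keys_der_subset, rule keys_unit_mult_mult)
        fix m v assume "m \<in> Poly_Mapping.keys (foldr left_op w 1)" "v \<in># m"
        then have "set_mset m \<subseteq> {1..n} \<times> {1..n}" "v \<in> {1..n} \<times> {1..n}" using IH by auto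
        then show "add_mset (fst a, snd v) (m - {#v#}) \<in> {m. set_mset m \<subseteq> {1..n} \<times> {1..n}}"
          using a by (auto dest: in_diffD)
      qed
    qed
  qed
qed

text \<open>Elementary symmetric polynomials are replaced by Capelli elements. The witness
  \<open>p\<close> is homogeneous of degree \<open>d\<close> and restricts to \<open>q\<close> on
  diagonal matrices; the lift \<open>x\<close> agrees with it only up to terms of lower degree,
  which is all that survives multiplication.\<close>

lemma elsym_gen_lift_capelli:
  assumes "elsym_gen {1..n} d q"
  shows "\<exists>x p. x \<in> free_set n \<and> Ugl_class n x \<in> capelli_alg n \<and> Poly_Mapping.keys x \<subseteq> {w. length w \<le> d}
     \<and> Poly_Mapping.keys p \<subseteq> {m. size m = d} \<and> deg_lt d (abelianize x - p) \<and> poly_subst diag_var p = q"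
  using assms
proof induction
  case (zero d)
  show ?case
    using capelli_alg.scalar[of n 0]
    by (intro exI[of _ 0]) (simp add: Ugl_scalar_eq additive.zero[OF additive_abelianize] poly_subst.psubst_0)
next
  case (cst c)
  show ?case
    using capelli_alg.scalar[of n c] keys_cst_subset[of c, where 'a = "ix list"] keys_cst_subset[of c, where 'a = "ix multiset"]
    by (intro exI[of _ "cst c"]) (auto simp: Ugl_scalar_eq poly_subst.psubst_cst abelianize_cst zero_list_def)
next
  case (elsym k)
  have "deg_lt k (- (symbol (free_H n k) - abelianize (free_H n k)))"
    using symbol_leading[OF keys_free_H] by (simp only: keys_uminus)
  then show ?case
    using free_H_free_set[of n k] keys_free_H[of n k] homog_esym[of n k] capelli_alg.capelli_H[of k n] elsym
    by (intro exI[of _ "free_H n k"] exI[of _ "esym n k"])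
      (auto simp: capelli_H_eq symbol_free_H subst_diag_esym)
next
  case (add d q q')
  then obtain x p x' p' where *:
    "x \<in> free_set n" "Ugl_class n x \<in> capelli_alg n" "Poly_Mapping.keys x \<subseteq> {w. length w \<le> d}"
    "Poly_Mapping.keys p \<subseteq> {m. size m = d}" "deg_lt d (abelianize x - p)" "poly_subst diag_var p = q"
    "x' \<in> free_set n" "Ugl_class n x' \<in> capelli_alg n" "Poly_Mapping.keys x' \<subseteq> {w. length w \<le> d}"
    "Poly_Mapping.keys p' \<subseteq> {m. size m = d}" "deg_lt d (abelianize x' - p')" "poly_subst diag_var p' = q'"
    by (elim exE conjE)
  have "deg_lt d ((abelianize x - p) + (abelianize x' - p'))"
    using * by (intro keys_add_subset)
  then have "deg_lt d (abelianize (x + x') - (p + p'))"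
    by (simp add: additive.add[OF additive_abelianize] algebra_simps)
  moreover have "Ugl_class n (x + x') \<in> capelli_alg n"
    using capelli_alg.add[OF *(2,8)] * by (simp add: Ugl_class_add)
  moreover have "poly_subst diag_var (p + p') = q + q'" using * by (simp add: poly_subst.psubst_add)
  ultimately show ?case
    using * by (intro exI[of _ "x + x'"] exI[of _ "p + p'"] conjI keys_add_subset free_set_add)
next
  case (mult d q e q')
  then obtain x p x' p' where *:
    "x \<in> free_set n" "Ugl_class n x \<in> capelli_alg n" "Poly_Mapping.keys x \<subseteq> {w. length w \<le> d}"
    "Poly_Mapping.keys p \<subseteq> {m. size m = d}" "deg_lt d (abelianize x - p)" "poly_subst diag_var p = q"
    "x' \<in> free_set n" "Ugl_class n x' \<in> capelli_alg n" "Poly_Mapping.keys x' \<subseteq> {w. length w \<le> e}"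
    "Poly_Mapping.keys p' \<subseteq> {m. size m = e}" "deg_lt e (abelianize x' - p')" "poly_subst diag_var p' = q'"
    by (elim exE conjE)
  have keys_ab: "Poly_Mapping.keys (abelianize x) \<subseteq> {m. size m \<le> d}"
    using keys_add_subset[of p "{m. size m \<le> d}" "abelianize x - p"] *(4,5) by fastforce
  \<comment> \<open>The difference of the two products is split so that each summand has one factor
    of lower degree.\<close>
  have "deg_lt (d + e) (abelianize x * (abelianize x' - p') + (abelianize x - p) * p')"
    using keys_ab *(4,5,10,11) by (intro keys_add_subset keys_mult_subset[of _ _ _ _ "{m. size m < d + e}"]) auto
  then have "deg_lt (d + e) (abelianize (x * x') - p * p')"
    by (simp add: abelianize_mult algebra_simps)
  moreover have "Ugl_class n (x * x') \<in> capelli_alg n"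
    using capelli_alg.mult[OF *(2,8)] * by (simp add: Ugl_class_mult)
  moreover have "poly_subst diag_var (p * p') = q * q'" using * by (simp add: poly_subst.psubst_mult)
  moreover have "Poly_Mapping.keys (p * p') \<subseteq> {m. size m = d + e}"
    by (rule keys_mult_subset[OF *(4,10)]) auto
  ultimately show ?case
    using * by (intro exI[of _ "x * x'"] exI[of _ "p * p'"] conjI keys_mult_length free_set_mult)
qed

text \<open>The top degree part of the symbol of a central element is an invariant, so it is determined by a symmetric
  polynomial; subtracting the corresponding polynomial in the Capelli elements lowers the degree.\<close>

theorem zeta_eq_capelli_alg: "zeta n = capelli_alg n"
proof
  show "capelli_alg n \<subseteq> zeta n" using capelli_alg_zeta by blast
  have "Ugl_class n x \<in> capelli_alg n"
    if "x \<in> free_set n" "\<And>a. a \<in> {1..n} \<times> {1..n} \<Longrightarrow> ad a (symbol x) = 0" "deg_lt d (symbol x)" for d x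
    using that
  proof (induction d arbitrary: x)
    case 0
    then have "symbol x = symbol (cst 0)" by simp
    then have "Ugl_class n x = Ugl_class n (cst 0)"
      using 0 Ugl_class_eq_iff[of x n "cst 0"] by simp
    then show ?case using capelli_alg.scalar[of n 0] by (simp add: Ugl_scalar_eq)
  next
    case (Suc d)
    let ?P = "poly_subst diag_var (symbol x)"
    \<comment> \<open>The homogeneous component of degree \<open>d\<close> of the diagonal
      restriction. It is the part that the lift has to reproduce.\<close>
    define q where "q = lin_ext cst (\<lambda>m. if size m = d then mon m else 0) ?P"
    have lookup_q: "Poly_Mapping.lookup q m = (if size m = d then Poly_Mapping.lookup ?P m else 0)" for m
    proof -
      have "Poly_Mapping.lookup q m = (\<Sum>k\<in>Poly_Mapping.keys ?P. if k = m then (if size m = d then Poly_Mapping.lookup ?P m else 0) else 0)"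
        unfolding q_def lin_ext_def lookup_sum lookup_cst_mult
        by (rule sum.cong) (auto simp: mon_def lookup_single when_def)
      then show ?thesis
        by (auto simp: not_in_keys_iff_lookup_eq_zero)
    qed
    have "homog {1..n} d q"
    proof
      fix m assume "m \<in> Poly_Mapping.keys q"
      then have m: "size m = d" "diag_mset m \<in> Poly_Mapping.keys (symbol x)"
        by (auto simp: in_keys_iff lookup_q lookup_subst_diag split: if_splits)
      then have "set_mset (diag_mset m) \<subseteq> {1..n} \<times> {1..n}"
        using keys_symbol_vars[OF Suc.prems(1)] by blast
      then show "m \<in> {m. set_mset m \<subseteq> {1..n} \<and> size m = d}" using m by auto
    qed
    moreover have "symmetric_in {1..n} q"
      unfolding symmetric_in_def
    proof (intro ballI poly_mapping_eqI)
      fix i j m assume ij: "i \<in> {1..n}" "j \<in> {1..n}"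
      let ?t = "Transposition.transpose i j"
      have "rename ?t ?P = ?P"
        using Suc.prems(2) ij by (intro subst_diag_symmetric) auto
      then have *: "Poly_Mapping.lookup ?P (image_mset ?t m) = Poly_Mapping.lookup ?P m" for m
        using lookup_rename[of ?t ?P m] by simp
      have m: "m = image_mset ?t (image_mset ?t m)"
        by (simp add: image_mset.compositionality o_def)
      have "Poly_Mapping.lookup (rename ?t q) m = Poly_Mapping.lookup q (image_mset ?t m)"
        by (subst m, subst lookup_rename) simp_all
      then show "Poly_Mapping.lookup (rename ?t q) m = Poly_Mapping.lookup q m"
        by (simp add: lookup_q *)
    qed
    ultimately have "elsym_gen {1..n} d q"
      by (intro fundamental_symmetric) simp_all
    then obtain x' p where x': "x' \<in> free_set n" "Ugl_class n x' \<in> capelli_alg n" "Poly_Mapping.keys x' \<subseteq> {w. length w \<le> d}"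
      "Poly_Mapping.keys p \<subseteq> {m. size m = d}" "deg_lt d (abelianize x' - p)" "poly_subst diag_var p = q"
      using elsym_gen_lift_capelli by blast
    have ad': "ad a (symbol x') = 0" if "a \<in> {1..n} \<times> {1..n}" for a
      using capelli_alg_zeta[OF x'(2)] x'(1) that center_iff_ad by blast
    let ?y = "x - x'"
    have y: "?y \<in> free_set n" using Suc.prems(1) x'(1) by simp
    have lower: "deg_lt d (symbol x' - p)"
      using keys_add_subset[OF symbol_leading[OF x'(3)] x'(5)] by simp
    have ady: "ad a (symbol ?y) = 0" if "a \<in> {1..n} \<times> {1..n}" for a
      using Suc.prems(2)[OF that] ad'[OF that] additive.diff[OF additive_ad] by (simp add: symbol_diff)
    \<comment> \<open>In degree \<open>d\<close> the diagonal coefficients of \<open>x\<close> and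
      \<open>x'\<close> coincide by the choice of \<open>x'\<close>; invariance of the difference
      extends this to all coefficients of degree \<open>d\<close>.\<close>
    have top: "Poly_Mapping.lookup (symbol ?y) m = 0" if "size m = d" for m
    proof (rule invariant_leading_eq_0[OF ady _ _ that])
      show "set_mset m \<subseteq> {1..n} \<times> {1..n}" if "m \<in> Poly_Mapping.keys (symbol ?y)" for m
        using keys_symbol_vars[OF y] that by blast
      fix M :: "nat multiset" assume M: "size M = d"
      have "Poly_Mapping.lookup (symbol x' - p) (diag_mset M) = 0"
        using lower M by (auto simp: in_keys_iff subset_iff)
      then have "Poly_Mapping.lookup (symbol x') (diag_mset M) = Poly_Mapping.lookup p (diag_mset M)"
        by (simp add: lookup_minus)
      also have "\<dots> = Poly_Mapping.lookup (symbol x) (diag_mset M)"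
        using lookup_q[of M] M by (simp add: x'(6)[symmetric] lookup_subst_diag)
      finally show "Poly_Mapping.lookup (symbol ?y) (diag_mset M) = 0"
        by (simp add: symbol_diff lookup_minus)
    qed
    have "deg_lt d (symbol ?y)"
    proof
      fix m assume m: "m \<in> Poly_Mapping.keys (symbol ?y)"
      have "deg_lt (Suc d) (symbol x')"
        using keys_add_subset[of "symbol x' - p" "{m. size m < Suc d}" p] lower x'(4) by fastforce
      then have "deg_lt (Suc d) (symbol ?y)"
        unfolding symbol_diff using Suc.prems(3) by (intro keys_diff_subset)
      moreover have "size m \<noteq> d" using top[of m] m by (auto simp: in_keys_iff)
      ultimately show "m \<in> {m. size m < d}" using m by auto
    qed
    then have "Ugl_class n ?y \<in> capelli_alg n"
      using y ady by (intro Suc.IH)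
    then have "Ugl_class n ?y \<oplus>\<^bsub>Ugl n\<^esub> Ugl_class n x' \<in> capelli_alg n"
      using x'(2) by (rule capelli_alg.add)
    then show ?case using y x'(1) by (simp add: Ugl_class_add)
  qed
  note gen = this
  show "zeta n \<subseteq> capelli_alg n"
  proof
    fix X assume "X \<in> zeta n"
    then obtain x where x: "x \<in> free_set n" "X = Ugl_class n x" "\<And>a. a \<in> {1..n} \<times> {1..n} \<Longrightarrow> ad a (symbol x) = 0"
      using zeta_cases by metis
    have "finite (size ` Poly_Mapping.keys (symbol x))" by simp
    then obtain d where "\<forall>k\<in>size ` Poly_Mapping.keys (symbol x). k < d"
      by (metis finite_nat_set_iff_bounded)
    then have "deg_lt d (symbol x)" by auto
    then show "X \<in> capelli_alg n" using gen[OF x(1,3)] x(2) by simp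
  qed
qed

section \<open>The Olshanski projection\<close>

lemma free_set_Suc: "x \<in> free_set n \<Longrightarrow> x \<in> free_set (n + 1)"
proof -
  have "words n \<subseteq> words (n + 1)"
    unfolding words_def by (rule lists_mono) auto
  then show "x \<in> free_set n \<Longrightarrow> x \<in> free_set (n + 1)" by blast
qed

text \<open>As \<open>symbol\<close> is independent of \<open>n\<close>, elements with the same
  class for \<open>n\<close> have the same class for \<open>n + 1\<close>. The image under the coset
  map is therefore a singleton, as \<open>the_elem\<close> requires.\<close>

lemma Ugl_embed_class:
  assumes "x \<in> free_set n"
  shows "Ugl_embed n (Ugl_class n x) = Ugl_class (n + 1) x"
proof -
  have "Ugl_class (n + 1) y = Ugl_class (n + 1) x" if y: "y \<in> Ugl_class n x" for y
    using in_class_symbol[OF y] free_set_Suc[OF in_class_free_set[OF y assms]] free_set_Suc[OF assms]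
      Ugl_class_eq_iff[of y "n + 1" x] by blast
  then have "Ugl_class (n + 1) ` Ugl_class n x = (\<lambda>_. Ugl_class (n + 1) x) ` Ugl_class n x"
    by (rule image_cong[OF refl])
  also have "\<dots> = {Ugl_class (n + 1) x}"
    using Ugl_class_self[of x n] by blast
  finally show ?thesis
    by (simp add: Ugl_embed_def Ugl_class_def[abs_def])
qed

section \<open>The left ideal of the last column\<close>

lemma left_ideal_genleftideal:
  assumes "ring G" "S \<subseteq> carrier G"
  shows "left_ideal (genleftideal G S) G"
proof -
  interpret ring G by fact
  let ?F = "{J. left_ideal J G \<and> S \<subseteq> J}"
  have "left_ideal (carrier G) G"
    unfolding left_ideal_def
    by (auto intro: additive_subgroupI add.subgroup_self)
  then have mem: "carrier G \<in> ?F" using assms(2) by blast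
  have sub: "\<And>J. J \<in> ?F \<Longrightarrow> subgroup J (add_monoid G)"
    by (simp add: left_ideal_def additive_subgroup_def)
  have "subgroup (\<Inter>?F) (add_monoid G)"
    by (rule add.subgroups_Inter[OF sub]) (use mem in blast)+
  then show ?thesis
    unfolding genleftideal_def left_ideal_def
    by (auto simp: additive_subgroup_def left_ideal_def)
qed

lemma olshanski_ideal_left_ideal: "left_ideal (olshanski_ideal m) (Ugl m)"
  unfolding olshanski_ideal_def
proof (rule left_ideal_genleftideal[OF ring_Ugl], rule subsetI)
  fix X assume "X \<in> {Ugl_gen m i m | i. i \<in> {1..m}}"
  then obtain i where i: "X = Ugl_class m (letter i m)" "i \<in> {1..m}" by (auto simp: Ugl_gen_eq)
  then have "letter i m \<in> free_set m" by (intro free_set_letter) auto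
  then show "X \<in> carrier (Ugl m)" unfolding i(1) by (rule Ugl_class_carrier)
qed

lemma olshanski_ideal_additive: "additive_subgroup (olshanski_ideal m) (Ugl m)"
  using olshanski_ideal_left_ideal[of m] by (simp add: left_ideal_def)

lemmas olshanski_ideal_subset = additive_subgroup.a_subset[OF olshanski_ideal_additive]
  and olshanski_ideal_add = additive_subgroup.a_closed[OF olshanski_ideal_additive]
  and olshanski_ideal_zero = additive_subgroup.zero_closed[OF olshanski_ideal_additive]

lemma olshanski_ideal_mult: "Y \<in> carrier (Ugl m) \<Longrightarrow> X \<in> olshanski_ideal m \<Longrightarrow> Y \<otimes>\<^bsub>Ugl m\<^esub> X \<in> olshanski_ideal m"
  using olshanski_ideal_left_ideal[of m] unfolding left_ideal_def by blast

lemma olshanski_ideal_gen: "i \<in> {1..m} \<Longrightarrow> Ugl_class m (letter i m) \<in> olshanski_ideal m"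
  unfolding olshanski_ideal_def genleftideal_def by (auto simp: Ugl_gen_eq)

abbreviation has_column :: "nat \<Rightarrow> ix multiset set" where
  "has_column m \<equiv> {l. \<exists>v\<in>#l. snd v = m}"

text \<open>Left multiplication by a matrix unit changes the row of a variable and keeps its column.
  Hence a factor from column \<open>m\<close> survives even when the derivation hits it.\<close>

lemma has_column_left_op:
  assumes "Poly_Mapping.keys p \<subseteq> has_column m"
  shows "Poly_Mapping.keys (left_op a p) \<subseteq> has_column m"
  unfolding left_op_def
proof (rule keys_add_subset)
  show "Poly_Mapping.keys (var a * p) \<subseteq> has_column m"
    by (rule keys_mult_subset[OF _ assms, of _ UNIV]) auto
  show "Poly_Mapping.keys (der (unit_mult a) p) \<subseteq> has_column m"
  proof (rule keys_der_subset, rule keys_unit_mult_mult)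
    fix l v assume "l \<in> Poly_Mapping.keys p" "v \<in># l"
    then obtain w where w: "w \<in># l" "snd w = m" using assms by auto
    show "add_mset (fst a, snd v) (l - {#v#}) \<in> has_column m"
    proof (cases "w = v")
      case False
      then have "w \<in># l - {#v#}" using w(1) \<open>v \<in># l\<close> by (metis insert_DiffM insert_iff set_mset_add_mset_insert)
      then show ?thesis using w by auto
    qed (use w in simp)
  qed
qed

lemma has_column_mult:
  assumes "Poly_Mapping.keys (symbol x) \<subseteq> has_column m"
  shows "Poly_Mapping.keys (symbol (y * x)) \<subseteq> has_column m"
proof (induction rule: poly_mapping_single_induct[where p = y])
  fix w c
  have "Poly_Mapping.keys (foldr left_op w (symbol x)) \<subseteq> has_column m"
    by (induction w) (simp_all add: assms has_column_left_op)
  moreover have "Poly_Mapping.single w c * x = cst c * (mon w * x)"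
    by (simp only: cst_mult_mon[symmetric] mult.assoc)
  ultimately show "Poly_Mapping.keys (symbol (Poly_Mapping.single w c * x)) \<subseteq> has_column m"
    by (simp only: symbol_cst_mult symbol_mon_mult keys_cst_mult_subset)
next
  fix p q assume "Poly_Mapping.keys (symbol (p * x)) \<subseteq> has_column m" "Poly_Mapping.keys (symbol (q * x)) \<subseteq> has_column m"
  then show "Poly_Mapping.keys (symbol ((p + q) * x)) \<subseteq> has_column m"
    unfolding distrib_right symbol_add by (rule keys_add_subset)
qed simp

text \<open>The classes having a representative with this property form a left ideal that contains
  the generators. The property passes to every representative because the symbol is determined by
  the class.\<close>

lemma olshanski_ideal_has_column:
  assumes "Ugl_class m x \<in> olshanski_ideal m" "x \<in> free_set m"
  shows "Poly_Mapping.keys (symbol x) \<subseteq> has_column m"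
proof -
  let ?S = "{x. x \<in> free_set m \<and> Poly_Mapping.keys (symbol x) \<subseteq> has_column m}"
  have "left_ideal (Ugl_class m ` ?S) (Ugl m)"
    unfolding left_ideal_def
  proof
    show "additive_subgroup (Ugl_class m ` ?S) (Ugl m)"
    proof (rule additive_subgroup.intro, rule U.add.subgroupI)
      show "Ugl_class m ` ?S \<subseteq> carrier (Ugl m)" by auto
      have "0 \<in> ?S" by simp
      then show "Ugl_class m ` ?S \<noteq> {}" by blast
      fix X assume "X \<in> Ugl_class m ` ?S"
      then obtain x where x: "x \<in> ?S" "X = Ugl_class m x" by blast
      then have "- x \<in> ?S" by (simp add: symbol_minus)
      moreover have "\<ominus>\<^bsub>Ugl m\<^esub> X = Ugl_class m (- x)"
        using x by (simp add: Ugl_class_uminus)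
      ultimately show "\<ominus>\<^bsub>Ugl m\<^esub> X \<in> Ugl_class m ` ?S" by blast
      fix Y assume "Y \<in> Ugl_class m ` ?S"
      then obtain y where y: "y \<in> ?S" "Y = Ugl_class m y" by blast
      have "Poly_Mapping.keys (symbol (x + y)) \<subseteq> has_column m"
        unfolding symbol_add using x y by (intro keys_add_subset) blast+
      then have "x + y \<in> ?S" using x y by simp
      moreover have "X \<oplus>\<^bsub>Ugl m\<^esub> Y = Ugl_class m (x + y)"
        using x y by (simp add: Ugl_class_add)
      ultimately show "X \<oplus>\<^bsub>Ugl m\<^esub> Y \<in> Ugl_class m ` ?S" by blast
    qed
    show "\<forall>r\<in>carrier (Ugl m). \<forall>X\<in>Ugl_class m ` ?S. r \<otimes>\<^bsub>Ugl m\<^esub> X \<in> Ugl_class m ` ?S"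
    proof (intro ballI)
      fix r X assume "r \<in> carrier (Ugl m)" "X \<in> Ugl_class m ` ?S"
      then obtain y x where *: "y \<in> free_set m" "r = Ugl_class m y" "x \<in> ?S" "X = Ugl_class m x"
        by (auto simp: carrier_Ugl)
      have "y * x \<in> ?S"
        using * has_column_mult[of x m y] by simp
      moreover have "r \<otimes>\<^bsub>Ugl m\<^esub> X = Ugl_class m (y * x)"
        using * by (simp add: Ugl_class_mult)
      ultimately show "r \<otimes>\<^bsub>Ugl m\<^esub> X \<in> Ugl_class m ` ?S" by blast
    qed
  qed
  moreover have "{Ugl_gen m i m | i. i \<in> {1..m}} \<subseteq> Ugl_class m ` ?S"
  proof
    fix X assume "X \<in> {Ugl_gen m i m | i. i \<in> {1..m}}"
    then obtain i where i: "X = Ugl_class m (letter i m)" "i \<in> {1..m}" by (auto simp: Ugl_gen_eq)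
    then have "letter i m \<in> free_set m" by (intro free_set_letter) auto
    moreover have "symbol (letter i m) = var (i, m)"
      using symbol_letter_mult[of "(i, m)" 1] by (simp add: letter_eq left_op_1)
    ultimately show "X \<in> Ugl_class m ` ?S" using i by auto
  qed
  ultimately have "olshanski_ideal m \<subseteq> Ugl_class m ` ?S"
    unfolding olshanski_ideal_def genleftideal_def by blast
  then obtain y where y: "y \<in> ?S" "Ugl_class m x = Ugl_class m y"
    using assms(1) by blast
  then have "symbol x = symbol y"
    using Ugl_class_eq_iff[of x m y] assms(2) by blast
  then show ?thesis using y by simp
qed

text \<open>For central \<open>r\<close> the difference automatically commutes with \<open>e\<close> at \<open>(n + 1, n + 1)\<close>, so membership in the left
  ideal suffices.\<close>

definition olshanski_rel :: "nat \<Rightarrow> free_elt set \<Rightarrow> free_elt set \<Rightarrow> bool" where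
  "olshanski_rel n r r' \<longleftrightarrow> r \<in> zeta (n + 1) \<and> r' \<in> zeta n \<and>
     (\<exists>x y. x \<in> free_set (n + 1) \<and> y \<in> free_set n \<and> r = Ugl_class (n + 1) x \<and> r' = Ugl_class n y
        \<and> Ugl_class (n + 1) (x - y) \<in> olshanski_ideal (n + 1))"

section \<open>The decomposition as a relation\<close>

lemma olshanski_rel_unique:
  assumes "olshanski_rel n r r1" "olshanski_rel n r r2"
  shows "r1 = r2"
proof -
  obtain x y x' y' where *: "x \<in> free_set (n + 1)" "y \<in> free_set n" "r = Ugl_class (n + 1) x" "r1 = Ugl_class n y"
    "Ugl_class (n + 1) (x - y) \<in> olshanski_ideal (n + 1)"
    "x' \<in> free_set (n + 1)" "y' \<in> free_set n" "r = Ugl_class (n + 1) x'" "r2 = Ugl_class n y'"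
    "Ugl_class (n + 1) (x' - y') \<in> olshanski_ideal (n + 1)"
    using assms unfolding olshanski_rel_def by blast
  note y = free_set_Suc[OF *(2)] free_set_Suc[OF *(7)]
  have "symbol x = symbol x'"
    using *(1,3,6,8) Ugl_class_eq_iff by blast
  then have eq: "symbol (y - y') = symbol (x' - y') - symbol (x - y)"
    by (simp add: symbol_diff)
  have sub: "Poly_Mapping.keys (symbol (y - y')) \<subseteq> has_column (n + 1)"
    unfolding eq by (intro keys_diff_subset olshanski_ideal_has_column free_set_diff * y)
  have "Poly_Mapping.keys (symbol (y - y')) \<subseteq> {m. set_mset m \<subseteq> {1..n} \<times> {1..n}}"
    using *(2,7) by (intro keys_symbol_vars free_set_diff)
  then have "Poly_Mapping.keys (symbol (y - y')) = {}"
    using sub by fastforce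
  then have "symbol y = symbol y'" by (simp add: symbol_diff)
  then show ?thesis using * Ugl_class_eq_iff by blast
qed

text \<open>Only the centralizer condition on \<open>x - y\<close> needs an argument:
  \<open>x\<close> is central, and the symbol of \<open>y\<close> involves indices up to
  \<open>n\<close> only, so the derivation attached to \<open>(n + 1, n + 1)\<close> annihilates
  it.\<close>

lemma olshanski_rel_iff:
  assumes r: "r \<in> zeta (n + 1)"
  shows "olshanski_rel n r r' \<longleftrightarrow> r' \<in> zeta n \<and>
        (\<exists>r0\<in>olshanski_ideal0 (n + 1). r = Ugl_embed n r' \<oplus>\<^bsub>Ugl (n + 1)\<^esub> r0)"
proof
  assume "olshanski_rel n r r'"
  then obtain x y where *: "r' \<in> zeta n" "x \<in> free_set (n + 1)" "y \<in> free_set n" "r = Ugl_class (n + 1) x" "r' = Ugl_class n y"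
    "Ugl_class (n + 1) (x - y) \<in> olshanski_ideal (n + 1)"
    unfolding olshanski_rel_def by blast
  have y: "y \<in> free_set (n + 1)" using *(3) by (rule free_set_Suc)
  have e: "letter (n + 1) (n + 1) \<in> free_set (n + 1)" by (rule free_set_letter) auto
  let ?e = "(n + 1, n + 1)"
  have "left_op ?e (symbol y) = right_op ?e (symbol y)"
  proof -
    have "der (\<lambda>b. unit_mult ?e b - unit_mult b ?e) (symbol y) = 0"
    proof -
      have "(unit_mult ?e v - unit_mult v ?e) * mon (m - {#v#}) = 0" if "m \<in> Poly_Mapping.keys (symbol y)" "v \<in># m" for m v
      proof -
        have "set_mset m \<subseteq> {1..n} \<times> {1..n}" using keys_symbol_vars[OF *(3)] that(1) by blast
        then have "fst v \<noteq> n + 1" "snd v \<noteq> n + 1" using that(2) by auto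
        then show ?thesis by (simp add: unit_mult_def)
      qed
      then have "Poly_Mapping.keys (der (\<lambda>b. unit_mult ?e b - unit_mult b ?e) (symbol y)) \<subseteq> {}"
        by (intro keys_der_subset) simp
      then show ?thesis by simp
    qed
    then have "ad ?e (symbol y) = 0" by (simp only: ad_def)
    then show ?thesis by (simp add: ad_eq)
  qed
  moreover have "left_op ?e (symbol x) = right_op ?e (symbol x)"
    using r *(2,4) center_iff_ad[of x "n + 1"] by (auto simp: ad_eq)
  ultimately have "symbol (mon [?e] * (x - y)) = symbol ((x - y) * mon [?e])"
    by (simp add: symbol_letter_mult symbol_mult_letter symbol_diff left_op_diff right_op_diff)
  then have "Ugl_class (n + 1) ((x - y) * letter (n + 1) (n + 1)) = Ugl_class (n + 1) (letter (n + 1) (n + 1) * (x - y))"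
    using *(2) y e by (subst Ugl_class_eq_iff) (simp_all add: letter_eq)
  then have "Ugl_class (n + 1) (x - y) \<in> centralizer (Ugl (n + 1)) {Ugl_gen (n + 1) (n + 1) (n + 1)}"
    using *(2) y e by (simp add: centralizer_def Ugl_gen_eq Ugl_class_mult)
  then have "Ugl_class (n + 1) (x - y) \<in> olshanski_ideal0 (n + 1)"
    using *(6) by (simp add: olshanski_ideal0_def)
  moreover have "r = Ugl_embed n r' \<oplus>\<^bsub>Ugl (n + 1)\<^esub> Ugl_class (n + 1) (x - y)"
    using *(2-5) y by (simp add: Ugl_embed_class Ugl_class_add)
  ultimately show "r' \<in> zeta n \<and> (\<exists>r0\<in>olshanski_ideal0 (n + 1). r = Ugl_embed n r' \<oplus>\<^bsub>Ugl (n + 1)\<^esub> r0)"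
    using *(1) by blast
next
  assume "r' \<in> zeta n \<and> (\<exists>r0\<in>olshanski_ideal0 (n + 1). r = Ugl_embed n r' \<oplus>\<^bsub>Ugl (n + 1)\<^esub> r0)"
  then obtain r0 where r': "r' \<in> zeta n" and r0: "r0 \<in> olshanski_ideal (n + 1)"
    and req: "r = Ugl_embed n r' \<oplus>\<^bsub>Ugl (n + 1)\<^esub> r0"
    by (auto simp: olshanski_ideal0_def)
  obtain y where y: "y \<in> free_set n" "r' = Ugl_class n y"
    using zeta_cases[OF r'] by metis
  obtain z where z: "z \<in> free_set (n + 1)" "r0 = Ugl_class (n + 1) z"
    using r0 olshanski_ideal_subset[of "n + 1"] unfolding carrier_Ugl by blast
  have y': "y \<in> free_set (n + 1)" using y(1) by (rule free_set_Suc)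
  have "r = Ugl_class (n + 1) (y + z)"
    using req y y' z by (simp add: Ugl_embed_class Ugl_class_add)
  then show "olshanski_rel n r r'"
    unfolding olshanski_rel_def using r r' y y' z r0
    by (intro conjI exI[of _ "y + z"] exI[of _ y]) (simp_all add: free_set_add)
qed

lemma olshanski_rel_scalar: "olshanski_rel n (Ugl_scalar (n + 1) c) (Ugl_scalar n c)"
  unfolding olshanski_rel_def
  by (intro conjI zeta_scalar exI[of _ "cst c"])
    (use olshanski_ideal_zero[of "n + 1"] in \<open>simp_all add: Ugl_scalar_eq Ugl_class_zero\<close>)

lemma olshanski_rel_add:
  assumes "olshanski_rel n r r'" "olshanski_rel n s s'"
  shows "olshanski_rel n (r \<oplus>\<^bsub>Ugl (n + 1)\<^esub> s) (r' \<oplus>\<^bsub>Ugl n\<^esub> s')"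
proof -
  obtain x y u v where *: "x \<in> free_set (n + 1)" "y \<in> free_set n" "r = Ugl_class (n + 1) x" "r' = Ugl_class n y"
    "Ugl_class (n + 1) (x - y) \<in> olshanski_ideal (n + 1)"
    "u \<in> free_set (n + 1)" "v \<in> free_set n" "s = Ugl_class (n + 1) u" "s' = Ugl_class n v"
    "Ugl_class (n + 1) (u - v) \<in> olshanski_ideal (n + 1)"
    using assms unfolding olshanski_rel_def by blast
  have z: "r \<oplus>\<^bsub>Ugl (n + 1)\<^esub> s \<in> zeta (n + 1)" "r' \<oplus>\<^bsub>Ugl n\<^esub> s' \<in> zeta n"
    using assms by (simp_all add: olshanski_rel_def zeta_add)
  note s = free_set_Suc[OF *(2)] free_set_Suc[OF *(7)]
  have "Ugl_class (n + 1) ((x - y) + (u - v)) \<in> olshanski_ideal (n + 1)"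
    using olshanski_ideal_add[OF *(5,10)] *(1,6) s by (simp add: Ugl_class_add)
  moreover have "(x - y) + (u - v) = (x + u) - (y + v)" by simp
  ultimately show ?thesis
    unfolding olshanski_rel_def using * z
    by (intro conjI exI[of _ "x + u"] exI[of _ "y + v"]) (simp_all add: Ugl_class_add)
qed

text \<open>The ideal absorbs factors on the left only, so \<open>x * u - y * v\<close> has to
  become \<open>x * (u - v) + v * (x - y)\<close>. Moving \<open>v\<close> to the left is possible
  because it commutes with the central \<open>x\<close>, and with \<open>y\<close>, which is central
  for \<open>n\<close>.\<close>

lemma olshanski_rel_mult:
  assumes "olshanski_rel n r r'" "olshanski_rel n s s'"
  shows "olshanski_rel n (r \<otimes>\<^bsub>Ugl (n + 1)\<^esub> s) (r' \<otimes>\<^bsub>Ugl n\<^esub> s')"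
proof -
  obtain x y u v where *: "x \<in> free_set (n + 1)" "y \<in> free_set n" "r = Ugl_class (n + 1) x" "r' = Ugl_class n y"
    "Ugl_class (n + 1) (x - y) \<in> olshanski_ideal (n + 1)"
    "u \<in> free_set (n + 1)" "v \<in> free_set n" "s = Ugl_class (n + 1) u" "s' = Ugl_class n v"
    "Ugl_class (n + 1) (u - v) \<in> olshanski_ideal (n + 1)"
    using assms unfolding olshanski_rel_def by blast
  have z: "r \<otimes>\<^bsub>Ugl (n + 1)\<^esub> s \<in> zeta (n + 1)" "r' \<otimes>\<^bsub>Ugl n\<^esub> s' \<in> zeta n"
    using assms by (simp_all add: olshanski_rel_def zeta_mult)
  note s = free_set_Suc[OF *(2)] free_set_Suc[OF *(7)]
  have x: "symbol (x * v) = symbol (v * x)"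
    using zeta_commute[of r "n + 1" "Ugl_class (n + 1) v"] assms(1) *(1,3) s Ugl_class_eq_iff[of "x * v" "n + 1" "v * x"]
    by (simp add: olshanski_rel_def Ugl_class_mult)
  \<comment> \<open>Commutation is known in the enveloping algebra for \<open>n\<close>; as an
    equality of symbols it is valid for \<open>n + 1\<close> too.\<close>
  have y: "symbol (y * v) = symbol (v * y)"
    using zeta_commute[of r' n "Ugl_class n v"] assms(1) *(2,4,7) Ugl_class_eq_iff[of "y * v" n "v * y"]
    by (simp add: olshanski_rel_def Ugl_class_mult)
  have "Ugl_class (n + 1) (x * u - y * v) = Ugl_class (n + 1) (x * (u - v) + v * (x - y))"
    using *(1,6) s x y by (subst Ugl_class_eq_iff) (simp_all add: symbol_diff symbol_add algebra_simps)
  also have "\<dots> = Ugl_class (n + 1) x \<otimes>\<^bsub>Ugl (n + 1)\<^esub> Ugl_class (n + 1) (u - v) \<oplus>\<^bsub>Ugl (n + 1)\<^esub> Ugl_class (n + 1) v \<otimes>\<^bsub>Ugl (n + 1)\<^esub> Ugl_class (n + 1) (x - y)"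
    using *(1,6) s by (simp add: Ugl_class_add Ugl_class_mult)
  also have "\<dots> \<in> olshanski_ideal (n + 1)"
    using *(1,6) s by (intro olshanski_ideal_add olshanski_ideal_mult *(5,10) Ugl_class_carrier)
  finally show ?thesis
    unfolding olshanski_rel_def using * z
    by (intro conjI exI[of _ "x * u"] exI[of _ "y * v"]) (simp_all add: Ugl_class_mult)
qed

section \<open>Capelli elements modulo the left ideal\<close>

lemma strict_tuples_Suc:
  assumes "i \<in> strict_tuples (n + 1) k" "i \<notin> strict_tuples n k"
  shows "k \<ge> 1" "i k = n + 1"
proof -
  have i: "i \<in> {1..k} \<rightarrow>\<^sub>E {1..n + 1}" "strict_mono_on {1..k} i" "i \<notin> {1..k} \<rightarrow>\<^sub>E {1..n}"
    using assms by (auto simp: strict_tuples_def)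
  then obtain b where b: "b \<in> {1..k}" "i b \<notin> {1..n}"
    by (auto simp: PiE_iff)
  then have ib: "i b = n + 1" using i(1) by (fastforce simp: PiE_iff)
  show k: "k \<ge> 1" using b by simp
  then have "i k \<in> {1..n + 1}" using i(1) by (fastforce simp: PiE_iff)
  moreover have "i b \<le> i k"
    using strict_mono_onD[OF i(2), of b k] b k by (cases "b = k") auto
  ultimately show "i k = n + 1" using ib by simp
qed

lemma strict_tuples_mono: "strict_tuples n k \<subseteq> strict_tuples (n + 1) k"
  by (auto simp: strict_tuples_def PiE_iff)

lemma strict_tuples_empty: "n < k \<Longrightarrow> strict_tuples n k = {}"
proof (rule ccontr)
  assume "n < k" "strict_tuples n k \<noteq> {}"
  then obtain i where i: "i \<in> strict_tuples n k" by blast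
  then have "card (i ` {1..k}) = k" "i ` {1..k} \<subseteq> {1..n}"
    using card_image[OF strict_tuples_inj[OF i]] by (auto simp: strict_tuples_def)
  then show False using card_mono[of "{1..n}" "i ` {1..k}"] \<open>n < k\<close> by simp
qed

lemma foldr_mult: "foldr (\<lambda>b x. f b * x) bs z = foldr (\<lambda>b x. f b * x) bs 1 * z" for z :: "'r::monoid_mult"
  by (induction bs) (simp_all add: mult.assoc)

lemma Ugl_class_free_cdet_olshanski:
  assumes "i \<in> strict_tuples (n + 1) k" "i \<notin> strict_tuples n k"
  shows "Ugl_class (n + 1) (free_cdet k i) \<in> olshanski_ideal (n + 1)"
proof -
  note k = strict_tuples_Suc[OF assms]
  have iran: "i b \<in> {1..n + 1}" if "b \<in> {1..k}" for b
    using assms(1) that by (auto simp: strict_tuples_def)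
  let ?e = "\<lambda>p b. letter (i (p b)) (i b) + of_nat (if p b = b then k - p b else 0) :: free_elt"
  let ?z = "\<lambda>p. of_int (sign p) * foldr (\<lambda>b x. ?e p b * x) [1..<k] 1"
  let ?P = "{p. p permutes {1..k}}"
  have "free_cdet k i = (\<Sum>p\<in>?P. ?z p * letter (i (p k)) (n + 1))"
    unfolding free_cdet_def
  proof (rule sum.cong[OF refl])
    fix p
    \<comment> \<open>The shift in column \<open>k\<close> could appear only for
      \<open>p k = k\<close>, where it is \<open>k - k = 0\<close>. The last factor is therefore a
      single letter of column \<open>n + 1\<close>, at the right end where the left ideal needs
      it.\<close>
    have "?e p k = letter (i (p k)) (n + 1)" using k(2) by simp
    moreover have "[1..<k + 1] = [1..<k] @ [k]" using upt_Suc_append[OF k(1)] by (simp only: Suc_eq_plus1)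
    ultimately show "of_int (sign p) * foldr (\<lambda>b x. ?e p b * x) [1..<k + 1] 1 = ?z p * letter (i (p k)) (n + 1)"
      by (simp only: foldr_append foldr.simps o_apply id_apply mult_1_right mult.assoc
          foldr_mult[of "?e p" "[1..<k]" "letter (i (p k)) (n + 1)"])
  qed
  moreover have "Ugl_class (n + 1) (\<Sum>p\<in>Q. ?z p * letter (i (p k)) (n + 1)) \<in> olshanski_ideal (n + 1)
     \<and> (\<Sum>p\<in>Q. ?z p * letter (i (p k)) (n + 1)) \<in> free_set (n + 1)" if "finite Q" "Q \<subseteq> ?P" for Q
    using that
  proof (induction Q rule: finite_induct)
    case empty
    then show ?case using olshanski_ideal_zero[of "n + 1"] by (simp add: Ugl_class_zero)
  next
    case (insert p Q)
    then have p: "p permutes {1..k}" by simp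
    have pk: "i (p k) \<in> {1..n + 1}"
      using k(1) permutes_in_image[OF p, of k] by (intro iran) simp
    then have l: "letter (i (p k)) (n + 1) \<in> free_set (n + 1)"
      by (intro free_set_letter) auto
    have fold: "foldr (\<lambda>b x. ?e p b * x) bs 1 \<in> free_set (n + 1)" if "set bs \<subseteq> {1..k}" for bs
      using that
    proof (induction bs)
      case (Cons b bs)
      then have "i (p b) \<in> {1..n + 1}" "i b \<in> {1..n + 1}"
        using permutes_in_image[OF p, of b] by (auto intro!: iran simp del: atLeastAtMost_iff)
      then have "letter (i (p b)) (i b) \<in> free_set (n + 1)" by (rule free_set_letter)
      then have "?e p b \<in> free_set (n + 1)" by (rule free_set_add) (simp add: keys_words_of_nat)
      then show ?case using Cons unfolding foldr.simps o_apply by (intro free_set_mult) auto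
    qed (simp add: free_set_1)
    have "set [1..<k] \<subseteq> {1..k}" by auto
    then have "foldr (\<lambda>b x. ?e p b * x) [1..<k] 1 \<in> free_set (n + 1)" by (rule fold)
    then have z: "?z p \<in> free_set (n + 1)" by (intro free_set_mult) simp_all
    have "Ugl_class (n + 1) (?z p) \<otimes>\<^bsub>Ugl (n + 1)\<^esub> Ugl_class (n + 1) (letter (i (p k)) (n + 1)) \<in> olshanski_ideal (n + 1)"
      by (intro olshanski_ideal_mult Ugl_class_carrier z olshanski_ideal_gen pk)
    then have zl: "Ugl_class (n + 1) (?z p * letter (i (p k)) (n + 1)) \<in> olshanski_ideal (n + 1)"
      by (simp only: Ugl_class_mult[OF z l])
    have zl': "?z p * letter (i (p k)) (n + 1) \<in> free_set (n + 1)"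
      by (intro free_set_mult z l)
    have IH: "Ugl_class (n + 1) (\<Sum>p\<in>Q. ?z p * letter (i (p k)) (n + 1)) \<in> olshanski_ideal (n + 1)"
      "(\<Sum>p\<in>Q. ?z p * letter (i (p k)) (n + 1)) \<in> free_set (n + 1)"
      using insert by blast+
    show ?case
      unfolding sum.insert[OF insert.hyps]
      using olshanski_ideal_add[OF zl IH(1)] free_set_add[OF zl' IH(2)]
      by (simp only: Ugl_class_add[OF zl' IH(2)])
  qed
  ultimately show ?thesis
    using finite_permutations[of "{1..k}"] by simp
qed

text \<open>No bound on \<open>k\<close> is imposed: for \<open>k = n + 1\<close> there are no
  increasing tuples with values up to \<open>n\<close>, so \<open>free_H n k\<close> is an empty
  sum, and this gives the value 0 on the last Capelli element.\<close>

lemma olshanski_rel_capelli_H: "olshanski_rel n (capelli_H (n + 1) k) (Ugl_class n (free_H n k))"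
proof -
  let ?D = "strict_tuples (n + 1) k - strict_tuples n k"
  have "free_H (n + 1) k = free_H n k + (\<Sum>i\<in>?D. free_cdet k i)"
    unfolding free_H_def by (subst sum.subset_diff[OF strict_tuples_mono]) (simp_all add: add.commute)
  then have eq: "free_H (n + 1) k - free_H n k = (\<Sum>i\<in>?D. free_cdet k i)"
    by simp
  have "Ugl_class (n + 1) (\<Sum>i\<in>Q. free_cdet k i) \<in> olshanski_ideal (n + 1) \<and> (\<Sum>i\<in>Q. free_cdet k i) \<in> free_set (n + 1)"
    if "finite Q" "Q \<subseteq> ?D" for Q
    using that
  proof (induction Q rule: finite_induct)
    case empty
    then show ?case using olshanski_ideal_zero[of "n + 1"] by (simp add: Ugl_class_zero)
  next
    case (insert i Q)
    then have i: "i \<in> strict_tuples (n + 1) k" "i \<notin> strict_tuples n k" by auto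
    then have "i \<in> {1..k} \<rightarrow> {1..n + 1}" by (auto simp: strict_tuples_def)
    then have f: "free_cdet k i \<in> free_set (n + 1)"
      using cdet_Ugl by blast
    have IH: "Ugl_class (n + 1) (\<Sum>i\<in>Q. free_cdet k i) \<in> olshanski_ideal (n + 1)" "(\<Sum>i\<in>Q. free_cdet k i) \<in> free_set (n + 1)"
      using insert by blast+
    show ?case
      unfolding sum.insert[OF insert.hyps]
      using olshanski_ideal_add[OF Ugl_class_free_cdet_olshanski[OF i] IH(1)] free_set_add[OF f IH(2)]
      by (simp only: Ugl_class_add[OF f IH(2)])
  qed
  from this[of ?D] have "Ugl_class (n + 1) (free_H (n + 1) k - free_H n k) \<in> olshanski_ideal (n + 1)"
    unfolding eq by simp
  then show ?thesis
    unfolding olshanski_rel_def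
    using zeta_capelli_H[of "n + 1" k] zeta_capelli_H[of n k] free_H_free_set[of "n + 1" k] free_H_free_set[of n k]
    by (intro conjI exI[of _ "free_H (n + 1) k"] exI[of _ "free_H n k"]) (simp_all only: capelli_H_eq)
qed

text \<open>Rule induction over the generation of the center by Capelli elements: the relation holds
  for the generators and is preserved by the operations.\<close>

lemma olshanski_rel_ex: "r \<in> zeta (n + 1) \<Longrightarrow> \<exists>r'. olshanski_rel n r r'"
  unfolding zeta_eq_capelli_alg
  by (induction rule: capelli_alg.induct)
    (blast intro: olshanski_rel_scalar olshanski_rel_capelli_H olshanski_rel_add olshanski_rel_mult)+

lemma olshanski_proj_rel:
  assumes "r \<in> zeta (n + 1)"
  shows "olshanski_rel n r (olshanski_proj n r)"
proof -
  have "olshanski_proj n r = (THE r'. olshanski_rel n r r')"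
    using assms by (simp add: olshanski_proj_def olshanski_rel_iff)
  moreover have "\<exists>!r'. olshanski_rel n r r'"
    using olshanski_rel_ex[OF assms] olshanski_rel_unique by blast
  ultimately show ?thesis
    using theI'[of "olshanski_rel n r"] by simp
qed

lemma olshanski_proj_eqI:
  assumes "olshanski_rel n r r'"
  shows "olshanski_proj n r = r'"
proof (rule olshanski_rel_unique[OF olshanski_proj_rel assms])
  show "r \<in> zeta (n + 1)" using assms by (simp add: olshanski_rel_def)
qed

section \<open>Comparison of the two projections\<close>

lemma zeta_alg_simps [simp]:
  "carrier (zeta_alg n) = zeta n" "x \<otimes>\<^bsub>zeta_alg n\<^esub> y = x \<otimes>\<^bsub>Ugl n\<^esub> y" "x \<oplus>\<^bsub>zeta_alg n\<^esub> y = x \<oplus>\<^bsub>Ugl n\<^esub> y"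
  "\<one>\<^bsub>zeta_alg n\<^esub> = \<one>\<^bsub>Ugl n\<^esub>"
  by (simp_all add: zeta_alg_def)

lemma Ugl_scalar_1: "Ugl_scalar n 1 = \<one>\<^bsub>Ugl n\<^esub>"
  by (simp add: Ugl_scalar_eq Ugl_class_one)

lemma olshanski_proj_hom: "olshanski_proj n \<in> zeta_alg_homs (n + 1) n"
proof -
  have "olshanski_proj n \<in> ring_hom (zeta_alg (n + 1)) (zeta_alg n)"
  proof (rule ring_hom_memI)
    show "olshanski_proj n r \<in> carrier (zeta_alg n)" if "r \<in> carrier (zeta_alg (n + 1))" for r
      using olshanski_proj_rel[of r n] that by (simp add: olshanski_rel_def)
    show "olshanski_proj n \<one>\<^bsub>zeta_alg (n + 1)\<^esub> = \<one>\<^bsub>zeta_alg n\<^esub>"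
      using olshanski_proj_eqI[OF olshanski_rel_scalar[of n 1]] by (simp add: Ugl_scalar_1)
  qed (simp_all add: olshanski_proj_eqI olshanski_rel_add olshanski_rel_mult olshanski_proj_rel)
  moreover have "olshanski_proj n \<in> extensional (zeta (n + 1))"
    by (simp add: olshanski_proj_def)
  ultimately show ?thesis
    by (simp add: zeta_alg_homs_def olshanski_proj_eqI[OF olshanski_rel_scalar[simplified]])
qed

theorem proposition5p8:
  fixes n :: nat
  assumes "n \<ge> 1"
  shows "olshanski_proj n = capelli_proj n"
proof -
  let ?P = "\<lambda>h. h \<in> zeta_alg_homs (n + 1) n \<and>
        (\<forall>k\<in>{1..n}. h (capelli_H (n + 1) k) = capelli_H n k) \<and>
        h (capelli_H (n + 1) (n + 1)) = \<zero>\<^bsub>Ugl n\<^esub>"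
  have P: "?P (olshanski_proj n)"
  proof (intro conjI ballI olshanski_proj_hom)
    show "olshanski_proj n (capelli_H (n + 1) k) = capelli_H n k" for k
      using olshanski_rel_capelli_H by (intro olshanski_proj_eqI) (simp only: capelli_H_eq[of n])
    have "free_H n (n + 1) = 0"
      by (simp add: free_H_def strict_tuples_empty)
    then show "olshanski_proj n (capelli_H (n + 1) (n + 1)) = \<zero>\<^bsub>Ugl n\<^esub>"
      using olshanski_rel_capelli_H[of n "n + 1"] by (intro olshanski_proj_eqI) (simp only: Ugl_class_zero)
  qed
  have unique: "h = olshanski_proj n" if h: "?P h" for h
  proof -
    let ?g = "olshanski_proj n"
    have hom: "f \<in> ring_hom (zeta_alg (n + 1)) (zeta_alg n)" "f \<in> extensional (zeta (n + 1))"
      "f (Ugl_scalar (n + 1) c) = Ugl_scalar n c" if "?P f" for f c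
      using that by (simp_all add: zeta_alg_homs_def)
    have hom_add: "f (X \<oplus>\<^bsub>Ugl (n + 1)\<^esub> Y) = f X \<oplus>\<^bsub>Ugl n\<^esub> f Y"
      and hom_mult: "f (X \<otimes>\<^bsub>Ugl (n + 1)\<^esub> Y) = f X \<otimes>\<^bsub>Ugl n\<^esub> f Y"
      if "?P f" "X \<in> zeta (n + 1)" "Y \<in> zeta (n + 1)" for f X Y
      using ring_hom_add[OF hom(1)[OF that(1)]] ring_hom_mult[OF hom(1)[OF that(1)]] that(2,3) by simp_all
    have "h r = ?g r" if "r \<in> zeta (n + 1)" for r
      using that unfolding zeta_eq_capelli_alg
    proof induction
      case (scalar c)
      show ?case by (simp only: hom(3)[OF h] hom(3)[OF P])
    next
      case (capelli_H k)
      show ?case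
      proof (cases "k = n + 1")
        case True
        then show ?thesis using h P by simp
      next
        case False
        then have "k \<in> {1..n}" using capelli_H by simp
        then show ?thesis using h P by simp
      qed
    next
      case (add X Y)
      then show ?case
        by (simp only: hom_add[OF h] hom_add[OF P] capelli_alg_zeta)
    next
      case (mult X Y)
      then show ?case
        by (simp only: hom_mult[OF h] hom_mult[OF P] capelli_alg_zeta)
    qed
    \<comment> \<open>Agreement on the center is agreement everywhere, since both maps are
      extensional.\<close>
    then show ?thesis
      by (rule extensionalityI[OF hom(2)[OF h] hom(2)[OF P]])
  qed
  have "capelli_proj n = olshanski_proj n"
    unfolding capelli_proj_def by (rule the_equality[where P = ?P, OF P unique])
  then show ?thesis ..
qed

end
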